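(* Let $T=(V,E,F)$ be the standard hexagonal triangulation of the plane $\mathbb{C}$, let $l_0:E\to\mathbb{R}_{>0}$ be the constant PL metric $l_0\equiv 1$, and let $l:E\to\mathbb{R}_{>0}$ be a generalized PL metric on $T$ which is PL conformal to $l_0$. Suppose that $(T,l)$ is flat, complete (i.e. isometric to $(T,l_0)$) and Delaunay. Then there is a constant $C>0$ such that $l\equiv C$ on $E$.
   Context: Standard hexagonal triangulation: $T=(V,E,F)$ with $V=\{m+n\omega: m,n\in\mathbb{Z}\}\subset\mathbb{C}$, $\omega=\frac{1+\sqrt{-3}}{2}$; $ij\in E$ iff $|i-j|=1$; $F$ is the set of triples of pairwise adjacent vertices (the equilateral triangles of side 1). Each vertex has exactly six neighbours. A generalized PL metric is a function $l:E\to\mathbb{R}_{>0}$ such that for each face $ijk\in F$ the three numbers $l_{ij},l_{jk},l_{ki}$ satisfy the (non-strict) triangle inequalities, i.e. form a generalized Euclidean triangle (possibly degenerate); it is a PL metric if all triangle inequalities are strict. Angles of a generalized triangle are the usual Euclidean angles, extended continuously to degenerate triangles: if $l_{ab}=l_{bc}+l_{ca}$ then the angle at $c$ is $\pi$ and the angles at $a$ and $b$ are $0$. Write $\theta_{\angle kij}$ for the angle at $i$ in the triangle $kij$. A generalized PL metric induces in the natural manner (gluing the Euclidean triangles with the prescribed edge lengths along their common edges) an intrinsic distance and a flat cone metric on $T$, with discrete Gaussian curvature $K_i=2\pi-\sum_{kij\in F}\theta_{\angle kij}$ at the vertex $i$. Flat: $K_i=0$ for every $i\in V$. Complete: with the induced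 intrinsic distance, $(T,l)$ is isometric to $(T,l_0)$, i.e. to the Euclidean plane. Delaunay: for every edge $ij\in E$ with adjacent faces $ijk$ and $ijl$, the sum of the two opposite angles $\alpha_{ij}=\theta_{\angle ikj}+\theta_{\angle ilj}$ satisfies $\alpha_{ij}\le\pi$. PL conformal: generalized PL metrics $l,\tilde l$ on $T$ are PL conformal if there is a function $u:V\to\mathbb{R}$ with $\tilde l_{ij}=e^{u_i+u_j}l_{ij}$ for all $ij\in E$. *)

theory Defs
  imports "HOL-Analysis.Analysis"
begin

section \<open>The standard hexagonal triangulation\<close>

definition hex_omega :: complex where
  "hex_omega = (1 + \<i> * of_real (sqrt 3)) / 2"

definition hex_V :: "complex set" where
  "hex_V = {of_int m + of_int n * hex_omega | m n. True}"

definition hex_E :: "complex set set" where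
  "hex_E = {{i, j} | i j. i \<in> hex_V \<and> j \<in> hex_V \<and> dist i j = 1}"

definition hex_F :: "complex set set" where
  "hex_F = {{i, j, k} | i j k. {i, j} \<in> hex_E \<and> {j, k} \<in> hex_E \<and> {k, i} \<in> hex_E}"

section \<open>Generalized PL metrics\<close>

text \<open>
  A function on edges is a function on sets of vertices; only its values on \<^term>\<open>hex_E\<close> matter.
\<close>

definition generalized_PL_metric :: "(complex set \<Rightarrow> real) \<Rightarrow> bool" where
  "generalized_PL_metric l \<longleftrightarrow>
     (\<forall>e\<in>hex_E. l e > 0) \<and>
     (\<forall>i j k. {i, j, k} \<in> hex_F \<longrightarrow> l {i, j} \<le> l {j, k} + l {k, i})"

definition PL_conformal :: "(complex set \<Rightarrow> real) \<Rightarrow> (complex set \<Rightarrow> real) \<Rightarrow> bool" where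
  "PL_conformal l l' \<longleftrightarrow>
     (\<exists>u :: complex \<Rightarrow> real. \<forall>i j. {i, j} \<in> hex_E \<longrightarrow> l' {i, j} = exp (u i + u j) * l {i, j})"

definition unit_metric :: "complex set \<Rightarrow> real" where
  "unit_metric e = 1"

section \<open>Angles, curvature and the Delaunay condition\<close>

text \<open>
  The angle at the vertex \<open>i\<close> of the face \<open>f\<close>, by the law of cosines; \<open>f - {i}\<close> is the
  edge opposite to \<open>i\<close>.  This remains correct for degenerate triangles with positive
  edge lengths, where the argument of \<^const>\<open>arccos\<close> is \<open>-1\<close> opposite to the longest edge
  and \<open>1\<close> at the two other vertices.
\<close>

definition face_angle :: "(complex set \<Rightarrow> real) \<Rightarrow> complex set \<Rightarrow> complex \<Rightarrow> real" where
  "face_angle l f i =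
     arccos (((\<Sum>j\<in>f - {i}. (l {i, j})\<^sup>2) - (l (f - {i}))\<^sup>2) / (2 * (\<Prod>j\<in>f - {i}. l {i, j})))"

lemma face_angle_triple:
  assumes "i \<noteq> j" "j \<noteq> k" "k \<noteq> i"
  shows "face_angle l {i, j, k} i =
    arccos (((l {i, j})\<^sup>2 + (l {i, k})\<^sup>2 - (l {j, k})\<^sup>2) / (2 * (l {i, j} * l {i, k})))"
proof -
  have "{i, j, k} - {i} = {j, k}" using assms by auto
  then show ?thesis using assms by (simp add: face_angle_def)
qed

lemma face_angle_degenerate_pi:
  assumes "i \<noteq> j" "j \<noteq> k" "k \<noteq> i" "l {i, j} > 0" "l {i, k} > 0"
    and "l {j, k} = l {i, j} + l {i, k}"
  shows "face_angle l {i, j, k} i = pi"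
proof -
  have "((l {i, j})\<^sup>2 + (l {i, k})\<^sup>2 - (l {j, k})\<^sup>2) / (2 * (l {i, j} * l {i, k})) = -1"
    using assms by (simp add: field_simps power2_eq_square)
  then show ?thesis unfolding face_angle_triple[OF assms(1-3)] by (simp only: arccos_1 arccos_minus_1)
qed

lemma face_angle_degenerate_0:
  assumes "i \<noteq> j" "j \<noteq> k" "k \<noteq> i" "l {j, k} > 0" "l {i, k} > 0"
    and "l {i, j} = l {j, k} + l {i, k}"
  shows "face_angle l {i, j, k} i = 0"
proof -
  have "((l {i, j})\<^sup>2 + (l {i, k})\<^sup>2 - (l {j, k})\<^sup>2) / (2 * (l {i, j} * l {i, k})) = 1"
  proof -
    have "(l {i, j})\<^sup>2 + (l {i, k})\<^sup>2 - (l {j, k})\<^sup>2 = 2 * (l {i, j} * l {i, k})"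
      unfolding assms(6) by (simp add: algebra_simps power2_eq_square)
    moreover have "l {i, j} * l {i, k} > 0" using assms by simp
    ultimately show ?thesis by auto
  qed
  then show ?thesis unfolding face_angle_triple[OF assms(1-3)] by (simp only: arccos_1 arccos_minus_1)
qed

definition curvature :: "(complex set \<Rightarrow> real) \<Rightarrow> complex \<Rightarrow> real" where
  "curvature l i = 2 * pi - (\<Sum>f\<in>{f \<in> hex_F. i \<in> f}. face_angle l f i)"

definition flat_metric :: "(complex set \<Rightarrow> real) \<Rightarrow> bool" where
  "flat_metric l \<longleftrightarrow> (\<forall>i\<in>hex_V. curvature l i = 0)"

definition Delaunay :: "(complex set \<Rightarrow> real) \<Rightarrow> bool" where
  "Delaunay l \<longleftrightarrow>
     (\<forall>i j k k'. {i, j} \<in> hex_E \<and> {i, j, k} \<in> hex_F \<and> {i, j, k'} \<in> hex_F \<and> k \<noteq> k' \<longrightarrow>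
        face_angle l {i, j, k} k + face_angle l {i, j, k'} k' \<le> pi)"

section \<open>The induced intrinsic distance\<close>

text \<open>
  The underlying space of the triangulation is the whole plane \<^typ>\<open>complex\<close>, used here only as a
  parameter space: the closed face \<^term>\<open>convex hull f\<close> is given the geometry of the Euclidean
  triangle with edge lengths \<open>l\<close> by a real affine map that sends its vertices to those of such a
  triangle.  For a generalized PL metric such a map exists and is unique up to an isometry of
  the target, so that \<open>face_dist\<close> does not depend on the choice, and two faces agree on a common
  edge.  If the triangle is degenerate, the map is not injective on the face.
\<close>

definition realizes_face ::
    "(complex set \<Rightarrow> real) \<Rightarrow> complex set \<Rightarrow> (complex \<Rightarrow> complex) \<Rightarrow> bool" where
  "realizes_face l f \<phi> \<longleftrightarrow>
     linear (\<lambda>z. \<phi> z - \<phi> 0) \<and> (\<forall>v\<in>f. \<forall>w\<in>f. v \<noteq> w \<longrightarrow> dist (\<phi> v) (\<phi> w) = l {v, w})"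

definition face_dist ::
    "(complex set \<Rightarrow> real) \<Rightarrow> complex set \<Rightarrow> complex \<Rightarrow> complex \<Rightarrow> real" where
  "face_dist l f x y = (let \<phi> = (SOME \<phi>. realizes_face l f \<phi>) in dist (\<phi> x) (\<phi> y))"

text \<open>
  A polygonal path from \<open>x\<close> to \<open>y\<close>: the points \<open>p 0, \<dots>, p n\<close>, the \<open>m\<close>-th segment
  being contained in the closed face \<open>f m\<close>.
\<close>

definition face_path ::
    "complex \<Rightarrow> complex \<Rightarrow> nat \<Rightarrow> (nat \<Rightarrow> complex) \<Rightarrow> (nat \<Rightarrow> complex set) \<Rightarrow> bool" where
  "face_path x y n p f \<longleftrightarrow>
     p 0 = x \<and> p n = y \<and>
     (\<forall>m<n. f m \<in> hex_F \<and> p m \<in> convex hull (f m) \<and> p (Suc m) \<in> convex hull (f m))"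

definition intrinsic_dist :: "(complex set \<Rightarrow> real) \<Rightarrow> complex \<Rightarrow> complex \<Rightarrow> real" where
  "intrinsic_dist l x y =
     Inf {\<Sum>m<n. face_dist l (f m) (p m) (p (Suc m)) | n p f. face_path x y n p f}"

text \<open>
  Degenerate triangles make \<^term>\<open>intrinsic_dist l\<close> a pseudometric in general.  The glued space is
  the quotient identifying points at distance zero, and the following says that the two
  quotients are isometric.
\<close>

definition PL_isometric :: "(complex set \<Rightarrow> real) \<Rightarrow> (complex set \<Rightarrow> real) \<Rightarrow> bool" where
  "PL_isometric l l' \<longleftrightarrow>
     (\<exists>\<Phi> :: complex \<Rightarrow> complex.
        (\<forall>x y. intrinsic_dist l' (\<Phi> x) (\<Phi> y) = intrinsic_dist l x y) \<and>
        (\<forall>z. \<exists>x. intrinsic_dist l' z (\<Phi> x) = 0))"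

definition complete_PL_metric :: "(complex set \<Rightarrow> real) \<Rightarrow> bool" where
  "complete_PL_metric l \<longleftrightarrow> PL_isometric l unit_metric"

end

theory Submission
  imports Defs
begin

text \<open>
  Write \<open>X = exp (-2 u)\<close>.  Flat generalized Delaunay metrics in the conformal class satisfy a maximum
  principle: if the functions \<open>X\<close> of two of them agree at a vertex and one dominates the other, they
  are equal.
  Ratios of \<open>X\<close> at adjacent vertices are bounded, so by compactness the supremum of
  \<open>X (v + \<delta>) / X v\<close> over all such metrics is attained, and the maximum principle makes the ratio of an
  extremal metric constant.  Doing this for three translations produces a limit metric \<open>X\<close> that is a
  character of the lattice.

  Completeness enters through a separation property that is stable under limits: in a Delaunay
  metric the intrinsic distance from a vertex to any other vertex is at least the shortest length of an
  edge at that vertex, hence the isometry to the plane maps vertices to separated points.  A nontrivial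
  character would yield infinitely many points that are uniformly separated and lie in a bounded
  set.  So all extremal ratios are \<open>1\<close>, and \<open>X\<close> is constant.
\<close>

section \<open>Rigidity of one star\<close>

text \<open>The obstacle is that limits of metrics may contain degenerate triangles, and that
  flatness alone gives no control over how a limit overlaps itself when developed. The isometry to
  the plane is therefore kept only through two closed inequalities: adjacent vertices are not
  farther apart than their edge is long, and distinct vertices keep a definite distance. The
  constant 16 has one source. The cone angle \<open>2 * pi\<close> forces some neighbour
  \<open>k\<close> of \<open>v\<close> to satisfy \<open>X k \<le> X v\<close>; three triangle
  inequalities around the star then give \<open>sqrt (X w) \<le> 4 * sqrt (X v)\<close> for every
  neighbour \<open>w\<close>. Hence an edge at \<open>v\<close> has squared length at least
  \<open>1 / (16 * (X v)\<^sup>2)\<close>, which is the separation used later. The order of the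
  three translations matters. An arbitrary \<open>\<delta>\<close> is maximized first, over all
  metrics, so that its ratio \<open>M\<close> bounds the given metric; the two generators follow,
  among metrics that already have multiplier \<open>M\<close> along \<open>\<delta>\<close>, and
  serve to make the limit a character. The separation is proved without a global development: a
  short path is unfolded face by face, and only the sector seen from its starting vertex is
  tracked.\<close>

definition hex_dir :: "nat \<Rightarrow> int \<times> int" where
  "hex_dir k = [(1,0),(0,1),(-1,1),(-1,0),(0,-1),(1,-1)] ! (k mod 6)"

text \<open>
  Sixteen times the squared area of a triangle with squared side lengths \<open>a\<close>, \<open>b\<close>, \<open>c\<close>; its
  nonnegativity is equivalent to the triangle inequalities.
\<close>

definition heron :: "real \<Rightarrow> real \<Rightarrow> real \<Rightarrow> real" where
  "heron a b c = 4 * a * b - (a + b - c)\<^sup>2"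

lemma heron_rot: "heron a b c = heron b c a"
  by (simp add: heron_def power2_eq_square algebra_simps)

lemma heron_swap: "heron a b c = heron b a c"
  by (simp add: heron_def power2_eq_square algebra_simps)

text \<open>\<open>a / sqrt (K - a\<^sup>2)\<close> is the cotangent of the angle with cosine
  \<open>a / sqrt K\<close>, an odd and strictly increasing function of \<open>a\<close>. For the
  two angles opposite to an edge, \<open>0 \<le> a + b\<close> is the Delaunay condition, and
  equality is cocircularity.\<close>

lemma cot_sum_nonneg:
  fixes K a b :: real
  assumes a: "a\<^sup>2 < K" and b: "b\<^sup>2 < K" and ab: "0 \<le> a + b"
  shows "0 \<le> a / sqrt (K - a\<^sup>2) + b / sqrt (K - b\<^sup>2)"
    and "a / sqrt (K - a\<^sup>2) + b / sqrt (K - b\<^sup>2) = 0 \<Longrightarrow> a + b = 0"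
proof -
  have odd_strict_mono: "s / sqrt (K - s\<^sup>2) < t / sqrt (K - t\<^sup>2)"
    if "s < t" "s\<^sup>2 < K" "t\<^sup>2 < K" for s t :: real
  proof -
    have pos: "s / sqrt (K - s\<^sup>2) < t / sqrt (K - t\<^sup>2)"
      if "s < t" "s\<^sup>2 < K" "t\<^sup>2 < K" "0 \<le> s" for s t :: real
    proof -
      have "s\<^sup>2 \<le> t\<^sup>2" using that by (intro power_mono) auto
      then have "sqrt (K - t\<^sup>2) \<le> sqrt (K - s\<^sup>2)" by simp
      moreover have "0 < sqrt (K - t\<^sup>2)" using that by simp
      ultimately show ?thesis using that by (intro frac_less) auto
    qed
    show ?thesis
    proof (cases "0 \<le> s")
      case True then show ?thesis using pos that by blast
    next
      case False
      show ?thesis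
      proof (cases "t \<le> 0")
        case True
        from pos[of "-t" "-s"] that True show ?thesis by simp
      next
        case f: False
        have "s / sqrt (K - s\<^sup>2) < 0" using False that by (simp add: divide_neg_pos)
        moreover have "0 < t / sqrt (K - t\<^sup>2)" using f that by simp
        ultimately show ?thesis by linarith
      qed
    qed
  qed
  have m: "(- b) / sqrt (K - (- b)\<^sup>2) = - (b / sqrt (K - b\<^sup>2))" by simp
  consider "a + b = 0" | "- b < a" using ab by linarith
  then have "(a + b = 0 \<and> a / sqrt (K - a\<^sup>2) + b / sqrt (K - b\<^sup>2) = 0) \<or>
        0 < a / sqrt (K - a\<^sup>2) + b / sqrt (K - b\<^sup>2)"
  proof cases
    case 1
    then have "a = - b" by simp
    then show ?thesis by simp
  next
    case 2
    from odd_strict_mono[OF this] a b m show ?thesis by simp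
  qed
  then show "0 \<le> a / sqrt (K - a\<^sup>2) + b / sqrt (K - b\<^sup>2)"
    and "a / sqrt (K - a\<^sup>2) + b / sqrt (K - b\<^sup>2) = 0 \<Longrightarrow> a + b = 0" by auto
qed

section \<open>Angles of a triangle as functions of its squared sides\<close>

definition angle_sq :: "real \<Rightarrow> real \<Rightarrow> real \<Rightarrow> real" where
  "angle_sq c p q = arccos ((p + q - c) / (2 * sqrt (p * q)))"

lemma heron_concave:
  assumes t: "0 < t" "t < 1" and c: "0 < c"
    and h0: "0 \<le> heron c p q" and h1: "0 \<le> heron c (p + dp) (q + dq)"
  shows "0 \<le> heron c (p + t * dp) (q + t * dq)"
    and "heron c (p + t * dp) (q + t * dq) = 0 \<Longrightarrow> dp = 0 \<and> dq = 0"
proof -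
  have eq: "heron c (p + t * dp) (q + t * dq) =
     (1 - t) * heron c p q + t * heron c (p + dp) (q + dq) + t * (1 - t) * (dp - dq)\<^sup>2"
    by (simp add: heron_def power2_eq_square algebra_simps)
  have nn: "0 \<le> (1 - t) * heron c p q" "0 \<le> t * heron c (p + dp) (q + dq)"
    "0 \<le> t * (1 - t) * (dp - dq)\<^sup>2" using assms by auto
  show "0 \<le> heron c (p + t * dp) (q + t * dq)" using eq nn by linarith
  assume z: "heron c (p + t * dp) (q + t * dq) = 0"
  then have "(1 - t) * heron c p q = 0" "t * heron c (p + dp) (q + dq) = 0"
    "t * (1 - t) * (dp - dq)\<^sup>2 = 0" using eq nn by linarith+
  then have e: "heron c p q = 0" "heron c (p + dp) (q + dq) = 0" "dp = dq" using t by auto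
  then have "4 * c * dp = 0" unfolding heron_def e(3) by (simp add: algebra_simps)
  then show "dp = 0 \<and> dq = 0" using c e by auto
qed

lemma heron_le_iff: "0 \<le> heron c p q \<longleftrightarrow> (p + q - c)\<^sup>2 \<le> 4 * (p * q)"
  unfolding heron_rot[of c p q] by (simp add: heron_def mult.assoc)

lemma angle_sq_arg:
  assumes "0 < p" "0 < q" "0 \<le> heron c p q"
  shows "(p + q - c) / (2 * sqrt (p * q)) \<in> {-1..1}"
proof -
  have "\<bar>p + q - c\<bar> \<le> sqrt (4 * (p * q))"
    using assms(3) unfolding heron_le_iff by (simp add: real_le_rsqrt)
  also have "\<dots> = 2 * sqrt (p * q)" by (simp add: real_sqrt_mult)
  finally have "\<bar>(p + q - c) / (2 * sqrt (p * q))\<bar> \<le> 1" using assms by (simp add: field_simps)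
  then show ?thesis unfolding abs_le_iff atLeastAtMost_iff by linarith
qed

text \<open>\<open>sqrt (heron c p q)\<close> is four times the area, so
  \<open>(p - q + c) / sqrt (heron c p q)\<close> is the cotangent of the angle opposite to the side
  \<open>q\<close>. The derivative is minus half the sum of these cotangents weighted by the
  logarithmic derivatives of \<open>p\<close> and \<open>q\<close>.\<close>

lemma angle_sq_deriv:
  assumes p: "0 < p t" and q: "0 < q t" and h: "0 < heron c (p t) (q t)"
    and dp: "(p has_real_derivative dp) (at t)" and dq: "(q has_real_derivative dq) (at t)"
  shows "((\<lambda>s. angle_sq c (p s) (q s)) has_real_derivative
     - (dp * (p t - q t + c) / p t + dq * (q t - p t + c) / q t) / (2 * sqrt (heron c (p t) (q t)))) (at t)"
proof -
  define S where "S = sqrt (p t * q t)"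
  define H where "H = sqrt (heron c (p t) (q t))"
  define u where "u = (p t + q t - c) / (2 * S)"
  have S: "0 < S" "S * S = p t * q t" using p q by (auto simp: S_def)
  have H: "0 < H" "H * H = heron c (p t) (q t)" using h by (auto simp: H_def)
  have hh: "heron c (p t) (q t) = 4 * (p t * q t) - (p t + q t - c)\<^sup>2"
    unfolding heron_rot[of c] by (simp add: heron_def)
  have "1 - u\<^sup>2 = (H / (2 * S))\<^sup>2"
    using S H hh by (simp add: u_def power2_eq_square field_simps)
  then have su: "sqrt (1 - u\<^sup>2) = H / (2 * S)" using S H by (simp add: real_sqrt_unique)
  have "0 < 1 - u\<^sup>2" using \<open>1 - u\<^sup>2 = _\<close> S H by simp
  then have u1: "\<bar>u\<bar> < 1" using abs_square_less_1[of u] by simp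
  have pq: "0 < p t * q t" using p q by simp
  have d1: "((\<lambda>s. (p s + q s - c) / (2 * sqrt (p s * q s))) has_real_derivative
      ((dp + dq) * (2 * S) - (p t + q t - c) * ((dp * q t + p t * dq) / S)) / (2 * S * (2 * S))) (at t)"
    unfolding S_def using pq p q
    by (auto intro!: derivative_eq_intros dp dq simp: field_simps mult_less_0_iff)
  have u_t: "(p t + q t - c) / (2 * sqrt (p t * q t)) = u" by (simp add: u_def S_def)
  have d2: "((\<lambda>s. angle_sq c (p s) (q s)) has_real_derivative
      inverse (- sqrt (1 - u\<^sup>2)) *
      (((dp + dq) * (2 * S) - (p t + q t - c) * ((dp * q t + p t * dq) / S)) / (2 * S * (2 * S)))) (at t)"
    unfolding angle_sq_def
    by (rule DERIV_chain2[OF _ d1], unfold u_t, rule DERIV_arccos) (use u1 in auto)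
  have "inverse (- sqrt (1 - u\<^sup>2)) *
      (((dp + dq) * (2 * S) - (p t + q t - c) * ((dp * q t + p t * dq) / S)) / (2 * S * (2 * S)))
    = - ((dp + dq) * (2 * (S * S)) - (p t + q t - c) * (dp * q t + p t * dq)) / (2 * H * (S * S))"
    unfolding su using S(1) H(1) by (simp add: field_simps)
  also have "\<dots> = - (dp * (p t - q t + c) / p t + dq * (q t - p t + c) / q t) / (2 * H)"
    unfolding S(2) using H(1) p q by (simp add: field_simps)
  finally show ?thesis using d2 unfolding H_def by simp
qed

text \<open>Neighbours in the cyclic order of \<open>hex_dir\<close>; the predecessor adds 5 to
  avoid subtraction on \<open>nat\<close>.\<close>

definition nxt :: "nat \<Rightarrow> nat" where "nxt k = (k + 1) mod 6"
definition prv :: "nat \<Rightarrow> nat" where "prv k = (k + 5) mod 6"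

lemma sum6: "(\<Sum>k<(6::nat). f k) = f 0 + f 1 + f 2 + f 3 + f 4 + (f 5 :: real)"
  by (simp add: eval_nat_numeral)

lemma nxt_prv_simps [simp]:
  "nxt 0 = 1" "nxt 1 = 2" "nxt (Suc 0) = 2" "nxt 2 = 3" "nxt 3 = 4" "nxt 4 = 5" "nxt 5 = 0"
  "prv 0 = 5" "prv 1 = 0" "prv (Suc 0) = 0" "prv 2 = 1" "prv 3 = 2" "prv 4 = 3" "prv 5 = 4"
  by (simp_all add: nxt_def prv_def)

lemma less6: "k < 6 \<longleftrightarrow> k \<in> {0, 1, 2, 3, 4, 5 :: nat}"
  by auto

text \<open>
  Along the segment from \<open>P\<close> to \<open>P'\<close> the triangle and Delaunay conditions persist, since the former
  are concave and the latter linear in squared lengths.  The derivative of the cone angle is minus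
  a combination of the nonnegative increments with the nonnegative weights
  \<open>cot \<alpha> + cot \<beta>\<close>, and the mean value theorem makes every term vanish at some interior time.  A positive
  increment hence forces cocircularity at its edge, which makes the increments harmonic on the
  cycle, thus constant, and then cocircular everywhere, which is absurd.
\<close>

theorem star_rigidity:
  fixes P P' :: "nat \<Rightarrow> real"
  assumes c: "0 < c"
    and pos: "\<And>k. k < 6 \<Longrightarrow> 0 < P k"
    and le: "\<And>k. k < 6 \<Longrightarrow> P k \<le> P' k"
    and h: "\<And>k. k < 6 \<Longrightarrow> 0 \<le> heron c (P k) (P (nxt k))"
    and h': "\<And>k. k < 6 \<Longrightarrow> 0 \<le> heron c (P' k) (P' (nxt k))"
    and d: "\<And>k. k < 6 \<Longrightarrow> P (nxt k) + P (prv k) \<le> 2 * (c + P k)"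
    and d': "\<And>k. k < 6 \<Longrightarrow> P' (nxt k) + P' (prv k) \<le> 2 * (c + P' k)"
    and angles: "(\<Sum>k<6. angle_sq c (P k) (P (nxt k))) = (\<Sum>k<6. angle_sq c (P' k) (P' (nxt k)))"
    and k: "k < 6"
  shows "P' k = P k"
proof -
  define D where "D k = P' k - P k" for k
  define X where "X k t = P k + t * D k" for k and t :: real
  have n6: "nxt k < 6" "prv k < 6" for k by (auto simp: nxt_def prv_def)
  have D0: "0 \<le> D k" if "k < 6" for k using le[OF that] by (simp add: D_def)
  have Xpos: "0 < X k t" if "k < 6" "0 \<le> t" for k t
    using pos[OF that(1)] D0[OF that(1)] that by (simp add: X_def add_pos_nonneg)
  have P': "P' k = P k + D k" for k by (simp add: D_def)
  have X01: "X k 0 = P k" "X k 1 = P' k" for k by (auto simp: X_def D_def)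
  have hX: "0 \<le> heron c (X k t) (X (nxt k) t)" if kt: "k < 6" "0 \<le> t" "t \<le> 1" for k t
  proof -
    consider "t = 0" | "t = 1" | "0 < t" "t < 1" using kt by linarith
    then show ?thesis
    proof cases
      case 3
      then show ?thesis unfolding X_def
        using heron_concave(1)[OF 3 c h[OF kt(1)]] h'[OF kt(1)] unfolding P' by blast
    qed (use h h' X01 kt in auto)
  qed
  have hX0: "D k = 0 \<and> D (nxt k) = 0"
    if "k < 6" "0 < t" "t < 1" "heron c (X k t) (X (nxt k) t) = 0" for k t
    using heron_concave(2)[OF that(2,3) c h[OF that(1)]] h'[OF that(1)] that(4) unfolding P' X_def by blast
  define T where "T t = (\<Sum>k<6. angle_sq c (X k t) (X (nxt k) t))" for t
  define R where "R k t = sqrt (heron c (X k t) (X (nxt k) t))" for k t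
  define dk where "dk k t = - (D k * (X k t - X (nxt k) t + c) / X k t
      + D (nxt k) * (X (nxt k) t - X k t + c) / X (nxt k) t) / (2 * R k t)" for k t
  have der: "((\<lambda>t. angle_sq c (X k t) (X (nxt k) t)) has_real_derivative dk k t) (at t)"
    if "k < 6" "0 < t" "t < 1" for k t
  \<comment> \<open>In a degenerate triangle both increments vanish, so the angle is constant in
    \<open>t\<close>, and \<open>dk\<close> is 0 as well.\<close>
  proof (cases "heron c (X k t) (X (nxt k) t) = 0")
    case True
    from hX0[OF that this] show ?thesis unfolding dk_def X_def by auto
  next
    case False
    then have "0 < heron c (X k t) (X (nxt k) t)" using hX[of k t] that by auto
    then show ?thesis unfolding dk_def R_def
      by (intro angle_sq_deriv Xpos n6 that less_imp_le)
         (auto simp: X_def intro!: derivative_eq_intros)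
  qed
  have "continuous_on {0..1} T"
    unfolding T_def angle_sq_def
  proof (intro continuous_intros ballI conjI)
    fix k t assume "k \<in> {..<6::nat}" "t \<in> {0..1::real}"
    then have a: "(X k t + X (nxt k) t - c) / (2 * sqrt (X k t * X (nxt k) t)) \<in> {-1..1}"
      by (intro angle_sq_arg Xpos n6 hX) auto
    then show "- 1 \<le> (X k t + X (nxt k) t - c) / (2 * sqrt (X k t * X (nxt k) t))"
      "(X k t + X (nxt k) t - c) / (2 * sqrt (X k t * X (nxt k) t)) \<le> 1" by auto
    show "2 * sqrt (X k t * X (nxt k) t) \<noteq> 0"
      using Xpos[of k t] Xpos[OF n6(1)[of k], of t] \<open>k \<in> _\<close> \<open>t \<in> _\<close> by auto
  qed (auto simp: X_def intro!: continuous_intros)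
  moreover have "(T has_real_derivative (\<Sum>k<6. dk k t)) (at t)" if "0 < t" "t < 1" for t
    unfolding T_def using der that by (auto intro!: DERIV_sum)
  ultimately obtain z where z: "0 < z" "z < 1" "T 1 - T 0 = (1 - 0) * (\<Sum>k<6. dk k z)"
    using MVT[of 0 1 T] by (metis DERIV_unique real_differentiable_def zero_less_one)
  have "T 1 = T 0" using angles by (simp add: T_def X01)
  then have dk0: "(\<Sum>k<6. dk k z) = 0" using z by simp
  define B where "B k = (X k z + c - X (nxt k) z) / R k z + (X k z + c - X (prv k) z) / R (prv k) z" for k
  define E where "E k = D k / X k z * B k" for k
  \<comment> \<open>Regrouping by spokes: \<open>D k\<close> occurs in the two triangles that share
    the spoke \<open>k\<close>, with the cotangents of the two angles opposite to it.\<close>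
  have "(\<Sum>k<6. dk k z) = - (\<Sum>k<6. E k) / 2"
    unfolding sum6 dk_def E_def B_def by (simp add: algebra_simps add_divide_distrib diff_divide_distrib)
  then have E0: "(\<Sum>k<6. E k) = 0" using dk0 by simp
  have np: "nxt (prv k) = k" "prv (nxt k) = k" if "k < 6" for k using that unfolding less6 by auto
  have dX: "X (nxt k) z + X (prv k) z \<le> 2 * (c + X k z)" if "k < 6" for k
  proof -
    have "(1 - z) * (P (nxt k) + P (prv k)) + z * (P' (nxt k) + P' (prv k))
        \<le> (1 - z) * (2 * (c + P k)) + z * (2 * (c + P' k))"
      using d[OF that] d'[OF that] z by (intro add_mono mult_left_mono) auto
    then show ?thesis by (simp add: X_def D_def algebra_simps)
  qed
  have key: "0 \<le> E k \<and> (E k = 0 \<longrightarrow> D k * (2 * (c + X k z) - X (nxt k) z - X (prv k) z) = 0)"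
    if "k < 6" for k
  proof (cases "D k = 0")
    case False
    have "heron c (X k z) (X (nxt k) z) \<noteq> 0" using hX0[OF that z(1,2)] False by blast
    then have h1: "0 < heron c (X k z) (X (nxt k) z)" using hX[OF that, of z] z by simp
    have "heron c (X (prv k) z) (X k z) \<noteq> 0"
      using hX0[OF n6(2)[of k] z(1,2)] False np[OF that] by auto
    then have h2: "0 < heron c (X (prv k) z) (X k z)" using hX[OF n6(2)[of k], of z] z np[OF that] by simp
    let ?a = "X k z + c - X (nxt k) z" and ?b = "X k z + c - X (prv k) z"
    let ?K = "4 * X k z * c"
    have e1: "heron c (X k z) (X (nxt k) z) = ?K - ?a\<^sup>2"
      by (simp add: heron_def algebra_simps)
    have e2: "heron c (X (prv k) z) (X k z) = ?K - ?b\<^sup>2"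
      by (simp add: heron_def algebra_simps power2_eq_square)
    have B: "B k = ?a / sqrt (?K - ?a\<^sup>2) + ?b / sqrt (?K - ?b\<^sup>2)"
      unfolding B_def R_def np[OF that] e1 e2 ..
    have s: "0 \<le> ?a + ?b" using dX[OF that] by simp
    note cs = cot_sum_nonneg[of ?a ?K ?b, folded B]
    have "0 < D k / X k z" using False D0[OF that] Xpos[OF that, of z] z by simp
    moreover have "0 \<le> B k" using cs(1) h1 h2 e1 e2 s by auto
    moreover have "B k = 0 \<Longrightarrow> ?a + ?b = 0" using cs(2) h1 h2 e1 e2 s by auto
    ultimately have ab: "B k = 0 \<Longrightarrow> ?a + ?b = 0" and Dx: "0 < D k / X k z" and B0: "0 \<le> B k"
      by blast+
    have E0: "0 \<le> E k" unfolding E_def using Dx B0 by (rule mult_nonneg_nonneg[OF less_imp_le])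
    have EB: "B k = 0" if "E k = 0" using that Dx unfolding E_def mult_eq_0_iff by linarith
    have sum: "2 * (c + X k z) - X (nxt k) z - X (prv k) z = ?a + ?b" by simp
    show ?thesis
    proof (intro conjI impI)
      assume "E k = 0"
      then show "D k * (2 * (c + X k z) - X (nxt k) z - X (prv k) z) = 0"
        unfolding sum using ab[OF EB] by (simp only: mult_zero_right)
    qed (rule E0)
  qed (auto simp: E_def)
  have "E k = 0" if "k < 6" for k
    using sum_nonneg_0[of "{..<6::nat}" E k] E0 key[THEN conjunct1] that by blast
  then have tight: "D k * (2 * (c + X k z) - X (nxt k) z - X (prv k) z) = 0" if "k < 6" for k
    using key that by blast
  \<comment> \<open>The Delaunay slack is affine in time and nonnegative at both ends, so a zero at
    the interior time \<open>z\<close> makes it vanish at both ends. The difference of the two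
    slacks is the discrete Laplacian of \<open>D\<close>.\<close>
  have both: "D k * (2 * (c + P k) - P (nxt k) - P (prv k)) = 0 \<and>
      D k * (2 * D k - D (nxt k) - D (prv k)) = 0" if "k < 6" for k
  proof (cases "D k = 0")
    case False
    then have t0: "2 * (c + X k z) - X (nxt k) z - X (prv k) z = 0" using tight[OF that] by simp
    define f where "f = 2 * (c + P k) - P (nxt k) - P (prv k)"
    define f' where "f' = 2 * (c + P' k) - P' (nxt k) - P' (prv k)"
    have nn: "0 \<le> (1 - z) * f" "0 \<le> z * f'" using d[OF that] d'[OF that] z by (auto simp: f_def f'_def)
    have "(1 - z) * f + z * f' = 0" using t0 by (simp add: f_def f'_def X_def D_def algebra_simps)
    then have "(1 - z) * f = 0" "z * f' = 0" using nn by linarith+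
    then have "f = 0" "f' = 0" using z by auto
    moreover have "f' - f = 2 * D k - D (nxt k) - D (prv k)" by (simp add: f_def f'_def D_def)
    ultimately show ?thesis by (simp add: f_def)
  qed simp
  have "(\<Sum>k<6. (D k - D (nxt k))\<^sup>2) = (\<Sum>k<6. D k * (2 * D k - D (nxt k) - D (prv k)))"
    unfolding sum6 by (simp add: power2_eq_square algebra_simps)
  also have "\<dots> = 0" using both by (intro sum.neutral) auto
  finally have "D k = D (nxt k)" if "k < 6" for k
    using sum_nonneg_0[of "{..<6::nat}" "\<lambda>k. (D k - D (nxt k))\<^sup>2" k] that by simp
  then have "D 1 = D 0" "D 2 = D 1" "D 3 = D 2" "D 4 = D 3" "D 5 = D 4"
    by (metis nxt_prv_simps less6 insertI1 insertI2)+
  then have all: "D k = D 0" if "k < 6" for k using that unfolding less6 by auto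
  \<comment> \<open>Around the cycle the terms in \<open>P\<close> cancel, which leaves
    \<open>12 * c\<close>.\<close>
  have "0 = (\<Sum>k<6. D k * (2 * (c + P k) - P (nxt k) - P (prv k)))"
    using both by (intro sum.neutral[symmetric]) auto
  also have "\<dots> = D 0 * (\<Sum>k<6. 2 * (c + P k) - P (nxt k) - P (prv k))"
    unfolding sum_distrib_left by (intro sum.cong refl arg_cong2[where f = "(*)"] all) simp
  also have "\<dots> = D 0 * (12 * c)" unfolding sum6 by simp
  finally have "D 0 = 0" using c by simp
  then show ?thesis using all[OF k] by (simp add: D_def)
qed

section \<open>Visibility in a Delaunay strip\<close>

definition wedge :: "real \<Rightarrow> complex \<Rightarrow> complex \<Rightarrow> real" where
  "wedge e x y = e * (Re x * Im y - Im x * Re y)"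

text \<open>
  Twice the signed area of the triangle \<open>w\<close>, \<open>b\<close>, \<open>a\<close>.  The factor \<open>e = \<plusminus>1\<close> in \<^term>\<open>wedge\<close> allows the
  two sides of a strip of triangles to be treated by reflection.  When \<open>0 < wedge e b a\<close>, the origin
  lies where \<open>near e b a\<close> is positive.
\<close>

definition near :: "real \<Rightarrow> complex \<Rightarrow> complex \<Rightarrow> complex \<Rightarrow> real" where
  "near e b a w = wedge e b a - wedge e b w - wedge e w a"

definition affine_fun :: "(complex \<Rightarrow> real) \<Rightarrow> bool" where
  "affine_fun h \<longleftrightarrow> (\<exists>p q k. \<forall>w. h w = p * Re w + q * Im w + k)"

definition in_cone :: "real \<Rightarrow> complex \<Rightarrow> complex \<Rightarrow> complex \<Rightarrow> bool" where
  "in_cone e \<beta> \<alpha> w \<longleftrightarrow> 0 < wedge e \<beta> w \<and> 0 < wedge e w \<alpha>"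

text \<open>
  The triangle \<open>a\<close>, \<open>b\<close>, \<open>q\<close> is the last one of an unfolded strip and was entered through the edge
  \<open>a\<close>, \<open>b\<close>; the part of the plane visible from the origin through the strip is the cone between \<open>\<beta>\<close>
  and \<open>\<alpha>\<close>, spanned by two blocking vertices of the strip.  The affine function \<open>h\<close> interpolates the
  squared norm at the vertices of the triangle; by the Delaunay condition these functions increase
  when an edge is crossed, so that \<open>r * norm w \<le> h w\<close> propagates and gives \<open>r \<le> norm q\<close> at any
  visible vertex \<open>q\<close>.
\<close>

definition sees ::
    "real \<Rightarrow> real \<Rightarrow> complex \<Rightarrow> complex \<Rightarrow> complex \<Rightarrow> complex \<Rightarrow> complex \<Rightarrow> bool" where
  "sees r e a b q \<alpha> \<beta> \<longleftrightarrow>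
     0 < wedge e b a \<and> near e b a q < 0 \<and>
     0 \<le> wedge e \<alpha> a \<and> 0 \<le> wedge e b \<beta> \<and> 0 < wedge e b \<alpha> \<and> 0 < wedge e \<beta> a \<and> 0 < wedge e \<beta> \<alpha> \<and>
     0 \<le> near e b a \<alpha> \<and> 0 \<le> near e b a \<beta> \<and> r \<le> norm \<alpha> \<and> r \<le> norm \<beta> \<and>
     (\<exists>h. affine_fun h \<and> h a = (norm a)\<^sup>2 \<and> h b = (norm b)\<^sup>2 \<and> h q = (norm q)\<^sup>2 \<and>
       (\<forall>w. 0 \<le> wedge e \<beta> w \<and> 0 \<le> wedge e w \<alpha> \<and> near e b a w \<le> 0 \<longrightarrow> r * norm w \<le> h w))"

lemma wedge_neg: "wedge (- e) x y = wedge e y x"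
  by (simp add: wedge_def algebra_simps)

lemma near_neg: "near (- e) a b w = near e b a w"
  by (simp add: near_def wedge_neg)

lemma near_vertices [simp]: "near e b a a = 0" "near e b a b = 0"
  by (auto simp: near_def wedge_def)

lemma near_rot: "near e q a b = - near e b a q"
  by (simp add: near_def wedge_def algebra_simps)

lemma wedge_self [simp]: "wedge e x x = 0"
  by (simp add: wedge_def)

lemma wedge_comb:
  "wedge e x ((1 - s) *\<^sub>R y + s *\<^sub>R z) = (1 - s) * wedge e x y + s * wedge e x z"
  "wedge e ((1 - s) *\<^sub>R y + s *\<^sub>R z) x = (1 - s) * wedge e y x + s * wedge e z x"
  by (simp_all add: wedge_def algebra_simps)

lemma near_comb: "near e b a ((1 - s) *\<^sub>R y + s *\<^sub>R z) = (1 - s) * near e b a y + s * near e b a z"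
  by (simp add: near_def wedge_def algebra_simps)

lemma plucker: "wedge e b a * wedge e x y = wedge e x a * wedge e b y - wedge e x b * wedge e a y"
  by (simp add: wedge_def algebra_simps)

lemma sees_swap: "sees r e a b q \<alpha> \<beta> \<Longrightarrow> sees r (- e) b a q \<beta> \<alpha>"
  unfolding sees_def wedge_neg near_neg by metis

lemma in_cone_swap: "in_cone (- e) \<alpha> \<beta> w \<longleftrightarrow> in_cone e \<beta> \<alpha> w"
  by (auto simp: in_cone_def wedge_neg)

text \<open>\<open>(norm w)\<^sup>2 - h w\<close> is the power of \<open>w\<close> with respect to
  the circumcircle of \<open>a\<close>, \<open>q\<close>, \<open>b\<close>. Subtracting
  \<open>(w - a) \<bullet> (w - q)\<close>, the power for the circle with diameter \<open>a\<close>,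
  \<open>q\<close>, leaves an affine function vanishing at \<open>a\<close> and \<open>q\<close>, so
  its value at \<open>p\<close> follows from that at \<open>b\<close>. The cotangent condition then
  says that \<open>p\<close> is not inside the circumcircle, and the new interpolant is
  \<open>h\<close> minus a nonnegative multiple of \<open>near e q a\<close>.\<close>

lemma extend_lift:
  assumes h: "affine_fun h" "h a = (norm a)\<^sup>2" "h q = (norm q)\<^sup>2" "h b = (norm b)\<^sup>2"
    and b: "0 < near e q a b" and p: "near e q a p < 0"
    and cot: "0 \<le> ((p - a) \<bullet> (p - q)) / (- near e q a p) + ((b - a) \<bullet> (b - q)) / near e q a b"
  shows "\<exists>h'. affine_fun h' \<and> h' a = (norm a)\<^sup>2 \<and> h' q = (norm q)\<^sup>2 \<and> h' p = (norm p)\<^sup>2 \<and>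
           (\<forall>w. near e q a w \<le> 0 \<longrightarrow> h w \<le> h' w)"
proof -
  obtain c1 c2 k where hw: "h w = c1 * Re w + c2 * Im w + k" for w
    using h(1) unfolding affine_fun_def by blast
  define g where "g w = (norm w)\<^sup>2 - h w" for w
  define f where "f w = g w - (w - a) \<bullet> (w - q)" for w
  define m1 m2 m where "m1 = Re a + Re q - c1" and "m2 = Im a + Im q - c2"
    and "m = - (Re a * Re q + Im a * Im q) - k"
  have f: "f w = m1 * Re w + m2 * Im w + m" for w
    by (simp add: f_def g_def hw cmod_def inner_complex_def m1_def m2_def m_def power2_eq_square algebra_simps)
  have "f a = 0" "f q = 0" using h by (simp_all add: f_def g_def)
  then have m: "m = - (m1 * Re a + m2 * Im a)" and z: "m1 * (Re q - Re a) + m2 * (Im q - Im a) = 0"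
    unfolding f by (auto simp: algebra_simps)
  have "f p * near e q a b - f b * near e q a p
     = e * (m1 * (Re q - Re a) + m2 * (Im q - Im a)) *
       ((Re b - Re a) * (Im p - Im a) - (Im b - Im a) * (Re p - Re a))"
    unfolding f m near_def wedge_def by (simp add: algebra_simps)
  then have eq: "f p * near e q a b = f b * near e q a p" using z by simp
  have "f b = - ((b - a) \<bullet> (b - q))" using h by (simp add: f_def g_def)
  then have "f p = - ((b - a) \<bullet> (b - q)) * near e q a p / near e q a b"
    using eq b by (simp add: field_simps)
  then have "g p = (p - a) \<bullet> (p - q) + ((b - a) \<bullet> (b - q)) / near e q a b * (- near e q a p)"
    by (simp add: f_def)
  also have "\<dots> = (- near e q a p) *
      (((p - a) \<bullet> (p - q)) / (- near e q a p) + ((b - a) \<bullet> (b - q)) / near e q a b)"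
    using p by (simp add: field_simps)
  also have "0 \<le> \<dots>" using p cot by (intro mult_nonneg_nonneg) auto
  finally have gp: "0 \<le> g p" .
  define \<kappa> where "\<kappa> = g p / (- near e q a p)"
  have k0: "0 \<le> \<kappa>" using gp p by (simp add: \<kappa>_def divide_nonneg_neg)
  define h' where "h' w = h w - \<kappa> * near e q a w" for w
  have "h' w = (c1 - \<kappa> * (e * (Im q - Im a))) * Re w + (c2 - \<kappa> * (e * (Re a - Re q))) * Im w
     + (k - \<kappa> * wedge e q a)" for w
    by (simp add: h'_def hw near_def wedge_def algebra_simps)
  then have "affine_fun h'" unfolding affine_fun_def by blast
  moreover have "h' a = (norm a)\<^sup>2" "h' q = (norm q)\<^sup>2" using h by (auto simp: h'_def)
  moreover have "h' p = (norm p)\<^sup>2" using p by (simp add: h'_def \<kappa>_def g_def)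
  moreover have "h w \<le> h' w" if "near e q a w \<le> 0" for w
    using k0 that by (simp add: h'_def mult_nonneg_nonpos)
  ultimately show ?thesis by blast
qed

lemma scale_solve:
  fixes u v :: "'a :: real_vector"
  shows "d \<noteq> 0 \<Longrightarrow> d *\<^sub>R v = x *\<^sub>R u \<Longrightarrow> v = (x / d) *\<^sub>R u"
  by (metis vector_fraction_eq_iff)

text \<open>The interpolant through the origin, \<open>a\<close> and \<open>b\<close> is linear. On
  the cone over \<open>a\<close>, \<open>b\<close> a point \<open>w = x b + y a\<close> with
  \<open>x\<close>, \<open>y\<close> nonnegative satisfies
  \<open>r |w| \<le> r (x |b| + y |a|) \<le> x |b|^2 + y |a|^2 = h w\<close> when \<open>r\<close>
  is nonnegative; \<open>extend_lift\<close> carries this across the edge.\<close>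

lemma sees_base:
  assumes ba: "0 < wedge e b a" and q: "near e b a q < 0" and r: "r \<le> norm a" "r \<le> norm b"
    and cot: "0 \<le> ((q - a) \<bullet> (q - b)) / (- near e b a q) + (a \<bullet> b) / near e b a 0"
  shows "sees r e a b q a b"
proof -
  define h where "h w = (wedge e w a * (norm b)\<^sup>2 + wedge e b w * (norm a)\<^sup>2) / wedge e b a" for w
  have n0: "near e b a 0 = wedge e b a" by (simp add: near_def wedge_def)
  have "h w = (e * (Im a * (norm b)\<^sup>2 - Im b * (norm a)\<^sup>2) / wedge e b a) * Re w
      + (e * (Re b * (norm a)\<^sup>2 - Re a * (norm b)\<^sup>2) / wedge e b a) * Im w + 0" for w
    using ba unfolding h_def by (simp add: field_simps) (simp add: wedge_def algebra_simps)
  then have "affine_fun h" unfolding affine_fun_def by blast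
  moreover have ab: "h a = (norm a)\<^sup>2" "h b = (norm b)\<^sup>2" using ba by (auto simp: h_def)
  moreover have "h 0 = (norm (0::complex))\<^sup>2" by (simp add: h_def wedge_def)
  ultimately obtain h' where h': "affine_fun h'" "h' a = (norm a)\<^sup>2" "h' b = (norm b)\<^sup>2" "h' q = (norm q)\<^sup>2"
      "\<And>w. near e b a w \<le> 0 \<Longrightarrow> h w \<le> h' w"
    using extend_lift[of h a b 0 e q] q cot n0 ba by auto
  have "r * norm w \<le> h w" if "0 \<le> wedge e b w" "0 \<le> wedge e w a" for w
  proof -
    define x y where "x = wedge e w a / wedge e b a" and "y = wedge e b w / wedge e b a"
    have xy: "0 \<le> x" "0 \<le> y" using that ba by (auto simp: x_def y_def)
    have "wedge e b a *\<^sub>R w = wedge e w a *\<^sub>R b + wedge e b w *\<^sub>R a"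
      by (rule complex_eqI) (simp_all add: wedge_def algebra_simps)
    then have "wedge e b a *\<^sub>R w = wedge e b a *\<^sub>R (x *\<^sub>R b + y *\<^sub>R a)"
      using ba by (simp add: x_def y_def scaleR_add_right)
    then have "w = x *\<^sub>R b + y *\<^sub>R a" using ba by simp
    then have "norm w \<le> x * norm b + y * norm a"
      using xy by (metis abs_of_nonneg norm_scaleR norm_triangle_ineq)
    then have "r * norm w \<le> (x * norm b + y * norm a) * r" if "0 \<le> r"
      using that by (simp add: mult.commute mult_left_mono)
    moreover have "(x * norm b + y * norm a) * r \<le> x * (norm b)\<^sup>2 + y * (norm a)\<^sup>2"
    proof -
      have "x * (norm b * r) \<le> x * (norm b * norm b)" "y * (norm a * r) \<le> y * (norm a * norm a)"
        using r xy by (intro mult_left_mono; simp)+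
      then show ?thesis by (simp add: power2_eq_square distrib_right mult.assoc)
    qed
    moreover have "h w = x * (norm b)\<^sup>2 + y * (norm a)\<^sup>2"
      by (simp add: h_def x_def y_def add_divide_distrib)
    moreover have "0 \<le> x * (norm b)\<^sup>2 + y * (norm a)\<^sup>2" using xy by simp
    moreover have "r * norm w \<le> 0" if "r < 0" using that by (simp add: mult_nonpos_nonneg)
    ultimately show ?thesis by (cases "0 \<le> r") auto
  qed
  then show ?thesis unfolding sees_def using ba q r h' by (fastforce intro: exI[of _ h'])
qed

lemma sees_vertex:
  assumes "sees r e a b q \<alpha> \<beta>" "in_cone e \<beta> \<alpha> q"
  shows "r \<le> norm q"
proof -
  have "r * norm q \<le> norm q * norm q"
    using assms unfolding sees_def in_cone_def power2_eq_square by (metis less_imp_le)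
  moreover have "q \<noteq> 0" using assms(2) by (auto simp: in_cone_def wedge_def)
  ultimately show ?thesis by simp
qed

text \<open>
  A path leaving the cone would cross one of its boundary rays beyond the blocking vertex, hence at
  distance at least \<open>r\<close> from the origin.
\<close>

lemma sees_stays:
  assumes s: "sees r e a b q \<alpha> \<beta>" and z: "in_cone e \<beta> \<alpha> z" "near e b a z \<le> 0" "near e b a z' \<le> 0"
    and r: "norm z + norm (z' - z) < r"
  shows "in_cone e \<beta> \<alpha> z'"
proof (rule ccontr)
  assume n: "\<not> in_cone e \<beta> \<alpha> z'"
  define w where "w t = (1 - t) *\<^sub>R z + t *\<^sub>R z'" for t
  define f where "f t = min (wedge e \<beta> (w t)) (wedge e (w t) \<alpha>)" for t
  have "continuous_on {0..1} f" unfolding f_def w_def wedge_comb by (intro continuous_intros)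
  moreover have "0 < f 0" "f 1 \<le> 0" using z n by (auto simp: f_def w_def in_cone_def)
  ultimately obtain t where t: "0 \<le> t" "t \<le> 1" "f t = 0"
    using IVT2'[of f 1 0 0] by auto
  have d: "0 \<le> wedge e \<beta> (w t)" "0 \<le> wedge e (w t) \<alpha>" "wedge e \<beta> (w t) = 0 \<or> wedge e (w t) \<alpha> = 0"
    using t(3) unfolding f_def min_def by (auto split: if_splits)
  have "near e b a (w t) \<le> 0"
    unfolding w_def near_comb using t z by (simp add: add_nonpos_nonpos mult_nonneg_nonpos)
  have "w t = z + t *\<^sub>R (z' - z)" by (simp add: w_def algebra_simps)
  then have "norm (w t) \<le> norm z + t * norm (z' - z)"
    using t by (metis abs_of_nonneg norm_scaleR norm_triangle_ineq)
  also have "\<dots> \<le> norm z + norm (z' - z)" using t by (simp add: mult_left_le_one_le)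
  finally have wr: "norm (w t) < r" using r by simp
  have p: "0 < wedge e \<beta> \<alpha>" using s by (simp add: sees_def)
  have n0: "near e b a 0 = wedge e b a" by (simp add: near_def wedge_def)
  \<comment> \<open>On the ray through a blocking vertex: before the vertex (\<open>k < 1\<close>)
    the point is strictly on the origin's side of the edge, and from the vertex on it is at distance
    at least \<open>r\<close>.\<close>
  have no: False if g: "0 \<le> near e b a \<gamma>" "r \<le> norm \<gamma>" "w t = k *\<^sub>R \<gamma>" "0 \<le> k" for \<gamma> k
  proof (cases "k < 1")
    case True
    have "near e b a (w t) = (1 - k) * wedge e b a + k * near e b a \<gamma>"
      unfolding g(3) by (simp add: near_def wedge_def algebra_simps)
    moreover have "0 < (1 - k) * wedge e b a" using True s by (simp add: sees_def)
    ultimately show False using g \<open>near e b a (w t) \<le> 0\<close> by (smt (verit) mult_nonneg_nonneg)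
  next
    case False
    then have "norm \<gamma> \<le> norm (w t)" using g by (simp add: mult_le_cancel_right1)
    then show False using wr g by simp
  qed
  have eq: "wedge e \<beta> \<alpha> *\<^sub>R w t = wedge e (w t) \<alpha> *\<^sub>R \<beta> + wedge e \<beta> (w t) *\<^sub>R \<alpha>"
    by (rule complex_eqI) (simp_all add: wedge_def algebra_simps)
  have "w t = (wedge e (w t) \<alpha> / wedge e \<beta> \<alpha>) *\<^sub>R \<beta>" if "wedge e \<beta> (w t) = 0"
    using eq that p by (intro scale_solve) auto
  moreover have "w t = (wedge e \<beta> (w t) / wedge e \<beta> \<alpha>) *\<^sub>R \<alpha>" if "wedge e (w t) \<alpha> = 0"
    using eq that p by (intro scale_solve) auto
  ultimately show False using no d p s unfolding sees_def
    by (metis divide_nonneg_pos)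
qed

text \<open>Crossing the edge \<open>a\<close>, \<open>q\<close> leaves \<open>\<alpha>\<close> as
  the blocker on the side of \<open>a\<close>; only the other boundary of the cone can shrink.
  Crossing \<open>b\<close>, \<open>q\<close> is the mirror image, obtained through
  \<open>sees_swap\<close>.\<close>

lemma sees_step:
  assumes s: "sees r e a b q \<alpha> \<beta>" and t: "0 < t" "t < 1"
    and z: "in_cone e \<beta> \<alpha> ((1 - t) *\<^sub>R a + t *\<^sub>R q)" and p: "near e q a p < 0"
    and cot: "0 \<le> ((p - a) \<bullet> (p - q)) / (- near e q a p) + ((b - a) \<bullet> (b - q)) / near e q a b"
  shows "\<exists>\<beta>'. sees r e a q p \<alpha> \<beta>' \<and> in_cone e \<beta>' \<alpha> ((1 - t) *\<^sub>R a + t *\<^sub>R q) \<and>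
           (\<forall>w. in_cone e \<beta>' \<alpha> w \<longrightarrow> in_cone e \<beta> \<alpha> w)"
proof -
  define z where "z = (1 - t) *\<^sub>R a + t *\<^sub>R q"
  \<comment> \<open>The vertex \<open>q\<close> becomes the blocker exactly if it narrows the cone;
    it is then visible, so \<open>sees_vertex\<close> gives \<open>r \<le> norm q\<close>.\<close>
  define \<beta>' where "\<beta>' = (if 0 < wedge e \<beta> q then q else \<beta>)"
  from s obtain h where ba: "0 < wedge e b a" and q: "near e b a q < 0" and
    c: "0 \<le> wedge e \<alpha> a" "0 \<le> wedge e b \<beta>" "0 < wedge e b \<alpha>" "0 < wedge e \<beta> a" and \<beta>\<alpha>: "0 < wedge e \<beta> \<alpha>" and
    nr: "0 \<le> near e b a \<alpha>" "0 \<le> near e b a \<beta>" and r: "r \<le> norm \<alpha>" "r \<le> norm \<beta>" and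
    h: "affine_fun h" "h a = (norm a)\<^sup>2" "h b = (norm b)\<^sup>2" "h q = (norm q)\<^sup>2" and
    hr: "\<And>w. 0 \<le> wedge e \<beta> w \<Longrightarrow> 0 \<le> wedge e w \<alpha> \<Longrightarrow> near e b a w \<le> 0 \<Longrightarrow> r * norm w \<le> h w"
    unfolding sees_def by blast
  have zc: "0 < wedge e \<beta> z" "0 < wedge e z \<alpha>" using z by (auto simp: in_cone_def z_def)
  have asym: "wedge e x y = - wedge e y x" for x y by (simp add: wedge_def algebra_simps)
  have \<beta>\<alpha>_expand: "wedge e \<beta> \<alpha> * wedge e x y = wedge e x \<alpha> * wedge e \<beta> y + wedge e \<beta> x * wedge e \<alpha> y" for x y
    using plucker[of e \<beta> \<alpha> x y] asym[of x \<beta>] by simp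
  have "0 < wedge e \<beta> \<alpha> * wedge e z a"
    unfolding \<beta>\<alpha>_expand[of z a] using zc c by (simp add: add_pos_nonneg)
  then have "0 < wedge e z a" using \<beta>\<alpha> by (simp add: zero_less_mult_iff)
  then have qa: "0 < wedge e q a" using t by (simp add: z_def wedge_comb zero_less_mult_iff)
  have "t * wedge e q \<alpha> = wedge e z \<alpha> + (1 - t) * wedge e \<alpha> a"
    by (simp add: z_def wedge_comb asym[of \<alpha> a])
  moreover have "0 \<le> (1 - t) * wedge e \<alpha> a" using t c by simp
  ultimately have "0 < t * wedge e q \<alpha>" using zc by linarith
  then have q\<alpha>: "0 < wedge e q \<alpha>" using t by (simp add: zero_less_mult_iff)
  have nb: "0 < near e q a b" using q by (simp add: near_rot[of e q a b])
  have near': "wedge e b a * near e q a w = near e b a w * wedge e q a + wedge e w a * near e q a b" for w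
    by (simp add: near_def wedge_def algebra_simps)
  have near'_nonneg: "0 \<le> near e q a w" if "0 \<le> near e b a w" "0 \<le> wedge e w a" for w
  proof -
    have "0 \<le> wedge e b a * near e q a w" unfolding near' using that qa nb by simp
    then show ?thesis using ba by (simp add: zero_le_mult_iff)
  qed
  have vertex: "r \<le> norm q" if "0 < wedge e \<beta> q"
    using sees_vertex[OF s] that q\<alpha> by (simp add: in_cone_def)
  obtain h' where h': "affine_fun h'" "h' a = (norm a)\<^sup>2" "h' q = (norm q)\<^sup>2" "h' p = (norm p)\<^sup>2"
      "\<And>w. near e q a w \<le> 0 \<Longrightarrow> h w \<le> h' w"
    using extend_lift[OF h(1,2,4,3) nb p cot] by auto
  have q\<alpha>_expand: "wedge e q \<alpha> * wedge e \<beta> w = wedge e w \<alpha> * wedge e \<beta> q + wedge e q w * wedge e \<beta> \<alpha>" for w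
    by (simp add: wedge_def algebra_simps)
  have cone: "0 \<le> wedge e \<beta> w" if "0 \<le> wedge e \<beta>' w" "0 \<le> wedge e w \<alpha>" for w
  proof (cases "0 < wedge e \<beta> q")
    case True
    then have "0 \<le> wedge e q \<alpha> * wedge e \<beta> w" unfolding q\<alpha>_expand using that \<beta>\<alpha> by (simp add: \<beta>'_def)
    then show ?thesis using q\<alpha> by (simp add: zero_le_mult_iff)
  qed (use that in \<open>simp add: \<beta>'_def\<close>)
  have icone: "in_cone e \<beta> \<alpha> w" if "in_cone e \<beta>' \<alpha> w" for w
  proof (cases "0 < wedge e \<beta> q")
    case True
    then have "0 < wedge e q \<alpha> * wedge e \<beta> w"
      unfolding q\<alpha>_expand using that \<beta>\<alpha> by (simp add: \<beta>'_def in_cone_def add_pos_pos)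
    then show ?thesis using q\<alpha> that by (simp add: zero_less_mult_iff in_cone_def)
  qed (use that in \<open>simp add: \<beta>'_def\<close>)
  have lift: "r * norm w \<le> h' w"
    if w: "0 \<le> wedge e \<beta>' w" "0 \<le> wedge e w \<alpha>" "near e q a w \<le> 0" for w
  proof -
    have b0: "0 \<le> wedge e \<beta> w" using cone w by blast
    have "0 \<le> wedge e \<beta> \<alpha> * wedge e w a" unfolding \<beta>\<alpha>_expand[of w a] using b0 w c by simp
    then have wa: "0 \<le> wedge e w a" using \<beta>\<alpha> by (simp add: zero_le_mult_iff)
    \<comment> \<open>Inside the cone, a point beyond the new edge is also beyond the old one, so
      the old bound applies to it.\<close>
    have "near e b a w \<le> 0"
    proof (rule ccontr)
      assume "\<not> ?thesis"
      then have "0 < wedge e b a * near e q a w" unfolding near' using qa nb wa by (simp add: add_pos_nonneg)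
      then show False using ba w by (simp add: zero_less_mult_iff)
    qed
    then show ?thesis using hr[OF b0 w(2)] h'(5)[OF w(3)] by linarith
  qed
  have "sees r e a q p \<alpha> \<beta>'"
    unfolding sees_def
  proof (intro conjI exI[of _ h'] allI impI)
    show "0 \<le> wedge e q \<beta>'" using asym[of q \<beta>] by (auto simp: \<beta>'_def)
    show "0 \<le> near e q a \<alpha>" "0 \<le> near e q a \<beta>'"
      using near'_nonneg nr c by (auto simp: \<beta>'_def)
  qed (use qa p c q\<alpha> \<beta>\<alpha> r vertex h' lift in \<open>auto simp: \<beta>'_def\<close>)
  moreover have "in_cone e \<beta>' \<alpha> z"
  proof -
    have "wedge e q z = (1 - t) * wedge e q a" by (simp add: z_def wedge_comb)
    then show ?thesis using zc qa t by (simp add: in_cone_def \<beta>'_def)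
  qed
  ultimately show ?thesis using icone unfolding z_def by blast
qed

text \<open>In the frame with \<open>a\<close> at 0 and \<open>q\<close> at 1 the apex is
  \<open>Complex x (e * y)\<close>: \<open>x\<close> is the foot of the altitude, the hypothesis on
  \<open>s\<close> and \<open>t\<close> makes \<open>y\<close> real, and the sign \<open>e\<close>
  puts the apex on the far side of the edge.\<close>

lemma third_point:
  fixes a q :: complex
  assumes aq: "a \<noteq> q" and e: "e\<^sup>2 = 1"
    and tri: "(s\<^sup>2 + (dist a q)\<^sup>2 - t\<^sup>2)\<^sup>2 \<le> 4 * s\<^sup>2 * (dist a q)\<^sup>2" and st: "0 \<le> s" "0 \<le> t"
  obtains p where "dist p a = s" "dist p q = t" "near e q a p \<le> 0"
proof -
  define L where "L = (dist a q)\<^sup>2"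
  have L: "0 < L" using aq by (simp add: L_def)
  define x where "x = (s\<^sup>2 + L - t\<^sup>2) / (2 * L)"
  have "x\<^sup>2 = (s\<^sup>2 + L - t\<^sup>2)\<^sup>2 / (4 * L\<^sup>2)" by (simp add: x_def power_divide power_mult_distrib)
  also have "\<dots> \<le> 4 * s\<^sup>2 * L / (4 * L\<^sup>2)" using tri L by (intro divide_right_mono) (auto simp: L_def)
  also have "\<dots> = s\<^sup>2 / L" using L by (simp add: power2_eq_square)
  finally have x2: "x\<^sup>2 \<le> s\<^sup>2 / L" .
  define y where "y = sqrt (s\<^sup>2 / L - x\<^sup>2)"
  have y: "0 \<le> y" "y\<^sup>2 = s\<^sup>2 / L - x\<^sup>2" using x2 by (auto simp: y_def)
  define p where "p = a + (q - a) * Complex x (e * y)"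
  have nL: "(norm (q - a))\<^sup>2 = L" by (simp add: L_def dist_norm norm_minus_commute)
  have ey: "(e * y)\<^sup>2 = y\<^sup>2" using e by (simp add: power_mult_distrib)
  have nz: "(norm (Complex x (e * y)))\<^sup>2 = x\<^sup>2 + y\<^sup>2"
      "(norm (Complex x (e * y) - 1))\<^sup>2 = (x - 1)\<^sup>2 + y\<^sup>2"
    unfolding cmod_power2 by (simp_all add: ey)
  have "(dist p a)\<^sup>2 = L * (x\<^sup>2 + y\<^sup>2)"
    by (simp add: p_def dist_norm norm_mult power_mult_distrib nL nz)
  then have 1: "(dist p a)\<^sup>2 = s\<^sup>2" using L y by simp
  have "p - q = (q - a) * (Complex x (e * y) - 1)" by (simp add: p_def algebra_simps)
  then have "(dist p q)\<^sup>2 = L * ((x - 1)\<^sup>2 + y\<^sup>2)"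
    by (simp add: dist_norm norm_mult power_mult_distrib nL nz)
  also have "\<dots> = s\<^sup>2 - 2 * L * x + L" using L y by (simp add: power2_eq_square algebra_simps)
  also have "\<dots> = t\<^sup>2" using L by (simp add: x_def field_simps)
  finally have 2: "(dist p q)\<^sup>2 = t\<^sup>2" .
  have "near e q a p = - (e * e * y) * ((Re q - Re a)\<^sup>2 + (Im q - Im a)\<^sup>2)"
    by (simp add: near_def wedge_def p_def power2_eq_square algebra_simps)
  also have "\<dots> \<le> 0" using y e by (simp add: power2_eq_square)
  finally show ?thesis using 1 2 st that[of p] by (simp add: power2_eq_iff_nonneg)
qed

text \<open>Lagrange's identity for the vectors from \<open>p\<close> to \<open>a\<close> and
  \<open>q\<close>: cross product squared plus inner product squared.\<close>

lemma near_inner: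
  assumes "e\<^sup>2 = 1"
  shows "(near e q a p)\<^sup>2 + ((p - a) \<bullet> (p - q))\<^sup>2 = (dist p a)\<^sup>2 * (dist p q)\<^sup>2"
proof -
  have "(near e q a p)\<^sup>2 = e\<^sup>2 * ((Re q - Re p) * (Im a - Im p) - (Im q - Im p) * (Re a - Re p))\<^sup>2"
    by (simp add: near_def wedge_def power2_eq_square algebra_simps)
  then show ?thesis using assms
    by (simp add: dist_norm cmod_def inner_complex_def) (simp add: power2_eq_square algebra_simps)
qed

lemma inner_dist: "(p - a) \<bullet> (p - q) = ((dist p a)\<^sup>2 + (dist p q)\<^sup>2 - (dist a q)\<^sup>2) / 2"
  for p a q :: complex
  by (simp add: dist_norm cmod_def inner_complex_def) (simp add: power2_eq_square algebra_simps)

section \<open>The hexagonal lattice and its faces\<close>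

definition adj :: "int \<times> int \<Rightarrow> int \<times> int \<Rightarrow> bool" where
  "adj v w \<longleftrightarrow> (\<exists>k<6. w = v + hex_dir k)"

definition tri :: "int \<times> int \<Rightarrow> int \<times> int \<Rightarrow> int \<times> int \<Rightarrow> bool" where
  "tri u v w \<longleftrightarrow> adj u v \<and> adj v w \<and> adj w u"

lemma hex_dir_simps [simp]:
  "hex_dir 0 = (1,0)" "hex_dir 1 = (0,1)" "hex_dir (Suc 0) = (0,1)" "hex_dir 2 = (-1,1)" "hex_dir 3 = (-1,0)" "hex_dir 4 = (0,-1)" "hex_dir 5 = (1,-1)"
  by (simp_all add: hex_dir_def)

lemma adj_iff:
  "adj v w \<longleftrightarrow> (fst w - fst v, snd w - snd v) \<in> {(1,0),(0,1),(-1,1),(-1,0),(0,-1),(1,-1)}"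
proof -
  have 1: "w = v + d \<longleftrightarrow> (fst w - fst v, snd w - snd v) = d" for d :: "int \<times> int"
    by (cases v; cases w; cases d) auto
  have "adj v w \<longleftrightarrow> (\<exists>k\<in>{0,1,2,3,4,5}. w = v + hex_dir k)"
    unfolding adj_def less6 by (rule Bex_def[symmetric])
  also have "\<dots> \<longleftrightarrow> (fst w - fst v, snd w - snd v) \<in> hex_dir ` {0,1,2,3,4,5}"
    unfolding 1 by (rule image_iff[symmetric])
  also have "hex_dir ` {0,1,2,3,4,5} = {(1,0),(0,1),(-1,1),(-1,0),(0,-1),(1,-1)}"
    by simp
  finally show ?thesis .
qed

lemma adj_sym: "adj v w \<longleftrightarrow> adj w v"
proof -
  have "(x, y) \<in> {(1,0),(0,1),(-1,1),(-1,0),(0,-1),(1,-1)} \<longleftrightarrow>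
      (- x, - y) \<in> {(1,0),(0,1),(-1,1),(-1,0),(0,-1),(1,-1)}" for x y :: int
    by (simp only: insert_iff empty_iff prod.inject) presburger
  from this[of "fst w - fst v" "snd w - snd v"]
  show ?thesis unfolding adj_iff by (simp only: minus_diff_eq)
qed

lemma adj_irrefl [simp]: "\<not> adj v v"
  unfolding adj_iff by auto

lemma tri_distinct: "tri u v w \<Longrightarrow> u \<noteq> v \<and> v \<noteq> w \<and> u \<noteq> w"
  unfolding tri_def by auto

lemma tri_rot: "tri u v w \<longleftrightarrow> tri v w u"
  unfolding tri_def by auto

lemma tri_swap: "tri u v w \<longleftrightarrow> tri v u w"
  unfolding tri_def using adj_sym by blast

lemma hex_dir_inj: "k < 6 \<Longrightarrow> j < 6 \<Longrightarrow> hex_dir k = hex_dir j \<Longrightarrow> k = j"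
  unfolding less6 by (elim insertE emptyE; simp)

lemma adj_dir_dir:
  assumes "k < 6" "j < 6"
  shows "adj (a + hex_dir k) (a + hex_dir j) \<longleftrightarrow> j = nxt k \<or> j = prv k"
proof -
  have "adj (a + hex_dir k) (a + hex_dir j) \<longleftrightarrow> adj (hex_dir k) (hex_dir j)"
    unfolding adj_iff fst_add snd_add by (simp only: add_diff_add diff_self add_0)
  then show ?thesis
    using assms unfolding less6 by (elim insertE emptyE; simp only:; simp add: adj_iff)
qed

text \<open>The directions are listed in cyclic order, so an edge from the centre lies in exactly
  two faces, one on each side.\<close>

lemma tri_dir:
  assumes k: "k < 6"
  shows "tri a (a + hex_dir k) c \<longleftrightarrow> c = a + hex_dir (nxt k) \<or> c = a + hex_dir (prv k)"
proof
  assume "tri a (a + hex_dir k) c"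
  then obtain j where j: "j < 6" "c = a + hex_dir j" "adj (a + hex_dir k) c"
    unfolding tri_def adj_sym[of c a] adj_def[of a c] by (elim conjE exE)
  then show "c = a + hex_dir (nxt k) \<or> c = a + hex_dir (prv k)"
    using adj_dir_dir[OF k j(1), of a] by auto
next
  assume c: "c = a + hex_dir (nxt k) \<or> c = a + hex_dir (prv k)"
  have l: "nxt k < 6" "prv k < 6" by (simp_all add: nxt_def prv_def)
  have "adj a (a + hex_dir k)" using k unfolding adj_def by blast
  moreover have "adj (a + hex_dir k) c" "adj c a"
    using c adj_dir_dir[OF k l(1), of a] adj_dir_dir[OF k l(2), of a] l
    unfolding adj_sym[of c a] by (auto simp: adj_def[of a])
  ultimately show "tri a (a + hex_dir k) c" by (simp add: tri_def)
qed

lemma tri_third: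
  assumes "tri a b c" "tri a b c'" "tri a b q" "c \<noteq> q" "c' \<noteq> q"
  shows "c = c'"
proof -
  from assms(1) obtain k where k: "k < 6" "b = a + hex_dir k" unfolding tri_def adj_def by blast
  show ?thesis using assms unfolding k(2) tri_dir[OF k(1)] by auto
qed

definition faces :: "(int \<times> int) set set" where
  "faces = {{u, v, w} | u v w. tri u v w}"

lemma faces_elem:
  assumes "f \<in> faces" "a \<in> f"
  obtains b c where "f = {a, b, c}" "tri a b c"
proof -
  from assms obtain u v w where f: "f = {u, v, w}" "tri u v w" unfolding faces_def by blast
  from assms(2) f(1) consider "a = u" | "a = v" | "a = w" by blast
  then show thesis
  proof cases
    case 1 then show ?thesis using f that by blast
  next
    case 2
    have "f = {v, w, u}" "tri v w u" using f by (auto simp: tri_def)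
    then show ?thesis using that 2 by blast
  next
    case 3
    have "f = {w, u, v}" "tri w u v" using f by (auto simp: tri_def)
    then show ?thesis using that 3 by blast
  qed
qed

lemma faces_edge:
  assumes "f \<in> faces" "a \<in> f" "b \<in> f" "a \<noteq> b"
  obtains c where "f = {a, b, c}" "tri a b c"
proof -
  from faces_elem[OF assms(1,2)] obtain u v where f: "f = {a, u, v}" "tri a u v" by blast
  then consider "b = u" | "b = v" using assms by blast
  then show thesis
  proof cases
    case 2
    have "f = {a, v, u}" "tri a v u" using f tri_rot tri_swap by auto
    then show ?thesis using 2 that by blast
  qed (use f that in blast)
qed

lemma finite_face: "f \<in> faces \<Longrightarrow> finite f"
  unfolding faces_def by auto

lemma tri_face: "tri a b c \<Longrightarrow> {a, b, c} \<in> faces"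
  unfolding faces_def by blast

text \<open>
  With \<open>X = exp (-2 u)\<close> the conformal metric has squared edge lengths \<open>1 / (X v * X w)\<close>, and each
  face \<open>a\<close>, \<open>b\<close>, \<open>c\<close> is similar to the triangle with squared sides \<open>X a\<close>, \<open>X b\<close>, \<open>X c\<close> opposite to these
  vertices.  The Delaunay condition becomes linear in \<open>X\<close>.
\<close>

definition sqlen :: "(int \<times> int \<Rightarrow> real) \<Rightarrow> int \<times> int \<Rightarrow> int \<times> int \<Rightarrow> real" where
  "sqlen X v w = (if v = w then 0 else 1 / (X v * X w))"

lemma sqlen_sym: "sqlen X v w = sqlen X w v"
  by (simp add: sqlen_def mult.commute)

text \<open>When the increments \<open>\<delta>\<close> of barycentric coordinates sum to 0, this is
  the squared length of the displacement, written with squared edge lengths only (Schoenberg's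
  form). It needs no chosen realization and depends continuously on \<open>X\<close>.\<close>

definition quad :: "(int \<times> int \<Rightarrow> real) \<Rightarrow> (int \<times> int) set \<Rightarrow> (int \<times> int \<Rightarrow> real) \<Rightarrow> real" where
  "quad X f \<delta> = - (\<Sum>v\<in>f. \<Sum>w\<in>f. \<delta> v * \<delta> w * sqlen X v w) / 2"

definition realize :: "(int \<times> int \<Rightarrow> real) \<Rightarrow> (int \<times> int) set \<Rightarrow> (int \<times> int \<Rightarrow> complex) \<Rightarrow> bool" where
  "realize X f P \<longleftrightarrow> (\<forall>v\<in>f. \<forall>w\<in>f. (dist (P v) (P w))\<^sup>2 = sqlen X v w)"

section \<open>Barycentric points of a realized face\<close>

definition bary_point :: "(int \<times> int \<Rightarrow> complex) \<Rightarrow> (int \<times> int) set \<Rightarrow> (int \<times> int \<Rightarrow> real) \<Rightarrow> complex" where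
  "bary_point P f p = (\<Sum>v\<in>f. p v *\<^sub>R P v)"

text \<open>Weights live on all vertices and vanish off the face, so one function describes the same
  point in every face that contains it.\<close>

definition bary_weights :: "(int \<times> int \<Rightarrow> real) \<Rightarrow> (int \<times> int) set \<Rightarrow> bool" where
  "bary_weights p f \<longleftrightarrow> (\<forall>v. 0 \<le> p v) \<and> (\<forall>v. v \<notin> f \<longrightarrow> p v = 0) \<and> sum p f = 1"

text \<open>Polarization: in the expanded double sum the terms depending on one index only are
  multiplied by \<open>sum \<delta> f = 0\<close>.\<close>

lemma norm_sq_sum:
  fixes P :: "'b \<Rightarrow> 'a :: real_inner"
  assumes "sum \<delta> f = 0"
  shows "(norm (\<Sum>v\<in>f. \<delta> v *\<^sub>R P v))\<^sup>2 = - (\<Sum>v\<in>f. \<Sum>w\<in>f. \<delta> v * \<delta> w * (dist (P v) (P w))\<^sup>2) / 2"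
proof -
  have d: "(dist (P v) (P w))\<^sup>2 = (P v \<bullet> P v) + (P w \<bullet> P w) - 2 * (P v \<bullet> P w)" for v w
    by (simp add: dist_norm power2_norm_eq_inner inner_diff_left inner_diff_right inner_commute)
  have z1: "(\<Sum>v\<in>f. \<Sum>w\<in>f. \<delta> v * \<delta> w * (P v \<bullet> P v)) = 0"
  proof -
    have "(\<Sum>w\<in>f. \<delta> v * \<delta> w * (P v \<bullet> P v)) = \<delta> v * (P v \<bullet> P v) * sum \<delta> f" for v
      unfolding sum_distrib_left by (intro sum.cong) (auto simp: mult_ac)
    then show ?thesis using assms by simp
  qed
  have z2: "(\<Sum>v\<in>f. \<Sum>w\<in>f. \<delta> v * \<delta> w * (P w \<bullet> P w)) = 0"
  proof -
    have "(\<Sum>w\<in>f. \<delta> v * \<delta> w * (P w \<bullet> P w)) = \<delta> v * (\<Sum>w\<in>f. \<delta> w * (P w \<bullet> P w))" for v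
      unfolding sum_distrib_left by (intro sum.cong) (auto simp: mult_ac)
    then show ?thesis using assms by (simp add: sum_distrib_right[symmetric])
  qed
  have "(\<Sum>v\<in>f. \<Sum>w\<in>f. \<delta> v * \<delta> w * (dist (P v) (P w))\<^sup>2) =
    (\<Sum>v\<in>f. \<Sum>w\<in>f. \<delta> v * \<delta> w * (P v \<bullet> P v)) + (\<Sum>v\<in>f. \<Sum>w\<in>f. \<delta> v * \<delta> w * (P w \<bullet> P w))
     - 2 * (\<Sum>v\<in>f. \<Sum>w\<in>f. \<delta> v * \<delta> w * (P v \<bullet> P w))"
    unfolding d right_diff_distrib distrib_left sum.distrib sum_subtractf sum_distrib_left
    by (simp add: mult_ac)
  moreover have "(norm (\<Sum>v\<in>f. \<delta> v *\<^sub>R P v))\<^sup>2 = (\<Sum>v\<in>f. \<Sum>w\<in>f. \<delta> v * \<delta> w * (P v \<bullet> P w))"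
    unfolding power2_norm_eq_inner inner_sum_left inner_sum_right inner_scaleR_left inner_scaleR_right
      sum_distrib_left
    by (intro sum.cong refl) (simp add: inner_commute mult_ac)
  ultimately show ?thesis unfolding z1 z2 by simp
qed

lemma bary_point_dist:
  assumes "finite f" "realize X f P" "sum p f = 1" "sum p' f = 1"
  shows "(dist (bary_point P f p') (bary_point P f p))\<^sup>2 = quad X f (\<lambda>v. p' v - p v)"
proof -
  have "bary_point P f p' - bary_point P f p = (\<Sum>v\<in>f. (p' v - p v) *\<^sub>R P v)"
    by (simp add: bary_point_def sum_subtractf scaleR_diff_left)
  moreover have "sum (\<lambda>v. p' v - p v) f = 0" using assms by (simp add: sum_subtractf)
  ultimately have "(dist (bary_point P f p') (bary_point P f p))\<^sup>2 =
     - (\<Sum>v\<in>f. \<Sum>w\<in>f. (p' v - p v) * (p' w - p w) * (dist (P v) (P w))\<^sup>2) / 2"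
    by (simp add: dist_norm norm_sq_sum)
  also have "\<dots> = quad X f (\<lambda>v. p' v - p v)"
    unfolding quad_def using assms(2) by (simp add: realize_def)
  finally show ?thesis .
qed

definition face_len :: "(int \<times> int \<Rightarrow> real) \<Rightarrow> (int \<times> int) set \<Rightarrow> (int \<times> int \<Rightarrow> real) \<Rightarrow> (int \<times> int \<Rightarrow> real) \<Rightarrow> real" where
  "face_len X f p p' = sqrt (quad X f (\<lambda>v. p' v - p v))"

lemma bary_point_flen:
  assumes "finite f" "realize X f P" "bary_weights p f" "bary_weights p' f"
  shows "dist (bary_point P f p') (bary_point P f p) = face_len X f p p'"
proof -
  have "(dist (bary_point P f p') (bary_point P f p))\<^sup>2 = quad X f (\<lambda>v. p' v - p v)"
    using bary_point_dist[OF assms(1,2)] assms(3,4) by (simp add: bary_weights_def)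
  then show ?thesis unfolding face_len_def by (metis real_sqrt_abs abs_of_nonneg zero_le_dist)
qed

lemma bary_point_cong:
  assumes "finite f" "finite g" "\<And>v. v \<in> f \<Longrightarrow> v \<in> g \<Longrightarrow> P v = P' v"
    "bary_weights p f" "bary_weights p g"
  shows "bary_point P f p = bary_point P' g p"
proof -
  have "bary_point P f p = bary_point P (f \<inter> g) p" unfolding bary_point_def
    using assms by (intro sum.mono_neutral_right) (auto simp: bary_weights_def)
  also have "\<dots> = bary_point P' (f \<inter> g) p" unfolding bary_point_def using assms by (intro sum.cong) auto
  also have "\<dots> = bary_point P' g p" unfolding bary_point_def
    using assms by (intro sum.mono_neutral_left) (auto simp: bary_weights_def)
  finally show ?thesis .
qed

lemma quad_cong:
  assumes "finite f" "finite g" "\<And>v. v \<notin> f \<Longrightarrow> \<delta> v = 0" "\<And>v. v \<notin> g \<Longrightarrow> \<delta> v = 0"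
  shows "quad X f \<delta> = quad X g \<delta>"
proof -
  have *: "(\<Sum>v\<in>f. \<Sum>w\<in>f. \<delta> v * \<delta> w * sqlen X v w) = (\<Sum>v\<in>f \<union> g. \<Sum>w\<in>f \<union> g. \<delta> v * \<delta> w * sqlen X v w)"
    if "finite f" "finite g" "\<And>v. v \<notin> f \<Longrightarrow> \<delta> v = 0" for f g :: "(int \<times> int) set"
  proof -
    have "(\<Sum>w\<in>f. \<delta> v * \<delta> w * sqlen X v w) = (\<Sum>w\<in>f \<union> g. \<delta> v * \<delta> w * sqlen X v w)" for v
      using that by (intro sum.mono_neutral_left) auto
    then have "(\<Sum>v\<in>f. \<Sum>w\<in>f. \<delta> v * \<delta> w * sqlen X v w) = (\<Sum>v\<in>f. \<Sum>w\<in>f \<union> g. \<delta> v * \<delta> w * sqlen X v w)"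
      by simp
    also have "\<dots> = (\<Sum>v\<in>f \<union> g. \<Sum>w\<in>f \<union> g. \<delta> v * \<delta> w * sqlen X v w)"
      using that by (intro sum.mono_neutral_left) auto
    finally show ?thesis .
  qed
  show ?thesis unfolding quad_def using *[of f g] *[of g f] assms by (simp add: Un_commute)
qed

text \<open>The common denominator cancels in the quotient, so the cotangent of the angle at
  \<open>p\<close> is that of the similar triangle with squared sides \<open>X a\<close>,
  \<open>X q\<close>, \<open>X p\<close>.\<close>

lemma realize_inner:
  assumes "realize X {a, q, p} P" "distinct [a, q, p]" "0 < X a" "0 < X q" "0 < X p" "e\<^sup>2 = 1"
  shows "(P p - P a) \<bullet> (P p - P q) = (X a + X q - X p) / (2 * X a * X q * X p)"
    and "\<bar>near e (P q) (P a) (P p)\<bar> = sqrt (heron (X a) (X q) (X p)) / (2 * X a * X q * X p)"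
proof -
  have d: "(dist (P p) (P a))\<^sup>2 = 1 / (X p * X a)" "(dist (P p) (P q))\<^sup>2 = 1 / (X p * X q)"
    "(dist (P a) (P q))\<^sup>2 = 1 / (X a * X q)"
    using assms(1,2) by (auto simp: realize_def sqlen_def)
  show i: "(P p - P a) \<bullet> (P p - P q) = (X a + X q - X p) / (2 * X a * X q * X p)"
    unfolding inner_dist d using assms(3-5) by (simp add: field_simps)
  have "(near e (P q) (P a) (P p))\<^sup>2 = 1 / (X p * X a) * (1 / (X p * X q)) -
      ((X a + X q - X p) / (2 * X a * X q * X p))\<^sup>2"
    using near_inner[OF assms(6), of "P q" "P a" "P p"] unfolding i d by linarith
  also have "\<dots> = heron (X a) (X q) (X p) / (2 * X a * X q * X p)\<^sup>2"
    using assms(3-5) by (simp add: heron_def field_simps power2_eq_square)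
  finally have "sqrt ((near e (P q) (P a) (P p))\<^sup>2) = sqrt (heron (X a) (X q) (X p) / (2 * X a * X q * X p)\<^sup>2)"
    by (rule arg_cong)
  then show "\<bar>near e (P q) (P a) (P p)\<bar> = sqrt (heron (X a) (X q) (X p)) / (2 * X a * X q * X p)"
    using assms(3-5) by (simp add: real_sqrt_divide)
qed

text \<open>Unfolds a face across its edge \<open>a\<close>, \<open>q\<close>, on the far side for
  the orientation \<open>e\<close>; the hypothesis of \<open>third_point\<close> becomes
  \<open>heron\<close> divided by a square.\<close>

lemma realize_extend:
  assumes P: "(dist (P a) (P q))\<^sup>2 = sqlen X a q" and d: "distinct [a, q, p]"
    and X: "0 < X a" "0 < X q" "0 < X p" and e: "e\<^sup>2 = 1" and h: "0 \<le> heron (X a) (X q) (X p)"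
  obtains z where "realize X {a, q, p} (P(p := z))" "near e (P q) (P a) z \<le> 0"
proof -
  have L: "(dist (P a) (P q))\<^sup>2 = 1 / (X a * X q)" using P d by (simp add: sqlen_def)
  have aq: "P a \<noteq> P q" using L X by auto
  define s t where "s = sqrt (1 / (X a * X p))" and "t = sqrt (1 / (X q * X p))"
  have st: "s\<^sup>2 = 1 / (X a * X p)" "t\<^sup>2 = 1 / (X q * X p)" "0 \<le> s" "0 \<le> t"
    using X by (auto simp: s_def t_def)
  have "4 * s\<^sup>2 * (dist (P a) (P q))\<^sup>2 - (s\<^sup>2 + (dist (P a) (P q))\<^sup>2 - t\<^sup>2)\<^sup>2 =
     heron (X a) (X q) (X p) / (X a * X q * X p)\<^sup>2"
    unfolding L st using X by (simp add: field_simps heron_def power2_eq_square)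
  also have "\<dots> \<ge> 0" using h by simp
  finally obtain z where z: "dist z (P a) = s" "dist z (P q) = t" "near e (P q) (P a) z \<le> 0"
    using third_point[OF aq e, of s t] st by auto
  have "realize X {a, q, p} (P(p := z))"
    using d z st L by (auto simp: realize_def sqlen_def dist_commute mult.commute)
  then show thesis using z that by blast
qed

section \<open>Vertices are far apart in the intrinsic distance\<close>

declare split_paired_All [simp del] split_paired_Ex [simp del]

text \<open>Strict triangle inequalities keep every unfolded face nondegenerate, so that its signed
  area has a definite sign and can be divided by.\<close>

locale strict_delaunay =
  fixes X :: "int \<times> int \<Rightarrow> real" and r :: real and i :: "int \<times> int"
  assumes pos: "0 < X v"
    and strict: "tri a b c \<Longrightarrow> 0 < heron (X a) (X b) (X c)"
    and delaunay: "tri a b c \<Longrightarrow> tri a b c' \<Longrightarrow> c \<noteq> c' \<Longrightarrow> X c + X c' \<le> 2 * (X a + X b)"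
    and r: "adj i k \<Longrightarrow> r \<le> sqrt (sqlen X i k)"
begin

lemma near_nonzero:
  assumes "tri a q p" "realize X {a, q, p} P" "e\<^sup>2 = 1"
  shows "near e (P q) (P a) (P p) \<noteq> 0"
proof -
  have "0 < \<bar>near e (P q) (P a) (P p)\<bar>"
    using realize_inner(2)[OF assms(2) _ pos pos pos assms(3)] tri_distinct[OF assms(1)]
      strict[OF assms(1)] pos by simp
  then show ?thesis by simp
qed

text \<open>Turns the linear Delaunay inequality into the cotangent condition that
  \<open>sees_base\<close> and \<open>sees_step\<close> require.\<close>

lemma cot_nonneg:
  assumes t: "tri a q p" "tri a q b" "b \<noteq> p" and e: "e\<^sup>2 = 1"
    and P: "realize X {a, q, p} P" and P': "realize X {a, q, b} P'" "P' a = P a" "P' q = P q"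
    and n: "near e (P q) (P a) (P p) < 0" "0 < near e (P q) (P a) (P' b)"
  shows "0 \<le> ((P p - P a) \<bullet> (P p - P q)) / (- near e (P q) (P a) (P p)) +
             ((P' b - P a) \<bullet> (P' b - P q)) / near e (P q) (P a) (P' b)"
proof -
  have ratio: "((P p - P a) \<bullet> (P p - P q)) / \<bar>near e (P q) (P a) (P p)\<bar> =
      (X a + X q - X p) / sqrt (4 * X a * X q - (X a + X q - X p)\<^sup>2)"
    if "tri a q p" "realize X {a, q, p} P" for p P
    using realize_inner[OF that(2) _ pos pos pos e] tri_distinct[OF that(1)] pos[of a] pos[of q] pos[of p]
    by (simp add: heron_def)
  have h: "(X a + X q - X p)\<^sup>2 < 4 * X a * X q" if "tri a q p" for p
    using strict[OF that] by (simp add: heron_def)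
  have "0 \<le> (X a + X q - X p) + (X a + X q - X b)"
    using delaunay[OF t(1,2)] t(3) by auto
  from cot_sum_nonneg(1)[OF h[OF t(1)] h[OF t(2)] this]
  show ?thesis
    using ratio[OF t(1) P] ratio[OF t(2) P'(1)] n P'(2,3) by (simp add: abs_if)
qed

text \<open>The last face \<open>a\<close>, \<open>b\<close>, \<open>q\<close> of an unfolding that
  starts at \<open>i\<close>, entered through \<open>a\<close>, \<open>b\<close>. \<open>P\<close>
  is overwritten at each new vertex, so its values are meaningful on this face only; a vertex may be
  met again at another place. \<open>step\<close> crosses \<open>a\<close>, \<open>q\<close>, and
  the other side is reached through \<open>swap\<close>.\<close>

inductive strip ::
    "real \<Rightarrow> int \<times> int \<Rightarrow> int \<times> int \<Rightarrow> int \<times> int \<Rightarrow> (int \<times> int \<Rightarrow> complex) \<Rightarrow> complex \<Rightarrow> complex \<Rightarrow> bool"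
  where
  base: "tri i a b \<Longrightarrow> tri a b q \<Longrightarrow> q \<noteq> i \<Longrightarrow> e\<^sup>2 = 1 \<Longrightarrow> realize X {i, a, b} P \<Longrightarrow> P i = 0 \<Longrightarrow>
    realize X {a, b, q} (P(q := z)) \<Longrightarrow> sees r e (P a) (P b) z (P a) (P b) \<Longrightarrow>
    strip e a b q (P(q := z)) (P a) (P b)"
| step: "strip e a b q P \<alpha> \<beta> \<Longrightarrow> tri a q p \<Longrightarrow> p \<noteq> b \<Longrightarrow> realize X {a, q, p} (P(p := z)) \<Longrightarrow>
    sees r e (P a) (P q) z \<alpha> \<beta>' \<Longrightarrow> (\<forall>w. in_cone e \<beta>' \<alpha> w \<longrightarrow> in_cone e \<beta> \<alpha> w) \<Longrightarrow>
    strip e a q p (P(p := z)) \<alpha> \<beta>'"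
| swap: "strip e a b q P \<alpha> \<beta> \<Longrightarrow> strip (- e) b a q P \<beta> \<alpha>"

section \<open>Following a short path through unfolded faces\<close>

lemma strip_inv:
  assumes "strip e a b q P \<alpha> \<beta>"
  shows "tri a b q \<and> e\<^sup>2 = 1 \<and> realize X {a, b, q} P \<and> sees r e (P a) (P b) (P q) \<alpha> \<beta>"
  using assms
proof induction
  case (base a b q e P z)
  have "(P(q := z)) a = P a" "(P(q := z)) b = P b" "(P(q := z)) q = z"
    using tri_distinct[OF base(2)] by auto
  then show ?case using base by (simp only: simp_thms)
next
  case (step e a b q P \<alpha> \<beta> p z \<beta>')
  have "(P(p := z)) a = P a" "(P(p := z)) q = P q" "(P(p := z)) p = z"
    using tri_distinct[OF step(2)] by auto
  then show ?case using step by (simp only: simp_thms)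
next
  case (swap e a b q P \<alpha> \<beta>)
  have "{b, a, q} = {a, b, q}" by auto
  then show ?case using swap.IH sees_swap tri_swap[of b a q] by auto
qed

text \<open>The point lies either in a face at \<open>i\<close>, placed with \<open>i\<close> at the
  origin, or in the visible cone of the last face of a strip. \<open>\<rho>\<close> stands for the
  length of path spent so far and bounds the distance of the unfolded point from the origin.\<close>

definition visible :: "(int \<times> int) set \<Rightarrow> (int \<times> int \<Rightarrow> real) \<Rightarrow> real \<Rightarrow> bool" where
  "visible f p \<rho> \<longleftrightarrow>
     (\<exists>P. f \<in> faces \<and> i \<in> f \<and> realize X f P \<and> P i = 0 \<and> norm (bary_point P f p) \<le> \<rho>) \<or>
     (\<exists>e a b q P \<alpha> \<beta>. f = {a, b, q} \<and> strip e a b q P \<alpha> \<beta> \<and>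
        in_cone e \<beta> \<alpha> (bary_point P f p) \<and> norm (bary_point P f p) \<le> \<rho>)"

text \<open>Needed for a path that turns back through the entry edge: the preceding face is in the
  star of \<open>i\<close>, or ends a shorter strip whose cone contains the present one.\<close>

lemma strip_pred:
  assumes "strip e a b q P \<alpha> \<beta>"
  shows "(tri i a b \<and> q \<noteq> i \<and> (\<exists>P'. realize X {i, a, b} P' \<and> P' i = 0 \<and> P' a = P a \<and> P' b = P b)) \<or>
    (\<exists>e' a' b' q' P' \<alpha>' \<beta>'. strip e' a' b' q' P' \<alpha>' \<beta>' \<and> {a, b} \<subseteq> {a', b', q'} \<and>
       q \<notin> {a', b', q'} \<and> P' a = P a \<and> P' b = P b \<and>
       (\<forall>w. in_cone e \<beta> \<alpha> w \<longrightarrow> in_cone e' \<beta>' \<alpha>' w))"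
  using assms
proof induction
  case (base a b q e P z)
  then show ?case using tri_distinct[OF base(2)] by auto
next
  case (step e a b q P \<alpha> \<beta> p z \<beta>')
  have "p \<notin> {a, b, q}" using step tri_distinct[OF step(2)] by auto
  moreover have "(P(p := z)) a = P a" "(P(p := z)) q = P q" using tri_distinct[OF step(2)] by auto
  ultimately show ?case using step(1,6)
    by (intro disjI2 exI[of _ e] exI[of _ a] exI[of _ b] exI[of _ q] exI[of _ P] exI[of _ \<alpha>] exI[of _ \<beta>])
      auto
next
  case (swap e a b q P \<alpha> \<beta>)
  from swap.IH show ?case
  proof (elim disjE)
    assume a: "tri i a b \<and> q \<noteq> i \<and> (\<exists>P'. realize X {i, a, b} P' \<and> P' i = 0 \<and> P' a = P a \<and> P' b = P b)"
    have "tri i b a" "{i, b, a} = {i, a, b}" using a tri_rot tri_swap by auto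
    then show ?thesis using a by (intro disjI1) auto
  next
    assume "\<exists>e' a' b' q' P' \<alpha>' \<beta>'. strip e' a' b' q' P' \<alpha>' \<beta>' \<and> {a, b} \<subseteq> {a', b', q'} \<and>
       q \<notin> {a', b', q'} \<and> P' a = P a \<and> P' b = P b \<and>
       (\<forall>w. in_cone e \<beta> \<alpha> w \<longrightarrow> in_cone e' \<beta>' \<alpha>' w)"
    then show ?thesis
    proof (elim exE conjE)
      fix e' a' b' q' P' \<alpha>' \<beta>'
      assume *: "strip e' a' b' q' P' \<alpha>' \<beta>'" "{a, b} \<subseteq> {a', b', q'}" "q \<notin> {a', b', q'}"
        "P' a = P a" "P' b = P b" "\<forall>w. in_cone e \<beta> \<alpha> w \<longrightarrow> in_cone e' \<beta>' \<alpha>' w"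
      show ?thesis unfolding in_cone_swap insert_commute[of b a "{}"]
        by (intro disjI2 exI[of _ e'] exI[of _ a'] exI[of _ b'] exI[of _ q'] exI[of _ P'] exI[of _ \<alpha>']
          exI[of _ \<beta>'] conjI *)
    qed
  qed
qed

lemma bary_point_triple:
  assumes "a \<noteq> b" "a \<noteq> q" "b \<noteq> q"
  shows "bary_point P {a, b, q} p = p a *\<^sub>R P a + p b *\<^sub>R P b + p q *\<^sub>R P q"
  using assms by (simp add: bary_point_def add.assoc)

lemma wt_triple:
  assumes "bary_weights p {a, b, q}" "a \<noteq> b" "a \<noteq> q" "b \<noteq> q"
  shows "p a + p b + p q = 1" "0 \<le> p a" "0 \<le> p b" "0 \<le> p q"
  using assms by (auto simp: bary_weights_def add.assoc simp del: split_paired_All)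

lemma near_pt:
  assumes "bary_weights p {a, b, q}" "a \<noteq> b" "a \<noteq> q" "b \<noteq> q"
  shows "near e (P b) (P a) (bary_point P {a, b, q} p) = p q * near e (P b) (P a) (P q)"
proof -
  have "near e b' a' (x *\<^sub>R a' + (1 - x - z) *\<^sub>R b' + z *\<^sub>R q') = z * near e b' a' q'"
    for x z a' b' q' by (simp add: near_def wedge_def algebra_simps)
  moreover have "p b = 1 - p a - p q" using wt_triple[OF assms] by linarith
  ultimately show ?thesis unfolding bary_point_triple[OF assms(2-4)] by metis
qed

text \<open>Inside one face the unfolded segment has the length \<open>face_len\<close>; as long as
  the total stays below \<open>r\<close>, \<open>sees_stays\<close> keeps it in the cone.\<close>

lemma visible_move:
  assumes v: "visible f p \<rho>" and p: "bary_weights p f" "bary_weights p' f" and l: "\<rho> + face_len X f p p' < r"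
  shows "visible f p' (\<rho> + face_len X f p p')"
  using v[unfolded visible_def]
proof (elim disjE exE conjE)
  fix P assume P: "f \<in> faces" "i \<in> f" "realize X f P" "P i = 0" "norm (bary_point P f p) \<le> \<rho>"
  have "dist (bary_point P f p') (bary_point P f p) = face_len X f p p'"
    using bary_point_flen[OF finite_face[OF P(1)] P(3) p] .
  then have "norm (bary_point P f p') \<le> \<rho> + face_len X f p p'"
    using P(5) norm_triangle_sub[of "bary_point P f p'" "bary_point P f p"] by (simp add: dist_norm)
  then show ?thesis using P unfolding visible_def by blast
next
  fix e a b q P \<alpha> \<beta>
  assume s: "f = {a, b, q}" "strip e a b q P \<alpha> \<beta>" "in_cone e \<beta> \<alpha> (bary_point P f p)" "norm (bary_point P f p) \<le> \<rho>"
  note inv = strip_inv[OF s(2)]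
  have d: "a \<noteq> b" "a \<noteq> q" "b \<noteq> q" using tri_distinct inv by blast+
  have fin: "finite f" using s by simp
  have dd: "dist (bary_point P f p') (bary_point P f p) = face_len X f p p'"
    using bary_point_flen[OF fin _ p] inv s by simp
  have n: "near e (P b) (P a) (bary_point P f p) \<le> 0" if "bary_weights p f" for p
    using near_pt[of p a b q e P] that s(1) d inv wt_triple(4)[of p a b q]
    by (simp add: sees_def mult_nonneg_nonpos)
  have "in_cone e \<beta> \<alpha> (bary_point P f p')"
    by (rule sees_stays[OF _ s(3) n[OF p(1)] n[OF p(2)]]) (use inv s(4) l dd in \<open>auto simp: dist_norm\<close>)
  moreover have "norm (bary_point P f p') \<le> \<rho> + face_len X f p p'"
    using s(4) dd norm_triangle_sub[of "bary_point P f p'" "bary_point P f p"] by (simp add: dist_norm)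
  ultimately show ?thesis unfolding visible_def using s by blast
qed

text \<open>The entry vertices \<open>a\<close> and \<open>b\<close> lie on or outside the boundary
  of the open cone, so only \<open>q\<close> can be seen, and \<open>sees_vertex\<close> bounds its
  norm.\<close>

lemma strip_unit:
  assumes s: "strip e a b q P \<alpha> \<beta>" and c: "in_cone e \<beta> \<alpha> (P v)" and v: "v \<in> {a, b, q}"
  shows "r \<le> norm (P v)"
proof -
  note inv = strip_inv[OF s]
  have asym: "wedge e x y = - wedge e y x" for x y by (simp add: wedge_def algebra_simps)
  have "v \<noteq> a" "v \<noteq> b" using c inv asym[of "P a" \<alpha>] asym[of "P b" \<beta>]
    by (auto simp: in_cone_def sees_def)
  then show ?thesis using v sees_vertex c inv by blast
qed

text \<open>With \<open>p b = 0\<close> the point lies on the edge \<open>a\<close>,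
  \<open>q\<close>, and in its interior, because a vertex in the cone would be at distance at least
  \<open>r\<close>. So exactly one other face is available, and the strip is extended into
  it.\<close>

lemma strip_cross:
  assumes s: "strip e a b q P \<alpha> \<beta>" and c: "in_cone e \<beta> \<alpha> (bary_point P {a, b, q} p)"
    and n: "norm (bary_point P {a, b, q} p) \<le> \<rho>" "\<rho> < r" and p: "bary_weights p {a, b, q}" "bary_weights p f"
    and f: "f \<in> faces" "f \<noteq> {a, b, q}" and b0: "p b = 0"
  shows "visible f p \<rho>"
proof -
  note inv = strip_inv[OF s]
  have d: "a \<noteq> b" "a \<noteq> q" "b \<noteq> q" using tri_distinct inv by blast+
  have sum1: "p a + p q = 1" "0 \<le> p a" "0 \<le> p q" using wt_triple[OF p(1) d] b0 by auto
  have pt1: "bary_point P {a, b, q} p = p a *\<^sub>R P a + p q *\<^sub>R P q" using bary_point_triple[OF d] b0 by simp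
  have vertex: False if "bary_point P {a, b, q} p = P v" "v \<in> {a, b, q}" for v
    using strip_unit[OF s _ that(2)] c n that(1) by simp
  have "p a \<noteq> 0" using vertex[of q] pt1 sum1 by force
  moreover have "p q \<noteq> 0" using vertex[of a] pt1 sum1 by force
  ultimately have pp: "p a \<noteq> 0" "p q \<noteq> 0" "0 < p q" "p q < 1" using sum1 by auto
  then have "a \<in> f" "q \<in> f" using p(2) by (auto simp: bary_weights_def)
  then obtain c where c': "f = {a, q, c}" "tri a q c" using faces_edge[OF f(1)] d by metis
  have cb: "c \<noteq> b" using f(2) c' by auto
  have dc: "distinct [a, q, c]" using tri_distinct[OF c'(2)] by auto
  have aqb: "tri a q b" using inv tri_rot tri_swap by blast
  have Paqb: "realize X {a, q, b} P" using inv by (simp add: insert_commute)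
  have L: "(dist (P a) (P q))\<^sup>2 = sqlen X a q" using inv by (simp add: realize_def)
  obtain z where z: "realize X {a, q, c} (P(c := z))" "near e (P q) (P a) z \<le> 0"
    using realize_extend[OF L dc pos pos pos] inv strict[OF c'(2)] by (metis less_imp_le)
  have dd: "(P(c := z)) a = P a" "(P(c := z)) q = P q" "(P(c := z)) c = z" using dc by auto
  have nz: "near e (P q) (P a) z < 0"
    using near_nonzero[OF c'(2) z(1), of e] z(2) inv dd by auto
  have nb: "0 < near e (P q) (P a) (P b)"
    using inv near_rot[of e "P q" "P a" "P b"] by (simp add: sees_def)
  have "0 \<le> ((z - P a) \<bullet> (z - P q)) / (- near e (P q) (P a) z) +
             ((P b - P a) \<bullet> (P b - P q)) / near e (P q) (P a) (P b)"
    using cot_nonneg[OF c'(2) aqb cb[symmetric] _ z(1) Paqb, of e] inv nz nb dd by simp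
  moreover have pt2: "bary_point P {a, b, q} p = (1 - p q) *\<^sub>R P a + p q *\<^sub>R P q"
    using pt1 sum1 by (metis add_diff_cancel_right')
  ultimately obtain \<beta>' where \<beta>': "sees r e (P a) (P q) z \<alpha> \<beta>'"
      "in_cone e \<beta>' \<alpha> (bary_point P {a, b, q} p)" "\<forall>w. in_cone e \<beta>' \<alpha> w \<longrightarrow> in_cone e \<beta> \<alpha> w"
    using sees_step[OF _ pp(3,4), of r e "P a" "P b" "P q" \<alpha> \<beta> z] inv c nz by auto
  have st: "strip e a q c (P(c := z)) \<alpha> \<beta>'"
    using step[OF s c'(2) cb z(1) \<beta>'(1,3)] .
  have "bary_point P {a, b, q} p = bary_point (P(c := z)) f p"
    using c'(1) cb dc by (intro bary_point_cong p) auto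
  then show ?thesis using st \<beta>'(2) n(1) c'(1) unfolding visible_def by metis
qed

lemma realize_star:
  assumes "f \<in> faces" "i \<in> f"
  obtains P where "realize X f P" "P i = 0"
proof -
  from faces_elem[OF assms] obtain a b where f: "f = {i, a, b}" "tri i a b" by blast
  have d: "distinct [i, a, b]" using tri_distinct[OF f(2)] by auto
  define P where "P = (\<lambda>v. if v = a then of_real (sqrt (sqlen X i a)) else (0 :: complex))"
  have "0 \<le> sqlen X i a" using pos[of i] pos[of a] by (simp add: sqlen_def)
  then have "(dist (P i) (P a))\<^sup>2 = sqlen X i a" using d by (simp add: P_def dist_norm)
  from realize_extend[OF this d pos pos pos, of 1] strict[OF f(2)]
  obtain z where "realize X {i, a, b} (P(b := z))" by auto
  moreover have "(P(b := z)) i = 0" using d by (simp add: P_def)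
  ultimately show thesis using that f by blast
qed

text \<open>The same point is reinterpreted in another face. Within the star of \<open>i\<close> its
  distance from \<open>i\<close> is intrinsic; leaving the star starts a strip, a side edge extends
  a strip, and the entry edge leads back by \<open>strip_pred\<close>.\<close>

lemma visible_transfer:
  assumes v: "visible g p \<rho>" and r\<rho>: "\<rho> < r" and p: "bary_weights p g" "bary_weights p f" and f: "f \<in> faces"
  shows "visible f p \<rho>"
proof (cases "f = g")
  case False
  from v show ?thesis unfolding visible_def[of g]
  proof (elim disjE exE conjE)
    fix P assume P: "g \<in> faces" "i \<in> g" "realize X g P" "P i = 0" "norm (bary_point P g p) \<le> \<rho>"
    show ?thesis
    proof (cases "i \<in> f")
      case True
      obtain P' where P': "realize X f P'" "P' i = 0" using realize_star[OF f True] .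
      define u where "u = (\<lambda>v. if v = i then 1 else 0 :: real)"
      have u: "sum u h = 1" "bary_point Q h u = Q i" "finite h" if "h \<in> faces" "i \<in> h" for h Q
        using finite_face[OF that(1)] that(2) unfolding u_def bary_point_def
        by (auto simp: sum.delta if_distrib[of "\<lambda>x. x *\<^sub>R _"] cong: if_cong)
      have n: "(norm (bary_point Q h p))\<^sup>2 = quad X h (\<lambda>v. p v - u v)"
        if "h \<in> faces" "i \<in> h" "realize X h Q" "Q i = 0" "bary_weights p h" for h Q
        using bary_point_dist[OF finite_face[OF that(1)] that(3), of u p] u[OF that(1,2)] that
        by (simp add: bary_weights_def)
      have "quad X f (\<lambda>v. p v - u v) = quad X g (\<lambda>v. p v - u v)"
        using p True P(2) f P(1) finite_face by (intro quad_cong) (auto simp: bary_weights_def u_def)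
      then have "(norm (bary_point P' f p))\<^sup>2 = (norm (bary_point P g p))\<^sup>2"
        using n[OF f True P' p(2)] n[OF P(1-4) p(1)] by simp
      then have "norm (bary_point P' f p) \<le> \<rho>" using P(5) by simp
      then show ?thesis using f True P' unfolding visible_def by blast
    next
      case False
      obtain a b where g: "g = {i, a, b}" "tri i a b" using faces_elem[OF P(1,2)] by blast
      have d: "i \<noteq> a" "i \<noteq> b" "a \<noteq> b" using tri_distinct[OF g(2)] by auto
      have pi: "p i = 0" using p(2) False by (simp add: bary_weights_def)
      have w: "p a + p b = 1" "0 \<le> p a" "0 \<le> p b" using wt_triple[of p i a b] p(1) g(1) d pi by auto
      have ptp: "bary_point P g p = p a *\<^sub>R P a + p b *\<^sub>R P b" using bary_point_triple[OF d] g(1) pi by simp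
      have len: "r \<le> norm (P v)" if "v \<in> {a, b}" for v
      proof -
        have "adj i v" using g(2) that adj_sym[of b i] unfolding tri_def by auto
        moreover have "(norm (P v))\<^sup>2 = sqlen X i v"
          using P(3,4) that g(1) unfolding realize_def by (metis dist_0_norm insertCI insertE singletonD)
        ultimately show ?thesis using r[of v] by (metis norm_ge_zero real_sqrt_unique)
      qed
      have "p a \<noteq> 0" using w ptp len[of b] P(5) r\<rho> by force
      moreover have "p b \<noteq> 0" using w ptp len[of a] P(5) r\<rho> by force
      ultimately have pp: "0 < p a" "0 < p b" "a \<in> f" "b \<in> f" using w p(2) by (auto simp: bary_weights_def less_le)
      then obtain q where q: "f = {a, b, q}" "tri a b q" using faces_edge[OF f] d by metis
      have qi: "q \<noteq> i" using q False by auto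
      have dq: "distinct [a, b, q]" using tri_distinct[OF q(2)] by auto
      have abi: "tri a b i" using g(2) tri_rot by blast
      have Pabi: "realize X {a, b, i} P" using P(3) g(1) by (simp add: insert_commute)
      \<comment> \<open>The realization of the star face has an arbitrary orientation;
        \<open>e\<close> records it.\<close>
      define e :: real where "e = (if 0 < wedge 1 (P b) (P a) then 1 else -1)"
      have e: "e\<^sup>2 = 1" by (simp add: e_def)
      have n0: "near e (P b) (P a) (P i) = wedge e (P b) (P a)" for e using P(4) by (simp add: near_def wedge_def)
      have "wedge 1 (P b) (P a) \<noteq> 0" using near_nonzero[OF abi Pabi, of 1] n0[of 1] by simp
      then have cpos: "0 < wedge e (P b) (P a)" by (auto simp: e_def wedge_def)
      have L: "(dist (P a) (P b))\<^sup>2 = sqlen X a b" using Pabi by (simp add: realize_def)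
      obtain z where z: "realize X {a, b, q} (P(q := z))" "near e (P b) (P a) z \<le> 0"
        using realize_extend[OF L dq pos pos pos e] strict[OF q(2)] by (metis less_imp_le)
      have dd: "(P(q := z)) a = P a" "(P(q := z)) b = P b" "(P(q := z)) q = z" using dq by auto
      have nz: "near e (P b) (P a) z < 0" using near_nonzero[OF q(2) z(1) e] z(2) dd by auto
      have "0 \<le> ((z - P a) \<bullet> (z - P b)) / (- near e (P b) (P a) z) +
             ((P i - P a) \<bullet> (P i - P b)) / near e (P b) (P a) (P i)"
        using cot_nonneg[OF q(2) abi qi[symmetric] e z(1) Pabi] nz n0 cpos dd by simp
      then have sees: "sees r e (P a) (P b) z (P a) (P b)"
        using sees_base[OF cpos nz] len P(4) by simp
      have st: "strip e a b q (P(q := z)) (P a) (P b)"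
        by (rule base[OF g(2) q(2) qi e _ P(4) z(1) sees]) (use P(3) g(1) in simp)
      have ptf: "bary_point (P(q := z)) f p = bary_point P g p"
        using q g dq qi by (intro bary_point_cong p) auto
      have "wedge e (P b) (bary_point P g p) = p a * wedge e (P b) (P a)" "wedge e (bary_point P g p) (P a) = p b * wedge e (P b) (P a)"
        unfolding ptp wedge_def by (simp_all add: algebra_simps)
      then have "in_cone e (P b) (P a) (bary_point P g p)" using cpos pp by (simp add: in_cone_def)
      then show ?thesis unfolding visible_def ptf[symmetric] using st P(5)[folded ptf] q(1) by blast
    qed
  next
    fix e a b q P \<alpha> \<beta>
    assume s: "g = {a, b, q}" "strip e a b q P \<alpha> \<beta>" "in_cone e \<beta> \<alpha> (bary_point P g p)" "norm (bary_point P g p) \<le> \<rho>"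
    note inv = strip_inv[OF s(2)]
    have d: "a \<noteq> b" "a \<noteq> q" "b \<noteq> q" using tri_distinct inv by blast+
    \<comment> \<open>Distinct faces share at most an edge, so some weight vanishes and tells which
      edge the point lies on.\<close>
    have "p a = 0 \<or> p b = 0 \<or> p q = 0"
    proof (rule ccontr)
      assume "\<not> ?thesis"
      then have "{a, b, q} \<subseteq> f" using p(2) by (auto simp: bary_weights_def)
      moreover obtain u v w where uvw: "f = {u, v, w}" "tri u v w" using f unfolding faces_def by blast
      have "card f = 3" using tri_distinct[OF uvw(2)] uvw(1) by simp
      moreover have "card {a, b, q} = 3" using d by simp
      ultimately show False using False s(1) finite_face[OF f] card_subset_eq by metis
    qed
    then consider "p b = 0" | "p a = 0" | "p q = 0" by blast
    then show ?thesis
    proof cases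
      case 1
      then show ?thesis using strip_cross[OF s(2) _ _ r\<rho> _ p(2) f] s p(1) False by auto
    next
      case 2
      have "{b, a, q} = g" using s(1) by auto
      then show ?thesis using strip_cross[OF swap[OF s(2)] _ _ r\<rho> _ p(2) f] s p(1) False 2 in_cone_swap by auto
    next
      case 3
      have w: "p a + p b = 1" "0 \<le> p a" "0 \<le> p b" using wt_triple[of p a b q] p(1) s(1) d 3 by auto
      have ptp: "bary_point P g p = p a *\<^sub>R P a + p b *\<^sub>R P b" using bary_point_triple[OF d] s(1) 3 by simp
      have vertex: False if "bary_point P g p = P v" "v \<in> {a, b, q}" for v
        using strip_unit[OF s(2) _ that(2)] s r\<rho> that(1) by simp
      have "p a \<noteq> 0" using vertex[of b] ptp w by force
      moreover have "p b \<noteq> 0" using vertex[of a] ptp w by force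
      ultimately have "a \<in> f" "b \<in> f" using p(2) by (auto simp: bary_weights_def)
      then obtain c where c: "f = {a, b, c}" "tri a b c" using faces_edge[OF f] d by metis
      have cq: "c \<noteq> q" using False c s by auto
      from strip_pred[OF s(2)] show ?thesis
      proof (elim disjE exE conjE)
        fix P' assume P': "tri i a b" "q \<noteq> i" "realize X {i, a, b} P'" "P' i = 0" "P' a = P a" "P' b = P b"
        have "c = i" using tri_third[OF c(2) _ _ cq, of i] P'(1,2) tri_rot inv by blast
        then have f': "f = {i, a, b}" using c by auto
        have "bary_point P' f p = bary_point P g p"
          using f' s(1) P' tri_distinct[OF P'(1)] p by (intro bary_point_cong) auto
        then show ?thesis unfolding visible_def using f f' P' s(4) by auto
      next
        fix e' a' b' q' P' \<alpha>' \<beta>'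
        assume s': "strip e' a' b' q' P' \<alpha>' \<beta>'" "{a, b} \<subseteq> {a', b', q'}" "q \<notin> {a', b', q'}"
          "P' a = P a" "P' b = P b" "\<forall>w. in_cone e \<beta> \<alpha> w \<longrightarrow> in_cone e' \<beta>' \<alpha>' w"
        have "{a', b', q'} \<in> faces" using strip_inv[OF s'(1)] tri_face by blast
        then obtain c' where c': "{a', b', q'} = {a, b, c'}" "tri a b c'"
          using faces_edge[of "{a', b', q'}" a b] s'(2) d by auto
        have "c' \<noteq> q" using s'(3) c'(1) by auto
        then have "c = c'" using tri_third[OF c(2) c'(2) _ cq] inv by blast
        then have f': "f = {a', b', q'}" using c c' by simp
        have "q \<notin> f" using f' s'(3) by simp
        have "bary_point P' f p = bary_point P g p"
          using s' s(1) c(1) cq \<open>q \<notin> f\<close> f by (intro bary_point_cong p finite_face[OF f]) auto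
        then show ?thesis unfolding visible_def using f' s' s(3,4) by metis
      qed
    qed
  qed
qed (use v in simp)

text \<open>On a path shorter than \<open>r\<close>, \<open>visible_move\<close> and
  \<open>visible_transfer\<close> keep every point visible. At the end the vertex \<open>j\<close>
  would be seen at distance below \<open>r\<close>, against the edge bound \<open>r\<close> in the
  star and \<open>strip_unit\<close> in a strip.\<close>

theorem vertex_path_length:
  fixes p :: "nat \<Rightarrow> int \<times> int \<Rightarrow> real"
  assumes path: "\<And>m. m < n \<Longrightarrow> f m \<in> faces \<and> bary_weights (p m) (f m) \<and> bary_weights (p (Suc m)) (f m)"
    and p0: "p 0 = (\<lambda>v. if v = i then 1 else 0)" and pn: "p n = (\<lambda>v. if v = j then 1 else 0)" and ij: "i \<noteq> j"
  shows "r \<le> (\<Sum>m<n. face_len X (f m) (p m) (p (Suc m)))"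
proof (rule ccontr)
  assume "\<not> ?thesis"
  then have lt: "(\<Sum>m<n. face_len X (f m) (p m) (p (Suc m))) < r" by simp
  \<comment> \<open>The real \<open>sqrt\<close> of a negative number is negative, so the sign has
    to come from a realization.\<close>
  have fl: "0 \<le> face_len X g x y" if g0: "g \<in> faces" "bary_weights x g" "bary_weights y g" for g x y
  proof -
    obtain v where v: "v \<in> g" using g0(1) unfolding faces_def by blast
    obtain a b where g: "g = {v, a, b}" "tri v a b" using faces_elem[OF g0(1) v] .
    have d: "distinct [v, a, b]" using tri_distinct[OF g(2)] by auto
    define P where "P = (\<lambda>u. if u = a then of_real (sqrt (sqlen X v a)) else (0 :: complex))"
    have "0 \<le> sqlen X v a" using pos[of v] pos[of a] by (simp add: sqlen_def)
    then have "(dist (P v) (P a))\<^sup>2 = sqlen X v a" using d by (simp add: P_def dist_norm)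
    from realize_extend[OF this d pos pos pos, of 1] strict[OF g(2)]
    obtain z where "realize X g (P(b := z))" using g(1) by auto
    from bary_point_flen[OF finite_face[OF g0(1)] this g0(2,3)] show ?thesis by (metis zero_le_dist)
  qed
  have n0: "0 < n" using p0 pn ij by (metis gr0I zero_neq_one)
  have mono: "(\<Sum>m<k. face_len X (f m) (p m) (p (Suc m))) < r" if "k \<le> n" for k
  proof -
    have "(\<Sum>m<k. face_len X (f m) (p m) (p (Suc m))) \<le> (\<Sum>m<n. face_len X (f m) (p m) (p (Suc m)))"
      using that path fl by (intro sum_mono2) auto
    then show ?thesis using lt by simp
  qed
  have visible: "visible (f k) (p (Suc k)) (\<Sum>m<Suc k. face_len X (f m) (p m) (p (Suc m)))" if "k < n" for k
    using that
  proof (induction k)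
    case 0
    have pa: "f 0 \<in> faces" "bary_weights (p 0) (f 0)" "bary_weights (p 1) (f 0)" using path[OF 0] by auto
    have i: "i \<in> f 0" using pa(2) p0 by (force simp: bary_weights_def)
    obtain P where P: "realize X (f 0) P" "P i = 0" using realize_star[OF pa(1) i] .
    have "bary_point P (f 0) (p 0) = P i"
      using finite_face[OF pa(1)] i unfolding p0 bary_point_def
      by (auto simp: sum.delta if_distrib[of "\<lambda>x. x *\<^sub>R _"] cong: if_cong)
    then have "visible (f 0) (p 0) 0" unfolding visible_def using pa i P by auto
    from visible_move[OF this pa(2,3)] show ?case using mono[of 1] n0 by simp
  next
    case (Suc k)
    have pa: "f k \<in> faces" "bary_weights (p (Suc k)) (f k)" using path[of k] Suc.prems by auto
    have pb: "f (Suc k) \<in> faces" "bary_weights (p (Suc k)) (f (Suc k))" "bary_weights (p (Suc (Suc k))) (f (Suc k))"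
      using path[OF Suc.prems] by auto
    have "visible (f (Suc k)) (p (Suc k)) (\<Sum>m<Suc k. face_len X (f m) (p m) (p (Suc m)))"
      using visible_transfer[OF Suc.IH mono[of "Suc k"] pa(2) pb(2,1)] Suc.prems by simp
    from visible_move[OF this pb(2,3)] show ?case using mono[of "Suc (Suc k)"] Suc.prems by simp
  qed
  define g where "g = f (n - 1)"
  have g: "g \<in> faces" "bary_weights (p n) g" using path[of "n - 1"] n0 by (auto simp: g_def)
  have j: "j \<in> g" using g(2) pn by (force simp: bary_weights_def)
  have ptn: "bary_point P g (p n) = P j" for P
    using finite_face[OF g(1)] j unfolding pn bary_point_def
    by (auto simp: sum.delta if_distrib[of "\<lambda>x. x *\<^sub>R _"] cong: if_cong)
  have "visible g (p n) (\<Sum>m<n. face_len X (f m) (p m) (p (Suc m)))"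
    using visible[of "n - 1"] n0 by (simp add: g_def)
  then show False unfolding visible_def ptn
  proof (elim disjE exE conjE)
    fix P assume P: "i \<in> g" "realize X g P" "P i = 0" "norm (P j) \<le> (\<Sum>m<n. face_len X (f m) (p m) (p (Suc m)))"
    obtain c where "g = {i, j, c}" "tri i j c" using faces_edge[OF g(1) P(1) j ij] .
    then have "adj i j" by (simp add: tri_def)
    moreover have "(norm (P j))\<^sup>2 = sqlen X i j"
      using P j unfolding realize_def by (metis dist_0_norm)
    ultimately have "r \<le> norm (P j)" using r[of j] by (metis norm_ge_zero real_sqrt_unique)
    then show False using P lt by simp
  next
    fix e a b q P \<alpha> \<beta>
    assume "g = {a, b, q}" "strip e a b q P \<alpha> \<beta>" "in_cone e \<beta> \<alpha> (P j)"
      "norm (P j) \<le> (\<Sum>m<n. face_len X (f m) (p m) (p (Suc m)))"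
    then show False using strip_unit[of e a b q P \<alpha> \<beta> j] j lt by simp
  qed
qed

end

section \<open>Limits of flat Delaunay metrics\<close>

text \<open>The conditions are invariant under positive scaling and translation, and all but
  positivity pass to pointwise limits of positive functions with a positive limit.\<close>

definition hexflat :: "(int \<times> int \<Rightarrow> real) \<Rightarrow> bool" where
  "hexflat X \<longleftrightarrow> (\<forall>v. 0 < X v) \<and>
     (\<forall>a b c. tri a b c \<longrightarrow> 0 \<le> heron (X a) (X b) (X c)) \<and>
     (\<forall>v. (\<Sum>k<6. angle_sq (X v) (X (v + hex_dir k)) (X (v + hex_dir (nxt k)))) = 2 * pi) \<and>
     (\<forall>a b c c'. tri a b c \<longrightarrow> tri a b c' \<longrightarrow> c \<noteq> c' \<longrightarrow> X c + X c' \<le> 2 * (X a + X b))"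

lemma hexflatD:
  assumes "hexflat X"
  shows "0 < X v" and "tri a b c \<Longrightarrow> 0 \<le> heron (X a) (X b) (X c)"
    and "(\<Sum>k<6. angle_sq (X v) (X (v + hex_dir k)) (X (v + hex_dir (nxt k)))) = 2 * pi"
    and "tri a b c \<Longrightarrow> tri a b c' \<Longrightarrow> c \<noteq> c' \<Longrightarrow> X c + X c' \<le> 2 * (X a + X b)"
  using assms unfolding hexflat_def by simp_all

lemma adj_translate: "adj (v + u) (w + u) \<longleftrightarrow> adj v w"
  by (simp add: adj_iff)

lemma tri_translate: "tri (a + u) (b + u) (c + u) \<longleftrightarrow> tri a b c"
  by (simp add: tri_def adj_translate)

lemma heron_scale: "heron (s * a) (s * b) (s * c) = s\<^sup>2 * heron a b c"
  by (simp add: heron_def power2_eq_square algebra_simps)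

lemma angle_sq_scale: "0 < s \<Longrightarrow> angle_sq (s * c) (s * p) (s * q) = angle_sq c p q"
proof -
  assume s: "0 < s"
  have "sqrt (s * p * (s * q)) = s * sqrt (p * q)"
    using s by (simp add: real_sqrt_mult mult_ac)
  moreover have "(s * p + s * q - s * c) / (2 * (s * sqrt (p * q))) = (p + q - c) / (2 * sqrt (p * q))"
  proof -
    have "s * p + s * q - s * c = s * (p + q - c)" by (simp add: algebra_simps)
    then show ?thesis using s by (simp add: mult.left_commute[of 2 s])
  qed
  ultimately show ?thesis by (simp add: angle_sq_def)
qed

lemma hexflat_transform:
  assumes X: "hexflat X" and s: "0 < s"
  shows "hexflat (\<lambda>v. s * X (v + u))"
  unfolding hexflat_def
proof (intro conjI allI impI)
  fix v
  show "0 < s * X (v + u)" using X s by (simp add: hexflat_def)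
  have *: "v + hex_dir k + u = (v + u) + hex_dir k" for k by (simp add: add_ac)
  show "(\<Sum>k<6. angle_sq (s * X (v + u)) (s * X (v + hex_dir k + u)) (s * X (v + hex_dir (nxt k) + u))) = 2 * pi"
    using X unfolding angle_sq_scale[OF s] * hexflat_def by blast
next
  fix a b c assume "tri a b c"
  then show "0 \<le> heron (s * X (a + u)) (s * X (b + u)) (s * X (c + u))"
    using X unfolding heron_scale hexflat_def by (simp add: tri_translate)
next
  fix a b c c' assume t: "tri a b c" "tri a b c'" "c \<noteq> c'"
  have "X (c + u) + X (c' + u) \<le> 2 * (X (a + u) + X (b + u))"
  proof -
    have "tri (a + u) (b + u) (c + u)" "tri (a + u) (b + u) (c' + u)" "c + u \<noteq> c' + u"
      using t by (simp_all add: tri_translate)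
    then show ?thesis by (rule hexflatD(4)[OF X])
  qed
  then have "s * (X (c + u) + X (c' + u)) \<le> s * (2 * (X (a + u) + X (b + u)))"
    using s by (intro mult_left_mono) auto
  then show "s * X (c + u) + s * X (c' + u) \<le> 2 * (s * X (a + u) + s * X (b + u))"
    by (simp add: algebra_simps)
qed

section \<open>Maximum principle and bounded ratios\<close>

lemma nxt_less [simp]: "nxt k < 6" "prv k < 6"
  by (simp_all add: nxt_def prv_def)

lemma tri_star: "k < 6 \<Longrightarrow> tri v (v + hex_dir k) (v + hex_dir (nxt k))" "k < 6 \<Longrightarrow> tri v (v + hex_dir k) (v + hex_dir (prv k))"
  by (simp_all add: tri_dir)

lemma nxt_neq_prv: "k < 6 \<Longrightarrow> nxt k \<noteq> prv k"
  unfolding less6 by (elim insertE emptyE; simp)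

text \<open>The common value at \<open>v\<close> is the shared constant \<open>c\<close> of the two
  stars, and both cone angles are \<open>2 * pi\<close>, so \<open>star_rigidity\<close>
  applies.\<close>

lemma hexflat_touch:
  assumes X: "hexflat X" and Y: "hexflat Y" and eq: "X v = Y v" and le: "\<And>w. X w \<le> Y w" and vw: "adj v w"
  shows "X w = Y w"
proof -
  obtain k where k: "k < 6" "w = v + hex_dir k" using vw unfolding adj_def by blast
  have del: "Z (v + hex_dir (nxt j)) + Z (v + hex_dir (prv j)) \<le> 2 * (Z v + Z (v + hex_dir j))"
    if "hexflat Z" "j < 6" for Z j
  proof -
    have "v + hex_dir (nxt j) \<noteq> v + hex_dir (prv j)"
      using hex_dir_inj[OF nxt_less(1) nxt_less(2), of j j] nxt_neq_prv[OF that(2)] add_left_imp_eq by metis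
    then show ?thesis by (rule hexflatD(4)[OF that(1) tri_star[OF that(2)]])
  qed
  have her: "0 \<le> heron (Z v) (Z (v + hex_dir j)) (Z (v + hex_dir (nxt j)))" if "hexflat Z" "j < 6" for Z j
    by (rule hexflatD(2)[OF that(1) tri_star(1)[OF that(2)]])
  have ang: "(\<Sum>j<6. angle_sq (Z v) (Z (v + hex_dir j)) (Z (v + hex_dir (nxt j)))) = 2 * pi" if "hexflat Z" for Z
    by (rule hexflatD(3)[OF that])
  have p: "0 < Z u" if "hexflat Z" for Z u by (rule hexflatD(1)[OF that])
  have "Y (v + hex_dir k) = X (v + hex_dir k)"
  proof (rule star_rigidity[where c = "X v" and P = "\<lambda>j. X (v + hex_dir j)" and P' = "\<lambda>j. Y (v + hex_dir j)" and k = k])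
    show "(\<Sum>j<6. angle_sq (X v) (X (v + hex_dir j)) (X (v + hex_dir (nxt j)))) =
      (\<Sum>j<6. angle_sq (X v) (Y (v + hex_dir j)) (Y (v + hex_dir (nxt j))))"
      using ang[OF X] ang[OF Y] by (simp only: eq)
  qed (use p[OF X] le her[OF X] her[OF Y, folded eq] del[OF X] del[OF Y, folded eq] k in blast)+
  then show ?thesis using k by simp
qed

lemma heron_sqrt_le:
  assumes "0 \<le> heron a b c" "0 \<le> a" "0 \<le> b" "0 \<le> c"
  shows "sqrt c \<le> sqrt a + sqrt b"
proof -
  have "(c - a - b)\<^sup>2 \<le> 4 * (a * b)" using assms(1) by (simp add: heron_def power2_eq_square algebra_simps)
  then have "c - a - b \<le> sqrt (4 * (a * b))" by (rule real_le_rsqrt)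
  also have "\<dots> = 2 * sqrt a * sqrt b" by (simp add: real_sqrt_mult)
  finally have "c \<le> (sqrt a + sqrt b)\<^sup>2" using assms by (simp add: power2_sum)
  then show ?thesis using assms real_le_lsqrt by auto
qed

text \<open>If all neighbours exceeded \<open>X v\<close>, the side opposite to \<open>v\<close>
  would be strictly shortest in all six triangles, and each angle at \<open>v\<close> would be below
  \<open>pi / 3\<close>. So some neighbour has \<open>f k \<le> c\<close>. Each step around the star
  adds at most \<open>c\<close>, and three steps in one direction or the other reach every
  neighbour: \<open>4 * c\<close>, squared.\<close>

lemma hexflat_ratio:
  assumes X: "hexflat X" and vw: "adj v w"
  shows "X w \<le> 16 * X v"
proof -
  obtain j where j: "j < 6" "w = v + hex_dir j" using vw unfolding adj_def by blast
  have pos: "0 < X u" for u by (rule hexflatD(1)[OF X])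
  define c where "c = sqrt (X v)"
  define f where "f k = sqrt (X (v + hex_dir k))" for k
  have her: "0 \<le> heron (X v) (X (v + hex_dir k)) (X (v + hex_dir (nxt k)))" if "k < 6" for k
    by (rule hexflatD(2)[OF X tri_star(1)[OF that]])
  have st: "f (nxt k) \<le> c + f k" "f k \<le> c + f (nxt k)" if "k < 6" for k
  proof -
    show "f (nxt k) \<le> c + f k"
      unfolding f_def c_def using heron_sqrt_le[OF her[OF that]] pos by (simp add: less_imp_le)
    have "heron (X v) (X (v + hex_dir k)) (X (v + hex_dir (nxt k))) = heron (X v) (X (v + hex_dir (nxt k))) (X (v + hex_dir k))"
      by (metis heron_rot heron_swap)
    then show "f k \<le> c + f (nxt k)"
      unfolding f_def c_def using heron_sqrt_le her[OF that] pos by (simp add: less_imp_le)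
  qed
  have "\<exists>k<6. f k \<le> c"
  proof (rule ccontr)
    assume n: "\<not> ?thesis"
    have big: "X v < X (v + hex_dir k)" if "k < 6" for k
      using n that by (auto simp: f_def c_def)
    have "angle_sq (X v) (X (v + hex_dir k)) (X (v + hex_dir (nxt k))) < pi / 3" if "k < 6" for k
    proof -
      let ?p = "X (v + hex_dir k)" and ?q = "X (v + hex_dir (nxt k))"
      have pq: "0 < sqrt (?p * ?q)" using pos by simp
      have "min ?p ?q \<le> ?p + ?q - sqrt (?p * ?q)"
      proof -
        have "sqrt (?p * ?q) \<le> sqrt (max ?p ?q * max ?p ?q)"
          using pos by (intro real_sqrt_le_mono mult_mono) (auto simp: less_imp_le le_max_iff_disj)
        also have "\<dots> = max ?p ?q" using pos[of "v + hex_dir k"] by simp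
        finally show ?thesis by linarith
      qed
      moreover have "X v < min ?p ?q" using big[OF that] big[of "nxt k"] by simp
      ultimately have "sqrt (?p * ?q) < ?p + ?q - X v" by linarith
      then have "1/2 < (?p + ?q - X v) / (2 * sqrt (?p * ?q))" using pq by (simp add: less_divide_eq)
      moreover have "(?p + ?q - X v) / (2 * sqrt (?p * ?q)) \<in> {-1..1}"
        using angle_sq_arg pos her[OF that] by blast
      ultimately have "angle_sq (X v) ?p ?q < arccos (1/2)"
        unfolding angle_sq_def by (intro arccos_less_arccos) auto
      also have "arccos (1/2) = pi / 3"
        using arccos_cos[of "pi / 3"] by (simp add: cos_60)
      finally show ?thesis .
    qed
    then have "(\<Sum>k<6. angle_sq (X v) (X (v + hex_dir k)) (X (v + hex_dir (nxt k)))) < (\<Sum>k<(6::nat). pi / 3)"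
      by (intro sum_strict_mono) (auto simp: lessThan_empty_iff bot_nat_def)
    then show False using X unfolding hexflat_def by (simp add: less_irrefl)
  qed
  then obtain k where k: "k < 6" "f k \<le> c" by blast
  have c0: "0 \<le> c" using pos[of v] by (simp add: c_def)
  have up: "f (nxt k) \<le> c + f k" "f (prv k) \<le> c + f k" if "k < 6" for k
  proof -
    have "nxt (prv k) = k" using that unfolding less6 by auto
    then show "f (nxt k) \<le> c + f k" "f (prv k) \<le> c + f k"
      using st(1)[OF that] st(2)[OF nxt_less(2)[of k]] by simp_all
  qed
  have "j \<in> {k, nxt k, nxt (nxt k), prv k, prv (prv k), nxt (nxt (nxt k))}"
    using j(1) k(1) unfolding less6 by (elim insertE emptyE) simp_all
  then have "f j \<le> 4 * c"
    using k(2) c0 up[OF k(1)] up[of "nxt k"] up[of "prv k"] up[of "nxt (nxt k)"] by force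
  then have "(f j)\<^sup>2 \<le> (4 * c)\<^sup>2" by (intro power_mono) (auto simp: f_def pos less_imp_le)
  then show ?thesis using pos j by (simp add: f_def c_def power_mult_distrib less_imp_le)
qed

section \<open>Compactness of normalized metrics\<close>

lemma lattice_induct:
  assumes "P 0" and step: "\<And>v w. P v \<Longrightarrow> adj v w \<Longrightarrow> P w"
  shows "P v"
proof -
  have 1: "P (m, 0)" for m
  proof (induction m rule: int_induct[of _ 0])
    case base then show ?case using assms(1) by (simp add: zero_prod_def)
  next
    case (step1 i) then show ?case using step[of "(i, 0)" "(i + 1, 0)"] by (simp add: adj_iff)
  next
    case (step2 i) then show ?case using step[of "(i, 0)" "(i - 1, 0)"] by (simp add: adj_iff)
  qed
  have "P (m, n)" for m n
  proof (induction n rule: int_induct[of _ 0])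
    case base then show ?case using 1 .
  next
    case (step1 i) then show ?case using step[of "(m, i)" "(m, i + 1)"] by (simp add: adj_iff)
  next
    case (step2 i) then show ?case using step[of "(m, i)" "(m, i - 1)"] by (simp add: adj_iff)
  qed
  then show ?thesis by (cases v) simp
qed

text \<open>
  The map \<open>\<Phi>\<close> records, in a form that survives pointwise limits, all that is needed from
  completeness: vertices are separated in the Euclidean plane.
\<close>

definition immersed :: "(int \<times> int \<Rightarrow> real) \<Rightarrow> (int \<times> int \<Rightarrow> complex) \<Rightarrow> bool" where
  "immersed X \<Phi> \<longleftrightarrow> hexflat X \<and>
     (\<forall>v w. adj v w \<longrightarrow> (dist (\<Phi> v) (\<Phi> w))\<^sup>2 \<le> 1 / (X v * X w)) \<and>
     (\<forall>v w. v \<noteq> w \<longrightarrow> 1 / (16 * (X v)\<^sup>2) \<le> (dist (\<Phi> v) (\<Phi> w))\<^sup>2)"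

lemma immersedD:
  assumes "immersed X \<Phi>"
  shows "hexflat X" and "adj v w \<Longrightarrow> (dist (\<Phi> v) (\<Phi> w))\<^sup>2 \<le> 1 / (X v * X w)"
    and "v \<noteq> w \<Longrightarrow> 1 / (16 * (X v)\<^sup>2) \<le> (dist (\<Phi> v) (\<Phi> w))\<^sup>2"
  using assms unfolding immersed_def by simp_all

text \<open>Lengths are \<open>1 / sqrt (X v * X w)\<close>, so dividing \<open>X\<close> by
  \<open>X u\<close> multiplies all lengths, and hence the map, by \<open>X u\<close>.\<close>

lemma immersed_normalize:
  assumes "immersed X \<Phi>"
  shows "immersed (\<lambda>v. 1 / X u * X (v + u)) (\<lambda>v. X u *\<^sub>R (\<Phi> (v + u) - \<Phi> u))"
proof -
  have X: "hexflat X" using assms by (simp add: immersed_def)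
  have pos: "0 < X v" for v using X by (simp add: hexflat_def)
  have d: "(dist (X u *\<^sub>R (\<Phi> (v + u) - \<Phi> u)) (X u *\<^sub>R (\<Phi> (w + u) - \<Phi> u)))\<^sup>2
      = (X u)\<^sup>2 * (dist (\<Phi> (v + u)) (\<Phi> (w + u)))\<^sup>2" for v w
  proof -
    have "X u *\<^sub>R (\<Phi> (v + u) - \<Phi> u) - X u *\<^sub>R (\<Phi> (w + u) - \<Phi> u) = X u *\<^sub>R (\<Phi> (v + u) - \<Phi> (w + u))"
      by (simp add: algebra_simps)
    then show ?thesis by (simp add: dist_norm power_mult_distrib)
  qed
  show ?thesis unfolding immersed_def d
  proof (intro conjI allI impI)
    show "hexflat (\<lambda>v. 1 / X u * X (v + u))" using hexflat_transform[OF X, of "1 / X u" u] pos[of u] by simp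
  next
    fix v w assume "adj v w"
    then have "(dist (\<Phi> (v + u)) (\<Phi> (w + u)))\<^sup>2 \<le> 1 / (X (v + u) * X (w + u))"
      by (intro immersedD(2)[OF assms]) (simp add: adj_translate)
    then have "(X u)\<^sup>2 * (dist (\<Phi> (v + u)) (\<Phi> (w + u)))\<^sup>2 \<le> (X u)\<^sup>2 * (1 / (X (v + u) * X (w + u)))"
      by (intro mult_left_mono) auto
    then show "(X u)\<^sup>2 * (dist (\<Phi> (v + u)) (\<Phi> (w + u)))\<^sup>2 \<le> 1 / (1 / X u * X (v + u) * (1 / X u * X (w + u)))"
      by (simp add: power2_eq_square)
  next
    fix v w :: "int \<times> int" assume "v \<noteq> w"
    then have "1 / (16 * (X (v + u))\<^sup>2) \<le> (dist (\<Phi> (v + u)) (\<Phi> (w + u)))\<^sup>2"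
      by (intro immersedD(3)[OF assms]) simp
    then have "(X u)\<^sup>2 * (1 / (16 * (X (v + u))\<^sup>2)) \<le> (X u)\<^sup>2 * (dist (\<Phi> (v + u)) (\<Phi> (w + u)))\<^sup>2"
      by (intro mult_left_mono) auto
    then show "1 / (16 * (1 / X u * X (v + u))\<^sup>2) \<le> (X u)\<^sup>2 * (dist (\<Phi> (v + u)) (\<Phi> (w + u)))\<^sup>2"
      by (simp add: power_mult_distrib power_divide)
  qed
qed

lemma immersed_bounds:
  "\<exists>B>0. \<forall>X \<Phi>. immersed X \<Phi> \<longrightarrow> X 0 = 1 \<longrightarrow> \<Phi> 0 = 0 \<longrightarrow> 1 / B \<le> X v \<and> X v \<le> B \<and> norm (\<Phi> v) \<le> B"
proof (induction v rule: lattice_induct)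
  case 1
  show ?case by (intro exI[of _ 1]) auto
next
  case (2 v w)
  then obtain B where B: "0 < B" "\<And>X \<Phi>. immersed X \<Phi> \<Longrightarrow> X 0 = 1 \<Longrightarrow> \<Phi> 0 = 0 \<Longrightarrow>
      1 / B \<le> X v \<and> X v \<le> B \<and> norm (\<Phi> v) \<le> B" by blast
  show ?case
  proof (intro exI[of _ "16 * B"] conjI allI impI)
    fix X \<Phi> assume X: "immersed X \<Phi>" "X 0 = 1" "\<Phi> 0 = 0"
    note b = B(2)[OF X]
    have hx: "hexflat X" using X by (simp add: immersed_def)
    have pos: "0 < X v" for v using hx by (simp add: hexflat_def)
    have r: "X w \<le> 16 * X v" "X v \<le> 16 * X w"
      using hexflat_ratio[OF hx 2(2)] hexflat_ratio[OF hx, of w v] 2(2) by (simp_all add: adj_sym[of w v])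
    show lo: "1 / (16 * B) \<le> X w" using r b by simp
    show "X w \<le> 16 * B" using r b by simp
    have "(dist (\<Phi> v) (\<Phi> w))\<^sup>2 \<le> 1 / (X v * X w)" by (rule immersedD(2)[OF X(1) 2(2)])
    also have "\<dots> \<le> 1 / (1 / B * (1 / (16 * B)))"
      using B(1) b lo pos[of v] pos[of w] by (intro divide_left_mono mult_mono) (auto simp: less_imp_le)
    also have "\<dots> = (4 * B)\<^sup>2" by (simp add: power2_eq_square)
    finally have "(dist (\<Phi> v) (\<Phi> w))\<^sup>2 \<le> (4 * B)\<^sup>2" .
    then have "dist (\<Phi> v) (\<Phi> w) \<le> 4 * B" by (rule power2_le_imp_le) (use B in simp)
    then have "norm (\<Phi> w) \<le> norm (\<Phi> v) + 4 * B"
      using norm_triangle_sub[of "\<Phi> w" "\<Phi> v"] by (simp add: dist_norm norm_minus_commute)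
    then show "norm (\<Phi> w) \<le> 16 * B" using b B(1) by linarith
  qed (use B in simp)
qed

text \<open>Tychonoff's theorem; a countable index type makes the function space metrizable, so
  compactness yields a subsequence.\<close>

lemma pointwise_subseq:
  fixes f :: "nat \<Rightarrow> 'a::countable \<Rightarrow> 'b::metric_space"
  assumes "\<And>x. compact (S x)" "\<And>n x. f n x \<in> S x"
  obtains g r where "strict_mono (r :: nat \<Rightarrow> nat)" "\<And>x. (\<lambda>n. f (r n) x) \<longlonglongrightarrow> g x" "\<And>x. g x \<in> S x"
proof -
  have "compactin (product_topology (\<lambda>_. euclidean) UNIV) (PiE UNIV S)"
    unfolding compactin_PiE using assms(1) by simp
  then have "compact (PiE UNIV S)" by (simp add: euclidean_product_topology)
  then have "seq_compact (PiE UNIV S)" by (simp add: compact_eq_seq_compact_metric)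
  moreover have "f n \<in> PiE UNIV S" for n using assms(2) by (simp add: PiE_def Pi_def extensional_def)
  ultimately obtain g r where g: "g \<in> PiE UNIV S" "strict_mono (r :: nat \<Rightarrow> nat)" "(f \<circ> r) \<longlonglongrightarrow> g"
    unfolding seq_compact_def by metis
  have "(\<lambda>n. f (r n) x) \<longlonglongrightarrow> g x" for x
    using continuous_on_tendsto_compose[OF continuous_on_product_coordinates[of x] g(3)]
    by (simp add: o_def)
  then show thesis using that g by (auto simp: PiE_def Pi_def)
qed

text \<open>Positivity is the one condition a limit could lose, hence a hypothesis. The angle sums
  converge even to degenerate triangles because \<open>arccos\<close> is continuous on the closed
  interval.\<close>

lemma immersed_limit:
  assumes im: "\<And>n. immersed (X n) (\<Phi> n)" and pos: "\<And>v. 0 < Y v"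
    and X: "\<And>v. (\<lambda>n. X n v) \<longlonglongrightarrow> Y v" and \<Phi>: "\<And>v. (\<lambda>n. \<Phi> n v) \<longlonglongrightarrow> \<Psi> v"
  shows "immersed Y \<Psi>"
proof -
  have hx: "hexflat (X n)" for n using im by (simp add: immersed_def)
  have xpos: "0 < X n v" for n v using hx by (simp add: hexflat_def)
  have her: "0 \<le> heron (Y a) (Y b) (Y c)" if "tri a b c" for a b c
  proof (rule LIMSEQ_le_const)
    show "(\<lambda>n. heron (X n a) (X n b) (X n c)) \<longlonglongrightarrow> heron (Y a) (Y b) (Y c)"
      unfolding heron_def by (intro tendsto_intros X)
    show "\<exists>N. \<forall>n\<ge>N. 0 \<le> heron (X n a) (X n b) (X n c)" using hexflatD(2)[OF hx that] by simp
  qed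
  have arg: "(Z (v + hex_dir k) + Z (v + hex_dir (nxt k)) - Z v) / (2 * sqrt (Z (v + hex_dir k) * Z (v + hex_dir (nxt k)))) \<in> {-1..1}"
    if "k < 6" "\<And>u. 0 < Z u" "\<And>a b c. tri a b c \<Longrightarrow> 0 \<le> heron (Z a) (Z b) (Z c)" for Z v k
    using angle_sq_arg[OF that(2,2) that(3)[OF tri_star(1)[OF that(1)]]] .
  have ang: "(\<Sum>k<6. angle_sq (Y v) (Y (v + hex_dir k)) (Y (v + hex_dir (nxt k)))) = 2 * pi" for v
  proof (rule LIMSEQ_unique)
    show "(\<lambda>n. \<Sum>k<6. angle_sq (X n v) (X n (v + hex_dir k)) (X n (v + hex_dir (nxt k)))) \<longlonglongrightarrow>
        (\<Sum>k<6. angle_sq (Y v) (Y (v + hex_dir k)) (Y (v + hex_dir (nxt k))))"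
    proof (intro tendsto_sum)
      fix k assume k: "k \<in> {..<6::nat}"
      show "(\<lambda>n. angle_sq (X n v) (X n (v + hex_dir k)) (X n (v + hex_dir (nxt k)))) \<longlonglongrightarrow>
          angle_sq (Y v) (Y (v + hex_dir k)) (Y (v + hex_dir (nxt k)))"
        unfolding angle_sq_def
      proof (rule continuous_on_tendsto_compose[OF continuous_on_arccos'])
        have "Y (v + hex_dir k) * Y (v + hex_dir (nxt k)) \<noteq> 0" using pos by (metis less_irrefl mult_eq_0_iff)
        then show "(\<lambda>n. (X n (v + hex_dir k) + X n (v + hex_dir (nxt k)) - X n v) / (2 * sqrt (X n (v + hex_dir k) * X n (v + hex_dir (nxt k)))))
          \<longlonglongrightarrow> (Y (v + hex_dir k) + Y (v + hex_dir (nxt k)) - Y v) / (2 * sqrt (Y (v + hex_dir k) * Y (v + hex_dir (nxt k))))"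
          by (intro tendsto_intros X) auto
      next
        show "(Y (v + hex_dir k) + Y (v + hex_dir (nxt k)) - Y v) / (2 * sqrt (Y (v + hex_dir k) * Y (v + hex_dir (nxt k)))) \<in> {- 1..1}"
          using k by (intro arg pos her) auto
        have "(X n (v + hex_dir k) + X n (v + hex_dir (nxt k)) - X n v) / (2 * sqrt (X n (v + hex_dir k) * X n (v + hex_dir (nxt k)))) \<in> {- 1..1}" for n
          using k by (intro arg xpos hexflatD(2)[OF hx]) auto
        then show "\<forall>\<^sub>F n in sequentially. (X n (v + hex_dir k) + X n (v + hex_dir (nxt k)) - X n v) / (2 * sqrt (X n (v + hex_dir k) * X n (v + hex_dir (nxt k)))) \<in> {- 1..1}"
          by simp
      qed
    qed
    show "(\<lambda>n. \<Sum>k<6. angle_sq (X n v) (X n (v + hex_dir k)) (X n (v + hex_dir (nxt k)))) \<longlonglongrightarrow> 2 * pi"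
      by (simp only: hexflatD(3)[OF hx] tendsto_const)
  qed
  have del: "Y c + Y c' \<le> 2 * (Y a + Y b)" if "tri a b c" "tri a b c'" "c \<noteq> c'" for a b c c'
  proof (rule LIMSEQ_le)
    show "(\<lambda>n. X n c + X n c') \<longlonglongrightarrow> Y c + Y c'" "(\<lambda>n. 2 * (X n a + X n b)) \<longlonglongrightarrow> 2 * (Y a + Y b)"
      by (intro tendsto_intros X)+
    show "\<exists>N. \<forall>n\<ge>N. X n c + X n c' \<le> 2 * (X n a + X n b)" using hexflatD(4)[OF hx that] by simp
  qed
  have up: "(dist (\<Psi> v) (\<Psi> w))\<^sup>2 \<le> 1 / (Y v * Y w)" if "adj v w" for v w
  proof (rule LIMSEQ_le)
    have "Y v * Y w \<noteq> 0" using pos by (metis less_irrefl mult_eq_0_iff)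
    then show "(\<lambda>n. 1 / (X n v * X n w)) \<longlonglongrightarrow> 1 / (Y v * Y w)" by (intro tendsto_intros X)
    show "(\<lambda>n. (dist (\<Phi> n v) (\<Phi> n w))\<^sup>2) \<longlonglongrightarrow> (dist (\<Psi> v) (\<Psi> w))\<^sup>2" by (intro tendsto_intros \<Phi>)
    show "\<exists>N. \<forall>n\<ge>N. (dist (\<Phi> n v) (\<Phi> n w))\<^sup>2 \<le> 1 / (X n v * X n w)"
      using immersedD(2)[OF im that] by simp
  qed
  have lo: "1 / (16 * (Y v)\<^sup>2) \<le> (dist (\<Psi> v) (\<Psi> w))\<^sup>2" if "v \<noteq> w" for v w
  proof (rule LIMSEQ_le)
    have "16 * (Y v)\<^sup>2 \<noteq> 0" using pos[of v] by simp
    then show "(\<lambda>n. 1 / (16 * (X n v)\<^sup>2)) \<longlonglongrightarrow> 1 / (16 * (Y v)\<^sup>2)" by (intro tendsto_intros X)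
    show "(\<lambda>n. (dist (\<Phi> n v) (\<Phi> n w))\<^sup>2) \<longlonglongrightarrow> (dist (\<Psi> v) (\<Psi> w))\<^sup>2" by (intro tendsto_intros \<Phi>)
    show "\<exists>N. \<forall>n\<ge>N. 1 / (16 * (X n v)\<^sup>2) \<le> (dist (\<Phi> n v) (\<Phi> n w))\<^sup>2"
      using immersedD(3)[OF im that] by simp
  qed
  show ?thesis unfolding immersed_def hexflat_def by (intro conjI allI impI pos her ang del up lo)
qed

section \<open>Maximal ratios and exponential limits\<close>

definition periodic :: "((int \<times> int) \<times> real) set \<Rightarrow> (int \<times> int \<Rightarrow> real) \<Rightarrow> bool" where
  "periodic S X \<longleftrightarrow> (\<forall>(\<delta>, M)\<in>S. \<forall>v. X (v + \<delta>) = M * X v)"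

lemma periodicD: "periodic S X \<Longrightarrow> (\<delta>, M) \<in> S \<Longrightarrow> X (v + \<delta>) = M * X v"
  unfolding periodic_def by fast

lemma periodicI: "(\<And>\<delta> M v. (\<delta>, M) \<in> S \<Longrightarrow> X (v + \<delta>) = M * X v) \<Longrightarrow> periodic S X"
  unfolding periodic_def by fast

text \<open>The multipliers in \<open>S\<close> survive normalization and limits, so the maximum can
  be taken among metrics that share them and the lemma can be iterated. The translate of the limit
  lies below \<open>M\<close> times the limit and touches it at 0; \<open>hexflat_touch\<close>
  spreads the equality.\<close>

lemma maximal_ratio:
  fixes \<delta> :: "int \<times> int"
  assumes X0: "immersed X0 \<Phi>0" "periodic S X0"
  obtains M Y \<Psi> where "immersed Y \<Psi>" "periodic (insert (\<delta>, M) S) Y"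
    "\<And>X \<Phi> v. immersed X \<Phi> \<Longrightarrow> periodic S X \<Longrightarrow> X (v + \<delta>) \<le> M * X v"
proof -
  have "\<exists>B. \<forall>v. 0 < B v \<and> (\<forall>X \<Phi>. immersed X \<Phi> \<longrightarrow> X 0 = 1 \<longrightarrow> \<Phi> 0 = 0 \<longrightarrow>
      1 / B v \<le> X v \<and> X v \<le> B v \<and> norm (\<Phi> v) \<le> B v)"
    using immersed_bounds by (intro choice allI)
  then obtain B where B: "\<And>v. 0 < B v" "\<And>v X \<Phi>. immersed X \<Phi> \<Longrightarrow> X 0 = 1 \<Longrightarrow> \<Phi> 0 = 0 \<Longrightarrow>
      1 / B v \<le> X v \<and> X v \<le> B v \<and> norm (\<Phi> v) \<le> B v" by blast
  define N where "N X \<Phi> \<longleftrightarrow> immersed X \<Phi> \<and> periodic S X \<and> X 0 = 1 \<and> \<Phi> 0 = 0"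
    for X :: "int \<times> int \<Rightarrow> real" and \<Phi> :: "int \<times> int \<Rightarrow> complex"
  have norm: "N (\<lambda>v. 1 / X u * X (v + u)) (\<lambda>v. X u *\<^sub>R (\<Phi> (v + u) - \<Phi> u))"
    if "immersed X \<Phi>" "periodic S X" for X \<Phi> u
  proof -
    have "X (v + d + u) = M * X (v + u)" if dM: "(d, M) \<in> S" for v d M
    proof -
      have "v + d + u = (v + u) + d" by (simp add: add_ac)
      then show ?thesis by (simp only: periodicD[OF \<open>periodic S X\<close> dM])
    qed
    then have "periodic S (\<lambda>v. 1 / X u * X (v + u))" by (intro periodicI) simp
    moreover have "0 < X u" by (rule hexflatD(1)[OF immersedD(1)[OF that(1)]])
    ultimately show ?thesis unfolding N_def using immersed_normalize[OF that(1)] by simp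
  qed
  define A where "A = {X \<delta> | X \<Phi>. N X \<Phi>}"
  have "A \<noteq> {}" using norm[OF X0] unfolding A_def by blast
  have bdd: "bdd_above A" unfolding A_def N_def using B(2) by (intro bdd_aboveI[of _ "B \<delta>"]) blast
  define M where "M = Sup A"
  have "\<exists>X \<Phi>. N X \<Phi> \<and> M - 1 / real (Suc n) < X \<delta>" for n
  proof -
    have "M - 1 / real (Suc n) < M" by simp
    from this[unfolded M_def] obtain a where "a \<in> A" "Sup A - 1 / real (Suc n) < a"
      using \<open>A \<noteq> {}\<close> bdd by (subst (asm) less_cSup_iff) auto
    then show ?thesis unfolding A_def M_def by blast
  qed
  then obtain X \<Phi> where X: "\<And>n. N (X n) (\<Phi> n)" "\<And>n. M - 1 / real (Suc n) < X n \<delta>" by metis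
  have imX: "immersed (X n) (\<Phi> n)" "X n 0 = 1" "\<Phi> n 0 = 0" "periodic S (X n)" for n
    using X(1) unfolding N_def by blast+
  have in_box: "(X n v, \<Phi> n v) \<in> {1 / B v..B v} \<times> cball 0 (B v)" for n v
    using B(2)[OF imX(1-3)] by simp
  have box: "compact ({1 / B v..B v} \<times> cball (0 :: complex) (B v))" for v
    by (intro compact_Times compact_cball) simp
  obtain g r where g: "strict_mono (r :: nat \<Rightarrow> nat)" "\<And>v. (\<lambda>n. (X (r n) v, \<Phi> (r n) v)) \<longlonglongrightarrow> g v"
      "\<And>v. g v \<in> {1 / B v..B v} \<times> cball 0 (B v)"
    by (rule pointwise_subseq[where f = "\<lambda>n v. (X n v, \<Phi> n v)", OF box in_box]) (rule that)
  define Y \<Psi> where "Y v = fst (g v)" and "\<Psi> v = snd (g v)" for v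
  have lim: "(\<lambda>n. X (r n) v) \<longlonglongrightarrow> Y v" "(\<lambda>n. \<Phi> (r n) v) \<longlonglongrightarrow> \<Psi> v" for v
    using tendsto_fst[OF g(2)] tendsto_snd[OF g(2)] by (auto simp: Y_def \<Psi>_def)
  have "1 / B v \<le> Y v" for v using g(3)[of v] by (auto simp: Y_def mem_Times_iff)
  then have Ypos: "0 < Y v" for v using B(1)[of v] by (metis divide_pos_pos less_le_trans zero_less_one)
  have Y: "immersed Y \<Psi>" by (rule immersed_limit[OF imX(1) Ypos lim])
  have perY: "periodic S Y"
  proof (rule periodicI)
    fix d K v assume "(d, K) \<in> S"
    then have "X n (v + d) = K * X n v" for n by (rule periodicD[OF imX(4)])
    then have "(\<lambda>n. K * X (r n) v) \<longlonglongrightarrow> Y (v + d)" using lim(1)[of "v + d"] by simp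
    then show "Y (v + d) = K * Y v"
      by (rule LIMSEQ_unique) (intro tendsto_intros lim)
  qed
  have max: "Z (v + \<delta>) \<le> M * Z v" if "immersed Z \<Xi>" "periodic S Z" for Z \<Xi> v
  proof -
    have "1 / Z v * Z (\<delta> + v) \<in> A" unfolding A_def
      by (intro CollectI exI conjI, rule refl, rule norm[OF that])
    then have "1 / Z v * Z (\<delta> + v) \<le> M" unfolding M_def using bdd by (rule cSup_upper)
    moreover have "0 < Z v" by (rule hexflatD(1)[OF immersedD(1)[OF that(1)]])
    ultimately show ?thesis by (simp add: pos_divide_le_eq add.commute)
  qed
  have Y0: "Y 0 = 1" using LIMSEQ_unique[OF lim(1)[of 0]] imX(2) by simp
  have "M \<le> Y \<delta>"
  proof (rule LIMSEQ_le)
    show "(\<lambda>n. X (r n) \<delta>) \<longlonglongrightarrow> Y \<delta>" by (rule lim)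
    show "(\<lambda>n. M - 1 / real (Suc (r n))) \<longlonglongrightarrow> M"
    proof -
      have "((\<lambda>n. M - 1 / real (Suc n)) \<circ> r) \<longlonglongrightarrow> M - 0"
        by (intro LIMSEQ_subseq_LIMSEQ[OF _ g(1)] tendsto_intros)
           (use LIMSEQ_inverse_real_of_nat in \<open>simp add: inverse_eq_divide\<close>)
      then show ?thesis by (simp add: o_def)
    qed
    show "\<exists>N. \<forall>n\<ge>N. M - 1 / real (Suc (r n)) \<le> X (r n) \<delta>" using X(2) less_imp_le by blast
  qed
  then have Yd: "Y (0 + \<delta>) = M * Y 0" using max[OF Y perY, of 0] Y0 by simp
  have Mpos: "0 < M" using Yd Y0 Ypos[of \<delta>] by simp
  have hY: "hexflat Y" by (rule immersedD(1)[OF Y])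
  have h1: "hexflat (\<lambda>v. Y (v + \<delta>))" using hexflat_transform[OF hY, of 1 \<delta>] by simp
  have h2: "hexflat (\<lambda>v. M * Y v)" using hexflat_transform[OF hY Mpos, of 0] by simp
  have "Y (v + \<delta>) = M * Y v" for v
  proof (induction v rule: lattice_induct)
    case (2 v w)
    show ?case by (rule hexflat_touch[OF h1 h2 2(1) _ 2(2)]) (rule max[OF Y perY])
  qed (rule Yd)
  then have "periodic (insert (\<delta>, M) S) Y" using periodicD[OF perY] by (intro periodicI) blast
  then show thesis using that Y max by blast
qed

text \<open>
  Along a direction in which the edges shrink geometrically all rows of vertices converge to the
  same point, so that infinitely many vertices at one scale have bounded mutual distances.
\<close>

lemma exponential_contradiction:
  fixes q :: "nat \<Rightarrow> int \<Rightarrow> int \<times> int"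
  assumes W: "immersed W \<Psi>" and q: "\<And>k n k' n'. q k n = q k' n' \<Longrightarrow> k = k'"
    and a1: "\<And>k n. adj (q k n) (q k (n + 1))" and a2: "\<And>k n. adj (q k n) (q (Suc k) n)"
    and \<rho>: "\<And>k n. W (q k (n + 1)) = \<rho> * W (q k n)" "1 < \<rho>"
    and \<sigma>: "\<And>k n. W (q (Suc k) n) = \<sigma> * W (q k n)"
  shows False
proof -
  have pos: "0 < W v" for v by (rule hexflatD(1)[OF immersedD(1)[OF W]])
  have Wn: "W (q k (n + int j)) = \<rho> ^ j * W (q k n)" for k n j
  proof (induction j)
    case (Suc j)
    have "q k (n + int (Suc j)) = q k (n + int j + 1)" by (simp add: add_ac)
    then show ?case using \<rho>(1)[of k "n + int j"] Suc by simp
  qed simp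
  \<comment> \<open>Each row takes arbitrarily small and large values, growing by the factor
    \<open>\<rho>\<close> per step; the first value not below 1 is at most
    \<open>\<rho>\<close>.\<close>
  have level: "\<exists>n. 1 \<le> W (q k n) \<and> W (q k n) \<le> \<rho>" for k
  proof -
    obtain j where "1 / W (q k 0) < \<rho> ^ j" using real_arch_pow[OF \<rho>(2)] by blast
    then have big: "1 < W (q k (0 + int j))" unfolding Wn using pos[of "q k 0"] by (simp add: field_simps)
    obtain j' where "W (q k (0 + int j)) < \<rho> ^ j'" using real_arch_pow[OF \<rho>(2)] by blast
    moreover have "W (q k (0 + int j)) = \<rho> ^ j' * W (q k (int j - int j'))"
      using Wn[of k "int j - int j'" j'] by simp
    ultimately have "\<rho> ^ j' * W (q k (int j - int j')) < \<rho> ^ j' * 1" by simp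
    then have small: "W (q k (int j - int j')) < 1" using \<rho>(2) by (subst (asm) mult_less_cancel_left_pos) auto
    define m where "m = (LEAST i. 1 \<le> W (q k (int j - int j' + int i)))"
    have ex: "1 \<le> W (q k (int j - int j' + int j'))" using big by simp
    have m: "1 \<le> W (q k (int j - int j' + int m))" unfolding m_def using ex by (rule LeastI)
    have "m \<noteq> 0" using m small by (intro notI) simp
    then obtain m' where m': "m = Suc m'" by (cases m) auto
    have "\<not> 1 \<le> W (q k (int j - int j' + int m'))"
      using not_less_Least[of m' "\<lambda>i. 1 \<le> W (q k (int j - int j' + int i))"] m' unfolding m_def by simp
    moreover have "W (q k (int j - int j' + int m)) = \<rho> * W (q k (int j - int j' + int m'))"
      using \<rho>(1)[of k "int j - int j' + int m'"] m' by (simp add: add_ac)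
    ultimately have "W (q k (int j - int j' + int m)) \<le> \<rho>" using \<rho>(2) by simp
    then show ?thesis using m by blast
  qed
  define n where "n k = (SOME n. 1 \<le> W (q k n) \<and> W (q k n) \<le> \<rho>)" for k
  have n: "1 \<le> W (q k (n k))" "W (q k (n k)) \<le> \<rho>" for k
    using someI_ex[OF level[of k]] unfolding n_def by blast+
  define z where "z k = \<Psi> (q k (n k))" for k
  have stepn: "dist (\<Psi> (q k m)) (\<Psi> (q k (m + 1))) \<le> 1 / W (q k m)" for k m
  proof -
    have "(dist (\<Psi> (q k m)) (\<Psi> (q k (m + 1))))\<^sup>2 \<le> 1 / (W (q k m) * W (q k (m + 1)))"
      by (rule immersedD(2)[OF W a1])
    also have "\<dots> \<le> 1 / (W (q k m) * W (q k m))"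
      unfolding \<rho>(1) using pos[of "q k m"] \<rho>(2) by (intro divide_left_mono mult_left_mono mult_pos_pos) auto
    also have "\<dots> = (1 / W (q k m))\<^sup>2" by (simp add: power2_eq_square)
    finally show ?thesis by (rule power2_le_imp_le) (use pos[of "q k m"] in simp)
  qed
  have stepk: "dist (\<Psi> (q k m)) (\<Psi> (q (Suc k) m)) \<le> sqrt (1 / \<sigma>) * (1 / W (q k m))" for k m
  proof -
    have "(dist (\<Psi> (q k m)) (\<Psi> (q (Suc k) m)))\<^sup>2 \<le> 1 / (W (q k m) * W (q (Suc k) m))"
      by (rule immersedD(2)[OF W a2])
    then have "dist (\<Psi> (q k m)) (\<Psi> (q (Suc k) m)) \<le> sqrt (1 / (W (q k m) * W (q (Suc k) m)))"
      by (rule real_le_rsqrt)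
    also have "\<dots> = sqrt (1 / \<sigma>) * (1 / W (q k m))"
      unfolding \<sigma> using pos[of "q k m"] by (simp add: real_sqrt_divide real_sqrt_mult)
    finally show ?thesis .
  qed
  \<comment> \<open>The geometric series that bounds the total length of a row beyond the chosen
    vertex.\<close>
  define C where "C = 1 / (1 - 1 / \<rho>)"
  have C: "dist (z k) (\<Psi> (q k (n k + int N))) \<le> C" for k N
  proof -
    have "dist (z k) (\<Psi> (q k (n k + int N))) \<le> (\<Sum>j<N. (1 / \<rho>) ^ j)"
    proof (induction N)
      case (Suc N)
      have "q k (n k + int (Suc N)) = q k (n k + int N + 1)" by (simp add: add_ac)
      then have "dist (\<Psi> (q k (n k + int N))) (\<Psi> (q k (n k + int (Suc N)))) \<le> 1 / W (q k (n k + int N))"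
        using stepn[of k "n k + int N"] by simp
      also have "\<dots> \<le> 1 / \<rho> ^ N"
        unfolding Wn using n(1)[of k] \<rho>(2) by (intro divide_left_mono) auto
      finally have "dist (\<Psi> (q k (n k + int N))) (\<Psi> (q k (n k + int (Suc N)))) \<le> (1 / \<rho>) ^ N"
        by (simp add: power_one_over)
      then show ?case using Suc dist_triangle[of "z k" "\<Psi> (q k (n k + int (Suc N)))" "\<Psi> (q k (n k + int N))"]
        by simp
    qed (simp add: z_def)
    also have "\<dots> \<le> (\<Sum>j. (1 / \<rho>) ^ j)"
      using \<rho>(2) by (intro sum_le_suminf summable_geometric) auto
    also have "\<dots> = C" unfolding C_def using \<rho>(2) by (intro suminf_geometric) simp
    finally show ?thesis .
  qed
  have zero: "(\<lambda>N. dist (\<Psi> (q 0 (m + int N))) (\<Psi> (q k (m + int N)))) \<longlonglongrightarrow> 0" for k m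
  proof (induction k)
    case (Suc k)
    have "norm (1 / \<rho>) < 1" using \<rho>(2) by simp
    then have p0: "(\<lambda>N. (1 / \<rho>) ^ N) \<longlonglongrightarrow> 0" by (rule LIMSEQ_power_zero)
    have "(\<lambda>N. sqrt (1 / \<sigma>) * ((1 / \<rho>) ^ N * (1 / W (q k m)))) \<longlonglongrightarrow> sqrt (1 / \<sigma>) * (0 * (1 / W (q k m)))"
      by (intro tendsto_mult tendsto_const p0)
    then have "(\<lambda>N. dist (\<Psi> (q 0 (m + int N))) (\<Psi> (q k (m + int N))) +
        sqrt (1 / \<sigma>) * (1 / W (q k (m + int N)))) \<longlonglongrightarrow> 0 + sqrt (1 / \<sigma>) * (0 * (1 / W (q k m)))"
      unfolding Wn using Suc by (intro tendsto_add) (auto simp: power_one_over)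
    then have "(\<lambda>N. dist (\<Psi> (q 0 (m + int N))) (\<Psi> (q k (m + int N))) +
        sqrt (1 / \<sigma>) * (1 / W (q k (m + int N)))) \<longlonglongrightarrow> 0" by simp
    then show ?case
    proof (rule Lim_null_comparison[rotated])
      show "\<forall>\<^sub>F N in sequentially. norm (dist (\<Psi> (q 0 (m + int N))) (\<Psi> (q (Suc k) (m + int N))))
          \<le> dist (\<Psi> (q 0 (m + int N))) (\<Psi> (q k (m + int N))) + sqrt (1 / \<sigma>) * (1 / W (q k (m + int N)))"
      proof (intro always_eventually allI)
        fix N
        show "norm (dist (\<Psi> (q 0 (m + int N))) (\<Psi> (q (Suc k) (m + int N))))
          \<le> dist (\<Psi> (q 0 (m + int N))) (\<Psi> (q k (m + int N))) + sqrt (1 / \<sigma>) * (1 / W (q k (m + int N)))"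
          using stepk[of k "m + int N"]
            dist_triangle[of "\<Psi> (q 0 (m + int N))" "\<Psi> (q (Suc k) (m + int N))" "\<Psi> (q k (m + int N))"]
          unfolding real_norm_def abs_of_nonneg[OF zero_le_dist] by linarith
      qed
    qed
  qed simp
  have bound: "dist (z 0) (z k) \<le> 2 * C + 1" for k
  proof -
    define m where "m = max (n 0) (n k)"
    obtain N where N: "dist (\<Psi> (q 0 (m + int N))) (\<Psi> (q k (m + int N))) < 1"
      using order_tendstoD(2)[OF zero[of m k], of 1] unfolding eventually_sequentially by fastforce
    obtain N0 where N0: "m + int N = n 0 + int N0" using zle_iff_zadd[of "n 0" "m + int N"] m_def by auto
    obtain Nk where Nk: "m + int N = n k + int Nk" using zle_iff_zadd[of "n k" "m + int N"] m_def by auto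
    have "dist (z 0) (\<Psi> (q 0 (m + int N))) \<le> C" "dist (z k) (\<Psi> (q k (m + int N))) \<le> C"
      using C[of 0 N0] C[of k Nk] N0 Nk by simp_all
    then show ?thesis using N
      dist_triangle[of "z 0" "z k" "\<Psi> (q 0 (m + int N))"]
      dist_triangle[of "\<Psi> (q 0 (m + int N))" "z k" "\<Psi> (q k (m + int N))"]
      dist_commute[of "z k" "\<Psi> (q k (m + int N))"] by linarith
  qed
  then have "bounded (range z)" unfolding bounded_def by blast
  then obtain l r where r: "strict_mono (r :: nat \<Rightarrow> nat)" "(z \<circ> r) \<longlonglongrightarrow> l"
    using bounded_imp_convergent_subsequence by blast
  then have "Cauchy (z \<circ> r)" using LIMSEQ_imp_Cauchy by blast
  \<comment> \<open>The separation of the chosen vertices: \<open>W \<le> \<rho>\<close> there, so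
    distinct ones are mapped at least \<open>1 / (4 * \<rho>)\<close> apart.\<close>
  moreover have "0 < 1 / (4 * \<rho>)" using \<rho>(2) by simp
  ultimately obtain K where "dist ((z \<circ> r) K) ((z \<circ> r) (Suc K)) < 1 / (4 * \<rho>)"
    unfolding Cauchy_def by (meson le_refl le_SucI)
  then have lt: "dist (z (r K)) (z (r (Suc K))) < 1 / (4 * \<rho>)" by simp
  have "r K \<noteq> r (Suc K)" using strict_monoD[OF r(1), of K "Suc K"] by simp
  then have "q (r K) (n (r K)) \<noteq> q (r (Suc K)) (n (r (Suc K)))" using q by blast
  then have "1 / (16 * (W (q (r K) (n (r K))))\<^sup>2) \<le> (dist (z (r K)) (z (r (Suc K))))\<^sup>2"
    unfolding z_def by (rule immersedD(3)[OF W])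
  moreover have "(1 / (4 * \<rho>))\<^sup>2 \<le> 1 / (16 * (W (q (r K) (n (r K))))\<^sup>2)"
  proof -
    have "(W (q (r K) (n (r K))))\<^sup>2 \<le> \<rho>\<^sup>2" using n[of "r K"] by (intro power_mono) auto
    moreover have "0 < W (q (r K) (n (r K)))" by (rule pos)
    ultimately show ?thesis using \<rho>(2) by (simp add: power_divide power_mult_distrib) (intro divide_left_mono, auto)
  qed
  moreover have "(dist (z (r K)) (z (r (Suc K))))\<^sup>2 < (1 / (4 * \<rho>))\<^sup>2"
    using lt by (intro power_strict_mono) auto
  ultimately show False by linarith
qed

theorem immersed_constant:
  assumes X: "immersed X \<Phi>"
  shows "X v = X w"
proof -
  have le: "X (v + \<delta>) \<le> X v" for v \<delta>
  proof -
    \<comment> \<open>The empty set puts no constraint on the first maximum, so \<open>M\<close>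
      bounds the ratio of the given \<open>X\<close>; it remains to show \<open>M = 1\<close> on the
      character \<open>W\<close>.\<close>
    have "periodic {} X" by (simp add: periodic_def)
    then obtain M Y1 \<Psi>1 where Y1: "immersed Y1 \<Psi>1" "periodic {(\<delta>, M)} Y1" and
      max: "\<And>X \<Phi> v. immersed X \<Phi> \<Longrightarrow> periodic {} X \<Longrightarrow> X (v + \<delta>) \<le> M * X v"
      by (rule maximal_ratio[OF X, of "{}" \<delta>]) (rule that)
    obtain A Y2 \<Psi>2 where Y2: "immersed Y2 \<Psi>2" "periodic {((1,0), A), (\<delta>, M)} Y2"
      by (rule maximal_ratio[OF Y1, of "(1,0)"]) (rule that)
    obtain B W \<Psi> where W: "immersed W \<Psi>" "periodic {((0,1), B), ((1,0), A), (\<delta>, M)} W"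
      by (rule maximal_ratio[OF Y2, of "(0,1)"]) (rule that)
    have pos: "0 < W v" for v by (rule hexflatD(1)[OF immersedD(1)[OF W(1)]])
    have "W ((m, n) + (0,1)) = B * W (m, n)" "W ((m, n) + (1,0)) = A * W (m, n)" for m n
      by (rule periodicD[OF W(2)], simp)+
    then have WB: "W (m, n + 1) = B * W (m, n)" and WA: "W (m + 1, n) = A * W (m, n)" for m n
      by simp_all
    have W\<delta>: "W (v + \<delta>) = M * W v" for v by (rule periodicD[OF W(2)]) simp
    have AB: "0 < A" "0 < B"
      using WA[of 0 0] WB[of 0 0] pos[of "(1,0)"] pos[of "(0,1)"] pos[of "(0,0)"]
      by (simp_all add: zero_less_mult_iff)
    have inv: "W (m - 1, n) = 1 / A * W (m, n)" "W (m, n - 1) = 1 / B * W (m, n)" for m n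
    proof -
      have e: "W (m, n) = A * W (m - 1, n)" "W (m, n) = B * W (m, n - 1)"
        using WA[of "m - 1" n] WB[of m "n - 1"] by simp_all
      show "W (m - 1, n) = 1 / A * W (m, n)" unfolding e(1) using AB by simp
      show "W (m, n - 1) = 1 / B * W (m, n)" unfolding e(2) using AB by simp
    qed
    have WA': "W (1 + m, n) = A * W (m, n)" and WB': "W (m, 1 + n) = B * W (m, n)" for m n
      using WA[of m n] WB[of m n] by (simp_all add: add.commute)
    have inv': "W (- m - 1, n) = 1 / A * W (- m, n)" "W (m, - n - 1) = 1 / B * W (m, - n)" for m n
      by (rule inv)+
    have "\<not> 1 < A"
    proof
      assume "1 < A"
      then show False
        by (intro exponential_contradiction[OF W(1), where q = "\<lambda>k n. (n, int k)" and \<rho> = A and \<sigma> = B])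
          (simp_all add: adj_iff WA WB')
    qed
    \<comment> \<open>The case \<open>A < 1\<close>: rows are traversed backwards, so that the edges
      shrink again.\<close>
    moreover have "\<not> 1 < 1 / A"
    proof
      assume "1 < 1 / A"
      then show False
        by (intro exponential_contradiction[OF W(1), where q = "\<lambda>k n. (- n, int k)" and \<rho> = "1 / A" and \<sigma> = B])
          (simp_all add: adj_iff inv' WB')
    qed
    ultimately have A1: "A = 1" using AB by simp
    have "\<not> 1 < B"
    proof
      assume "1 < B"
      then show False
        by (intro exponential_contradiction[OF W(1), where q = "\<lambda>k n. (int k, n)" and \<rho> = B and \<sigma> = A])
          (simp_all add: adj_iff WB WA')
    qed
    moreover have "\<not> 1 < 1 / B"
    proof
      assume "1 < 1 / B"
      then show False
        by (intro exponential_contradiction[OF W(1), where q = "\<lambda>k n. (int k, - n)" and \<rho> = "1 / B" and \<sigma> = A])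
          (simp_all add: adj_iff inv' WA')
    qed
    ultimately have B1: "B = 1" using AB by simp
    have "W u = W 0" for u
    proof (induction u rule: lattice_induct)
      case (2 u u')
      have "W (m + 1, n) = W (m, n)" "W (m, n + 1) = W (m, n)" "W (m - 1, n) = W (m, n)" "W (m, n - 1) = W (m, n)" for m n
        using WA WB inv A1 B1 by simp_all
      note s = this
      obtain k where k: "k < 6" "u' = u + hex_dir k" using 2(2) unfolding adj_def by blast
      obtain m n where u: "u = (m, n)" by (cases u)
      have "W u' = W u" unfolding k(2) u using k(1)
        unfolding less6 by (elim insertE emptyE) (simp_all add: s)
      then show ?case using 2(1) by simp
    qed simp
    then have "W (0 + \<delta>) = W 0" .
    then have "M = 1" using W\<delta>[of 0] pos[of 0] by simp
    then show ?thesis using max[OF X, of v] by (simp add: periodic_def)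
  qed
  have "X w \<le> X v" using le[of v "w - v"] by simp
  moreover have "X v \<le> X w" using le[of w "v - w"] by simp
  ultimately show ?thesis by simp
qed

section \<open>Barycentric coordinates in the plane\<close>

definition cvert :: "int \<times> int \<Rightarrow> complex" where
  "cvert v = of_int (fst v) + of_int (snd v) * hex_omega"

lemma hex_omega_parts [simp]: "Re hex_omega = 1 / 2" "Im hex_omega = sqrt 3 / 2"
  by (simp_all add: hex_omega_def)

lemma cvert_parts: "Re (cvert v) = of_int (fst v) + of_int (snd v) / 2" "Im (cvert v) = of_int (snd v) * (sqrt 3 / 2)"
  by (simp_all add: cvert_def)

lemma cvert_diff: "cvert w - cvert v = cvert (w - v)"
  by (simp add: cvert_def algebra_simps)

lemma inj_cvert: "inj cvert"
proof (rule injI)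
  fix v w assume eq: "cvert v = cvert w"
  then have "Im (cvert v) = Im (cvert w)" "Re (cvert v) = Re (cvert w)" by simp_all
  then show "v = w" unfolding cvert_parts by (simp add: prod_eq_iff)
qed

lemma norm_cvert: "(norm (cvert v))\<^sup>2 = of_int ((fst v)\<^sup>2 + fst v * snd v + (snd v)\<^sup>2)"
proof -
  have "(norm (cvert v))\<^sup>2 = (of_int (fst v) + of_int (snd v) / 2)\<^sup>2 + (of_int (snd v) * (sqrt 3 / 2))\<^sup>2"
    unfolding cmod_power2 cvert_parts ..
  also have "\<dots> = of_int ((fst v)\<^sup>2 + fst v * snd v + (snd v)\<^sup>2)"
    by (simp add: power_mult_distrib power_divide) (simp add: power2_eq_square field_simps)
  finally show ?thesis .
qed

text \<open>The units of the Eisenstein integers: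
  \<open>4 (m^2 + m n + n^2) = (2 m + n)^2 + 3 n^2\<close> bounds both coordinates by 1 in absolute
  value.\<close>

lemma eisenstein_units:
  fixes m n :: int
  shows "m\<^sup>2 + m * n + n\<^sup>2 = 1 \<longleftrightarrow> (m, n) \<in> {(1,0),(0,1),(-1,1),(-1,0),(0,-1),(1,-1)}"
proof
  assume e: "m\<^sup>2 + m * n + n\<^sup>2 = 1"
  have "(2 * m + n)\<^sup>2 + 3 * n\<^sup>2 = 4 * (m\<^sup>2 + m * n + n\<^sup>2)" "(2 * n + m)\<^sup>2 + 3 * m\<^sup>2 = 4 * (m\<^sup>2 + m * n + n\<^sup>2)"
    by (simp_all add: power2_eq_square algebra_simps)
  then have "3 * n\<^sup>2 \<le> 4" "3 * m\<^sup>2 \<le> 4" using e by (smt (verit) zero_le_power2)+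
  then have "n\<^sup>2 \<le> 1" "m\<^sup>2 \<le> 1" by linarith+
  then have "\<bar>n\<bar> \<le> 1" "\<bar>m\<bar> \<le> 1" by (simp_all add: abs_square_le_1)
  then have "n = -1 \<or> n = 0 \<or> n = 1" "m = -1 \<or> m = 0 \<or> m = 1" by linarith+
  then show "(m, n) \<in> {(1,0),(0,1),(-1,1),(-1,0),(0,-1),(1,-1)}" using e by auto
qed auto

lemma dist_cvert: "dist (cvert v) (cvert w) = 1 \<longleftrightarrow> adj v w"
proof -
  have "dist (cvert v) (cvert w) = norm (cvert (w - v))"
    by (metis dist_commute dist_norm cvert_diff)
  then have "dist (cvert v) (cvert w) = 1 \<longleftrightarrow> (norm (cvert (w - v)))\<^sup>2 = 1"
    by (simp add: power2_eq_1_iff) (smt (verit) norm_ge_zero)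
  also have "\<dots> \<longleftrightarrow> adj v w"
    unfolding norm_cvert of_int_eq_1_iff eisenstein_units adj_iff by simp
  finally show ?thesis .
qed

lemma hex_V_iff: "hex_V = range cvert"
  unfolding hex_V_def cvert_def by (force intro!: image_eqI[where x = "(_, _)"])

lemma hex_E_iff: "{cvert v, cvert w} \<in> hex_E \<longleftrightarrow> adj v w"
proof -
  have "{cvert v, cvert w} \<in> hex_E \<longleftrightarrow> dist (cvert v) (cvert w) = 1"
    unfolding hex_E_def hex_V_iff by (auto simp: doubleton_eq_iff dist_commute)
  then show ?thesis unfolding dist_cvert .
qed

lemma hex_E_cases:
  assumes "{i, j} \<in> hex_E"
  obtains v w where "i = cvert v" "j = cvert w" "adj v w"
proof -
  have "i \<in> hex_V \<and> j \<in> hex_V" using assms unfolding hex_E_def by (auto simp: doubleton_eq_iff)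
  then obtain v w where "i = cvert v" "j = cvert w" unfolding hex_V_iff by blast
  then show thesis using that assms hex_E_iff by simp
qed

lemma hex_F_iff: "hex_F = image cvert ` faces"
proof (intro equalityI subsetI)
  fix f assume "f \<in> hex_F"
  then obtain i j k where f: "f = {i, j, k}" "{i, j} \<in> hex_E" "{j, k} \<in> hex_E" "{k, i} \<in> hex_E"
    unfolding hex_F_def by blast
  obtain u v where u: "i = cvert u" "j = cvert v" using hex_E_cases[OF f(2)] .
  obtain w where w: "k = cvert w" using hex_E_cases[OF f(3)] .
  have "tri u v w" using f unfolding u w hex_E_iff by (simp add: tri_def)
  then have "{u, v, w} \<in> faces" by (rule tri_face)
  moreover have "f = cvert ` {u, v, w}" unfolding f u w by simp
  ultimately show "f \<in> image cvert ` faces" by (rule rev_image_eqI)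
next
  fix f assume "f \<in> image cvert ` faces"
  then obtain u v w where f: "f = {cvert u, cvert v, cvert w}" "tri u v w" unfolding faces_def by auto
  then show "f \<in> hex_F" unfolding hex_F_def tri_def hex_E_iff[symmetric] by blast
qed

lemma hex_F_triple: "{cvert u, cvert v, cvert w} \<in> hex_F" if "tri u v w"
proof -
  have "cvert ` {u, v, w} \<in> hex_F" unfolding hex_F_iff using tri_face[OF that] by (rule imageI)
  then show ?thesis by simp
qed

lemma faces_up_down:
  assumes "g \<in> faces"
  obtains m n where "g = {(m, n), (m + 1, n), (m, n + 1)}" | m n where "g = {(m + 1, n), (m, n + 1), (m + 1, n + 1)}"
proof -
  obtain v where "v \<in> g" using assms unfolding faces_def by blast
  then obtain b c where g: "g = {v, b, c}" "tri v b c" using faces_elem[OF assms] by metis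
  obtain k where k: "k < 6" "b = v + hex_dir k" using g(2) unfolding tri_def adj_def by blast
  have c: "c = v + hex_dir (nxt k) \<or> c = v + hex_dir (prv k)" using g(2) tri_dir[OF k(1)] k(2) by blast
  have "\<exists>j<6. g = {v, v + hex_dir j, v + hex_dir (nxt j)}"
    using c
  proof
    assume "c = v + hex_dir (nxt k)" then show ?thesis using g k by blast
  next
    assume "c = v + hex_dir (prv k)"
    moreover have "nxt (prv k) = k" using k(1) unfolding less6 by auto
    ultimately show ?thesis using g k by (intro exI[of _ "prv k"]) (auto simp: insert_commute)
  qed
  then obtain j where j: "j < 6" "g = {v, v + hex_dir j, v + hex_dir (nxt j)}" by blast
  obtain m n where v: "v = (m, n)" by (cases v)
  consider "j = 0" | "j = 1" | "j = 2" | "j = 3" | "j = 4" | "j = 5" using j(1) unfolding less6 by blast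
  then show thesis
  proof cases
    case 1 show ?thesis by (rule that(1)[of m n]) (simp add: j v 1)
  next
    case 2 show ?thesis by (rule that(2)[of "m - 1" n]) (simp add: j v 2 insert_commute)
  next
    case 3 show ?thesis by (rule that(1)[of "m - 1" n]) (simp add: j v 3 insert_commute)
  next
    case 4 show ?thesis by (rule that(2)[of "m - 1" "n - 1"]) (simp add: j v 4 insert_commute)
  next
    case 5 show ?thesis by (rule that(1)[of m "n - 1"]) (simp add: j v 5 insert_commute)
  next
    case 6 show ?thesis by (rule that(2)[of m "n - 1"]) (simp add: j v 6 insert_commute)
  qed
qed

section \<open>Coordinates in the basis 1, \<open>hex_omega\<close> and piecewise linear hat
  functions\<close>

definition coord1 :: "complex \<Rightarrow> real" where "coord1 z = Re z - Im z / sqrt 3"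
definition coord2 :: "complex \<Rightarrow> real" where "coord2 z = 2 * Im z / sqrt 3"

text \<open>The maximum of \<open>\<bar>s\<bar>\<close>, \<open>\<bar>t\<bar>\<close>,
  \<open>\<bar>s + t\<bar>\<close> is the norm whose unit ball is the hexagon spanned by the six
  neighbours. This yields barycentric coordinates without choosing a face.\<close>

definition hat :: "complex \<Rightarrow> int \<times> int \<Rightarrow> real" where
  "hat z v = (let s = coord1 z - of_int (fst v); t = coord2 z - of_int (snd v) in max 0 (1 - max \<bar>s\<bar> (max \<bar>t\<bar> \<bar>s + t\<bar>)))"

lemma coord_cvert: "coord1 (cvert v) = of_int (fst v)" "coord2 (cvert v) = of_int (snd v)"
  by (simp_all add: coord1_def coord2_def cvert_parts)

lemma coord_linear:
  "coord1 (x + y) = coord1 x + coord1 y" "coord2 (x + y) = coord2 x + coord2 y"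
  "coord1 (a *\<^sub>R x) = a * coord1 x" "coord2 (a *\<^sub>R x) = a * coord2 x"
  by (simp_all add: coord1_def coord2_def add_divide_distrib algebra_simps)

lemma hat_nonneg: "0 \<le> hat z v"
  by (simp add: hat_def Let_def)

lemma hat_far:
  assumes "1 \<le> \<bar>coord1 z - of_int (fst v)\<bar> \<or> 1 \<le> \<bar>coord2 z - of_int (snd v)\<bar> \<or> 1 \<le> \<bar>coord1 z - of_int (fst v) + (coord2 z - of_int (snd v))\<bar>"
  shows "hat z v = 0"
  using assms by (auto simp: hat_def Let_def max_def)

lemma hat_up:
  assumes st: "0 \<le> s" "0 \<le> t" "s + t \<le> 1" and z: "coord1 z = m + s" "coord2 z = n + t"
  shows "hat z (m, n) = 1 - s - t" "hat z (m + 1, n) = s" "hat z (m, n + 1) = t"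
    and "v \<notin> {(m, n), (m + 1, n), (m, n + 1)} \<Longrightarrow> hat z v = 0"
proof -
  show "hat z (m, n) = 1 - s - t" "hat z (m + 1, n) = s" "hat z (m, n + 1) = t"
    using st by (auto simp: hat_def Let_def z max_def abs_if)
  obtain i j where v: "v = (m - i, n - j)" by (metis diff_diff_eq2 add_diff_cancel_left' surj_pair)
  assume "v \<notin> {(m, n), (m + 1, n), (m, n + 1)}"
  then have "(i, j) \<notin> {(0,0), (-1,0), (0,-1)}" unfolding v by auto
  then have "i \<ge> 1 \<or> i \<le> -2 \<or> j \<ge> 1 \<or> j \<le> -2 \<or> (i = -1 \<and> j = -1)" by auto
  moreover have "coord1 z - of_int (fst v) = s + i" "coord2 z - of_int (snd v) = t + j" by (simp_all add: z v)
  moreover have "real_of_int i \<ge> 1 \<longleftrightarrow> i \<ge> 1" "real_of_int i \<le> -2 \<longleftrightarrow> i \<le> -2"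
    "real_of_int j \<ge> 1 \<longleftrightarrow> j \<ge> 1" "real_of_int j \<le> -2 \<longleftrightarrow> j \<le> -2" by linarith+
  ultimately show "hat z v = 0" using st by (intro hat_far) auto
qed

lemma hat_down:
  assumes st: "s \<le> 1" "t \<le> 1" "1 \<le> s + t" and z: "coord1 z = m + s" "coord2 z = n + t"
  shows "hat z (m + 1, n + 1) = s + t - 1" "hat z (m + 1, n) = 1 - t" "hat z (m, n + 1) = 1 - s"
    and "v \<notin> {(m + 1, n), (m, n + 1), (m + 1, n + 1)} \<Longrightarrow> hat z v = 0"
proof -
  show "hat z (m + 1, n + 1) = s + t - 1" "hat z (m + 1, n) = 1 - t" "hat z (m, n + 1) = 1 - s"
    using st by (auto simp: hat_def Let_def z max_def abs_if)
  obtain i j where v: "v = (m - i, n - j)" by (metis diff_diff_eq2 add_diff_cancel_left' surj_pair)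
  assume "v \<notin> {(m + 1, n), (m, n + 1), (m + 1, n + 1)}"
  then have "(i, j) \<notin> {(-1,0), (0,-1), (-1,-1)}" unfolding v by auto
  then have "i \<ge> 1 \<or> i \<le> -2 \<or> j \<ge> 1 \<or> j \<le> -2 \<or> (i = 0 \<and> j = 0)" by auto
  moreover have "coord1 z - of_int (fst v) = s + i" "coord2 z - of_int (snd v) = t + j" by (simp_all add: z v)
  moreover have "real_of_int i \<ge> 1 \<longleftrightarrow> i \<ge> 1" "real_of_int i \<le> -2 \<longleftrightarrow> i \<le> -2"
    "real_of_int j \<ge> 1 \<longleftrightarrow> j \<ge> 1" "real_of_int j \<le> -2 \<longleftrightarrow> j \<le> -2" by linarith+
  ultimately show "hat z v = 0" using st by (intro hat_far) auto
qed

lemma complex_coord_eqI: "coord1 x = coord1 y \<Longrightarrow> coord2 x = coord2 y \<Longrightarrow> x = y"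
  by (simp add: coord1_def coord2_def complex_eq_iff)

lemma hat_hull:
  assumes g: "g \<in> faces" and z: "z \<in> convex hull (cvert ` g)"
  shows "bary_weights (hat z) g" "bary_point cvert g (hat z) = z"
proof -
  have "bary_weights (hat z) g \<and> bary_point cvert g (hat z) = z"
    using g
  proof (cases rule: faces_up_down)
    case (1 m n)
    have ne: "(m, n) \<noteq> (m + 1, n)" "(m, n) \<noteq> (m, n + 1)" "(m + 1, n) \<noteq> (m, n + 1)" by auto
    have "z \<in> convex hull {cvert (m, n), cvert (m + 1, n), cvert (m, n + 1)}" using z 1 by simp
    then obtain a s t where w: "0 \<le> a" "0 \<le> s" "0 \<le> t" "a + s + t = 1"
      "z = a *\<^sub>R cvert (m, n) + s *\<^sub>R cvert (m + 1, n) + t *\<^sub>R cvert (m, n + 1)"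
      unfolding convex_hull_3 by blast
    have a: "a = 1 - s - t" using w by simp
    have c: "coord1 z = m + s" "coord2 z = n + t"
      unfolding w(5) coord_linear coord_cvert a by (simp_all add: algebra_simps)
    have st: "0 \<le> s" "0 \<le> t" "s + t \<le> 1" using w by auto
    note h = hat_up[OF st c]
    have "bary_weights (hat z) g" unfolding bary_weights_def 1 using hat_nonneg h(1-3) ne
      by (intro conjI allI impI h(4)) (simp_all add: h)
    moreover have "bary_point cvert g (hat z) = z"
    proof -
      have "bary_point cvert g (hat z) = (1 - s - t) *\<^sub>R cvert (m, n) + s *\<^sub>R cvert (m + 1, n) + t *\<^sub>R cvert (m, n + 1)"
        unfolding bary_point_def 1 using ne by (simp add: h add.assoc)
      then show ?thesis unfolding w(5) a .
    qed
    ultimately show ?thesis ..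
  next
    case (2 m n)
    have ne: "(m + 1, n) \<noteq> (m, n + 1)" "(m + 1, n) \<noteq> (m + 1, n + 1)" "(m, n + 1) \<noteq> (m + 1, n + 1)" by auto
    have "z \<in> convex hull {cvert (m + 1, n), cvert (m, n + 1), cvert (m + 1, n + 1)}" using z 2 by simp
    then obtain a b c where w: "0 \<le> a" "0 \<le> b" "0 \<le> c" "a + b + c = 1"
      "z = a *\<^sub>R cvert (m + 1, n) + b *\<^sub>R cvert (m, n + 1) + c *\<^sub>R cvert (m + 1, n + 1)"
      unfolding convex_hull_3 by blast
    have c: "c = 1 - a - b" using w by simp
    have co: "coord1 z = m + (1 - b)" "coord2 z = n + (1 - a)"
      unfolding w(5) coord_linear coord_cvert c by (simp_all add: algebra_simps)
    have st: "1 - b \<le> 1" "1 - a \<le> 1" "1 \<le> (1 - b) + (1 - a)" using w by auto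
    note h = hat_down[OF st co]
    have "bary_weights (hat z) g" unfolding bary_weights_def 2 using hat_nonneg h(1-3) ne
      by (intro conjI allI impI h(4)) (simp_all add: h)
    moreover have "bary_point cvert g (hat z) = z"
    proof -
      have "bary_point cvert g (hat z) = a *\<^sub>R cvert (m + 1, n) + b *\<^sub>R cvert (m, n + 1) + (1 - a - b) *\<^sub>R cvert (m + 1, n + 1)"
        unfolding bary_point_def 2 using ne by (simp add: h add.assoc)
      then show ?thesis unfolding w(5) c .
    qed
    ultimately show ?thesis ..
  qed
  then show "bary_weights (hat z) g" "bary_point cvert g (hat z) = z" by blast+
qed

lemma hat_vertex: "hat (cvert v) = (\<lambda>w. if w = v then 1 else 0)"
proof
  fix w
  have c: "coord1 (cvert v) = of_int (fst v) + 0" "coord2 (cvert v) = of_int (snd v) + 0" by (simp_all add: coord_cvert)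
  note h = hat_up[of 0 0, OF _ _ _ c]
  show "hat (cvert v) w = (if w = v then 1 else 0)"
    using h(1,2,3) h(4)[of w] by (cases v; cases w) auto
qed

lemma tri_explicit: "tri (m, n) (m + 1, n) (m, n + 1)" "tri (m + 1, n) (m, n + 1) (m + 1, n + 1)"
  by (simp_all add: tri_def adj_iff)

lemma faces_cover: "\<exists>g\<in>faces. z \<in> convex hull (cvert ` g)"
proof -
  define m n s t where "m = \<lfloor>coord1 z\<rfloor>" and "n = \<lfloor>coord2 z\<rfloor>" and "s = coord1 z - m" and "t = coord2 z - n"
  have st: "0 \<le> s" "s \<le> 1" "0 \<le> t" "t \<le> 1" unfolding s_def t_def m_def n_def by linarith+
  show ?thesis
  proof (cases "s + t \<le> 1")
    case True
    have "z = (1 - s - t) *\<^sub>R cvert (m, n) + s *\<^sub>R cvert (m + 1, n) + t *\<^sub>R cvert (m, n + 1)"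
      by (rule complex_coord_eqI; unfold coord_linear coord_cvert) (simp_all add: s_def t_def algebra_simps)
    then have "z \<in> convex hull {cvert (m, n), cvert (m + 1, n), cvert (m, n + 1)}"
      unfolding convex_hull_3 using st True
      by (intro CollectI exI[of _ "1 - s - t"] exI[of _ s] exI[of _ t]) simp
    then have "z \<in> convex hull (cvert ` {(m, n), (m + 1, n), (m, n + 1)})" by simp
    then show ?thesis using tri_face[OF tri_explicit(1)] by (rule bexI)
  next
    case False
    have "z = (1 - t) *\<^sub>R cvert (m + 1, n) + (1 - s) *\<^sub>R cvert (m, n + 1) + (s + t - 1) *\<^sub>R cvert (m + 1, n + 1)"
      by (rule complex_coord_eqI; unfold coord_linear coord_cvert) (simp_all add: s_def t_def algebra_simps)
    then have "z \<in> convex hull {cvert (m + 1, n), cvert (m, n + 1), cvert (m + 1, n + 1)}"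
      unfolding convex_hull_3 using st False
      by (intro CollectI exI[of _ "1 - t"] exI[of _ "1 - s"] exI[of _ "s + t - 1"]) simp
    then have "z \<in> convex hull (cvert ` {(m + 1, n), (m, n + 1), (m + 1, n + 1)})" by simp
    then show ?thesis using tri_face[OF tri_explicit(2)] by (rule bexI)
  qed
qed

section \<open>The intrinsic distance\<close>

definition edge_metric :: "(int \<times> int \<Rightarrow> real) \<Rightarrow> (complex set \<Rightarrow> real) \<Rightarrow> bool" where
  "edge_metric X l \<longleftrightarrow> (\<forall>v. 0 < X v) \<and> (\<forall>a b c. tri a b c \<longrightarrow> 0 \<le> heron (X a) (X b) (X c)) \<and>
     (\<forall>v w. adj v w \<longrightarrow> 0 \<le> l {cvert v, cvert w} \<and> (l {cvert v, cvert w})\<^sup>2 = sqlen X v w)"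

lemma edge_metricD:
  assumes "edge_metric X l"
  shows "0 < X v" and "tri a b c \<Longrightarrow> 0 \<le> heron (X a) (X b) (X c)"
    and "adj v w \<Longrightarrow> 0 \<le> l {cvert v, cvert w}" and "adj v w \<Longrightarrow> (l {cvert v, cvert w})\<^sup>2 = sqlen X v w"
  using assms unfolding edge_metric_def by simp_all

lemma faces_adj: "g \<in> faces \<Longrightarrow> v \<in> g \<Longrightarrow> w \<in> g \<Longrightarrow> v \<noteq> w \<Longrightarrow> adj v w"
  using faces_edge[of g v w] unfolding tri_def by metis

lemma realize_exists:
  assumes l: "edge_metric X l" and t: "tri a b c"
  obtains P where "realize X {a, b, c} P"
proof -
  note X = edge_metricD[OF l]
  have d: "distinct [a, b, c]" using tri_distinct[OF t] by simp
  define P where "P = (\<lambda>u. if u = b then of_real (sqrt (sqlen X a b)) else (0 :: complex))"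
  have "0 \<le> sqlen X a b" using X(1)[of a] X(1)[of b] by (simp add: sqlen_def)
  then have "(dist (P a) (P b))\<^sup>2 = sqlen X a b" using d by (simp add: P_def dist_norm)
  from realize_extend[OF this d X(1) X(1) X(1) _ X(2)[OF t], of 1]
  show thesis using that by auto
qed

lemma realizes_face_exists:
  assumes l: "edge_metric X l" and g: "g \<in> faces"
  shows "\<exists>\<phi>. realizes_face l (cvert ` g) \<phi>"
proof -
  obtain a b c where t: "g = {a, b, c}" "tri a b c" using g unfolding faces_def by blast
  obtain P where P: "realize X {a, b, c} P" using realize_exists[OF l t(2)] .
  have d: "a \<noteq> b" "b \<noteq> c" "a \<noteq> c" using tri_distinct[OF t(2)] by auto
  define B C where "B = cvert b - cvert a" and "C = cvert c - cvert a"
  define D where "D = wedge 1 B C"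
  have adj: "dist (cvert b) (cvert a) = 1" "dist (cvert b) (cvert c) = 1" "dist (cvert a) (cvert c) = 1"
    using t(2) unfolding tri_def dist_cvert by (simp_all add: adj_sym)
  have "(near 1 (cvert c) (cvert a) (cvert b))\<^sup>2 = 3 / 4"
    using near_inner[of 1 "cvert c" "cvert a" "cvert b"]
    unfolding inner_dist adj by (simp add: power2_eq_square)
  moreover have "near 1 (cvert c) (cvert a) (cvert b) = D"
    by (simp add: near_def wedge_def D_def B_def C_def algebra_simps)
  ultimately have D: "D \<noteq> 0" by auto
  \<comment> \<open>Cramer's rule for the linear map sending \<open>B\<close> to
    \<open>P b - P a\<close> and \<open>C\<close> to \<open>P c - P a\<close>.\<close>
  define L where "L z = (wedge 1 z C / D) *\<^sub>R (P b - P a) + (wedge 1 B z / D) *\<^sub>R (P c - P a)" for z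
  have lin: "linear L"
    by (rule linearI) (simp_all add: L_def wedge_def add_divide_distrib diff_divide_distrib algebra_simps)
  define \<phi> where "\<phi> z = P a + L (z - cvert a)" for z
  have LB: "L B = P b - P a" "L C = P c - P a" using D by (simp_all add: L_def D_def)
  have "\<phi> z - \<phi> 0 = L z" for z
    using linear_diff[OF lin, of "z - cvert a" "0 - cvert a"] by (simp add: \<phi>_def)
  then have "linear (\<lambda>z. \<phi> z - \<phi> 0)" using lin by simp
  moreover have \<phi>: "\<phi> (cvert v) = P v" if "v \<in> g" for v
    using that LB linear_0[OF lin] unfolding t \<phi>_def B_def C_def by auto
  moreover have "dist (\<phi> (cvert v)) (\<phi> (cvert w)) = l {cvert v, cvert w}" if "v \<in> g" "w \<in> g" "v \<noteq> w" for v w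
  proof -
    have a: "adj v w" by (rule faces_adj[OF g that])
    have "(dist (P v) (P w))\<^sup>2 = (l {cvert v, cvert w})\<^sup>2"
      using P that unfolding t(1) realize_def edge_metricD(4)[OF l a] by blast
    then show ?thesis unfolding \<phi>[OF that(1)] \<phi>[OF that(2)]
      using edge_metricD(3)[OF l a] by (simp add: power2_eq_iff_nonneg)
  qed
  ultimately have "realizes_face l (cvert ` g) \<phi>"
    unfolding realizes_face_def by (intro conjI ballI impI; (elim imageE)?) (assumption, metis)
  then show ?thesis by blast
qed

text \<open>Whichever map is selected, it is affine and realizes the face, so distances depend only
  on barycentric coordinates and \<open>X\<close>.\<close>

lemma face_dist_eq:
  assumes l: "edge_metric X l" and g: "g \<in> faces"
    and z: "z \<in> convex hull (cvert ` g)" "z' \<in> convex hull (cvert ` g)"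
  shows "face_dist l (cvert ` g) z z' = face_len X g (hat z) (hat z')"
proof -
  define \<phi> where "\<phi> = (SOME \<phi>. realizes_face l (cvert ` g) \<phi>)"
  have r: "realizes_face l (cvert ` g) \<phi>"
    unfolding \<phi>_def using realizes_face_exists[OF l g] by (rule someI_ex)
  define L where "L z = \<phi> z - \<phi> 0" for z
  have lin: "linear L" using r unfolding realizes_face_def L_def by blast
  define P where "P v = \<phi> (cvert v)" for v
  have P: "realize X g P"
    unfolding realize_def
  proof (intro ballI)
    fix v w assume vw: "v \<in> g" "w \<in> g"
    show "(dist (P v) (P w))\<^sup>2 = sqlen X v w"
    proof (cases "v = w")
      case False
      then have "dist (P v) (P w) = l {cvert v, cvert w}"
        using r vw inj_cvert unfolding realizes_face_def P_def by (auto simp: inj_eq)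
      then show ?thesis using edge_metricD(4)[OF l faces_adj[OF g vw False]] by simp
    qed (simp add: sqlen_def)
  qed
  have \<phi>: "\<phi> z = bary_point P g (hat z)" if "z \<in> convex hull (cvert ` g)" for z
  proof -
    note h = hat_hull[OF g that]
    have s: "sum (hat z) g = 1" using h(1) by (simp add: bary_weights_def)
    have "\<phi> z = \<phi> 0 + L (bary_point cvert g (hat z))" using h(2) by (simp add: L_def)
    also have "L (bary_point cvert g (hat z)) = (\<Sum>v\<in>g. hat z v *\<^sub>R L (cvert v))"
      unfolding bary_point_def by (simp add: linear_sum[OF lin] linear_scale[OF lin])
    also have "\<dots> = bary_point P g (hat z) - (\<Sum>v\<in>g. hat z v) *\<^sub>R \<phi> 0"
      unfolding L_def bary_point_def P_def scaleR_sum_left by (simp add: scaleR_diff_right sum_subtractf)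
    finally show ?thesis using s by simp
  qed
  have "face_dist l (cvert ` g) z z' = dist (\<phi> z) (\<phi> z')"
    by (simp add: face_dist_def \<phi>_def)
  also have "\<dots> = face_len X g (hat z) (hat z')"
    unfolding \<phi>[OF z(1)] \<phi>[OF z(2)] dist_commute[of "bary_point P g (hat z)"]
    by (rule bary_point_flen[OF finite_face[OF g] P hat_hull(1)[OF g z(1)] hat_hull(1)[OF g z(2)]])
  finally show ?thesis .
qed

section \<open>The unit metric induces the Euclidean distance\<close>

lemma face_dist_nonneg: "0 \<le> face_dist l f x y"
  by (simp add: face_dist_def Let_def)

lemma edge_metric_unit: "edge_metric (\<lambda>_. 1) unit_metric"
proof -
  have "v \<noteq> w" if "adj v w" for v w using that by auto
  then show ?thesis by (simp add: edge_metric_def heron_def unit_metric_def sqlen_def)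
qed

lemma face_dist_unit:
  assumes g: "g \<in> faces" and z: "z \<in> convex hull (cvert ` g)" "z' \<in> convex hull (cvert ` g)"
  shows "face_dist unit_metric (cvert ` g) z z' = dist z z'"
proof -
  have "realize (\<lambda>_. 1) g cvert"
    unfolding realize_def
  proof (intro ballI)
    fix v w assume vw: "v \<in> g" "w \<in> g"
    show "(dist (cvert v) (cvert w))\<^sup>2 = sqlen (\<lambda>_. 1) v w"
    proof (cases "v = w")
      case False
      have "dist (cvert v) (cvert w) = 1" unfolding dist_cvert by (rule faces_adj[OF g vw False])
      then show ?thesis using False by (simp add: sqlen_def)
    qed (simp add: sqlen_def)
  qed
  from bary_point_flen[OF finite_face[OF g] this hat_hull(1)[OF g z(1)] hat_hull(1)[OF g z(2)]]
  show ?thesis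
    unfolding face_dist_eq[OF edge_metric_unit g z] hat_hull(2)[OF g z(1)] hat_hull(2)[OF g z(2)]
    by (simp add: dist_commute)
qed

text \<open>Polygonal paths through faces with their Euclidean length, in a form that is easy to
  concatenate.\<close>

inductive reach :: "complex \<Rightarrow> complex \<Rightarrow> real \<Rightarrow> bool" where
  here: "reach x x 0"
| extend: "reach x y L \<Longrightarrow> g \<in> faces \<Longrightarrow> y \<in> convex hull (cvert ` g) \<Longrightarrow> z \<in> convex hull (cvert ` g) \<Longrightarrow>
    reach x z (L + dist y z)"

lemma reach_trans: "reach y z M \<Longrightarrow> reach x y L \<Longrightarrow> reach x z (L + M)"
proof (induction rule: reach.induct)
  case (extend y' y M g z)
  from reach.extend[OF extend.IH[OF extend.prems] extend.hyps(2-4)] show ?case by (simp add: add.assoc)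
qed simp

lemma reach_path:
  assumes "reach x y L"
  shows "\<exists>n p f. face_path x y n p f \<and> (\<Sum>m<n. face_dist unit_metric (f m) (p m) (p (Suc m))) = L"
  using assms
proof induction
  case (here x)
  show ?case by (intro exI[of _ 0] exI[of _ "\<lambda>_. x"]) (simp add: face_path_def)
next
  case (extend x y L g z)
  then obtain n p f where p: "face_path x y n p f" "(\<Sum>m<n. face_dist unit_metric (f m) (p m) (p (Suc m))) = L"
    by blast
  define p' f' where "p' = p(Suc n := z)" and "f' = f(n := cvert ` g)"
  have "face_path x z (Suc n) p' f'"
    using p(1) extend.hyps(2-4) unfolding face_path_def p'_def f'_def hex_F_iff by (auto simp: less_Suc_eq)
  moreover have "(\<Sum>m<Suc n. face_dist unit_metric (f' m) (p' m) (p' (Suc m))) = L + dist y z"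
  proof -
    have "(\<Sum>m<n. face_dist unit_metric (f' m) (p' m) (p' (Suc m))) = L"
      unfolding p(2)[symmetric] by (intro sum.cong) (auto simp: p'_def f'_def)
    moreover have "face_dist unit_metric (f' n) (p' n) (p' (Suc n)) = dist y z"
      using face_dist_unit[OF extend.hyps(2-4)] p(1) by (simp add: p'_def f'_def face_path_def)
    ultimately show ?thesis by simp
  qed
  ultimately show ?case by blast
qed

lemma finite_near_vertices: "finite {v. dist (cvert v) z \<le> R}"
proof -
  have "{v. dist (cvert v) z \<le> R} \<subseteq>
      {\<lfloor>coord1 z - 2 * R\<rfloor>..\<lceil>coord1 z + 2 * R\<rceil>} \<times> {\<lfloor>coord2 z - 2 * R\<rfloor>..\<lceil>coord2 z + 2 * R\<rceil>}"
  proof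
    fix v assume v: "v \<in> {v. dist (cvert v) z \<le> R}"
    define d where "d = cvert v - z"
    have d: "\<bar>Re d\<bar> \<le> R" "\<bar>Im d\<bar> \<le> R"
      using v abs_Re_le_cmod[of d] abs_Im_le_cmod[of d] by (auto simp: d_def dist_norm)
    have s3: "1 \<le> sqrt 3" by simp
    have "\<bar>Im d / sqrt 3\<bar> \<le> \<bar>Im d\<bar> / 1" unfolding abs_divide using s3 by (intro divide_left_mono) auto
    then have i: "\<bar>Im d / sqrt 3\<bar> \<le> R" using d by simp
    have "of_int (fst v) - coord1 z = Re d - Im d / sqrt 3" "of_int (snd v) - coord2 z = 2 * (Im d / sqrt 3)"
      unfolding coord_cvert[symmetric] coord1_def coord2_def d_def by (simp_all add: diff_divide_distrib)
    then have "\<bar>of_int (fst v) - coord1 z\<bar> \<le> 2 * R" "\<bar>of_int (snd v) - coord2 z\<bar> \<le> 2 * R"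
      using d i by linarith+
    then have "fst v \<in> {\<lfloor>coord1 z - 2 * R\<rfloor>..\<lceil>coord1 z + 2 * R\<rceil>}" "snd v \<in> {\<lfloor>coord2 z - 2 * R\<rfloor>..\<lceil>coord2 z + 2 * R\<rceil>}"
      unfolding atLeastAtMost_iff by linarith+
    then show "v \<in> {\<lfloor>coord1 z - 2 * R\<rfloor>..\<lceil>coord1 z + 2 * R\<rceil>} \<times> {\<lfloor>coord2 z - 2 * R\<rfloor>..\<lceil>coord2 z + 2 * R\<rceil>}"
      by (simp add: mem_Times_iff)
  qed
  then show ?thesis by (rule finite_subset) simp
qed

lemma face_diameter:
  assumes "g \<in> faces" "z \<in> convex hull (cvert ` g)" "v \<in> g"
  shows "dist (cvert v) z \<le> 1"
proof -
  have "cvert w \<in> cball (cvert v) 1" if "w \<in> g" for w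
    using faces_adj[OF assms(1,3) that] dist_cvert[of v w] by (cases "v = w") auto
  then have "convex hull (cvert ` g) \<subseteq> cball (cvert v) 1" by (intro hull_minimal) auto
  then show ?thesis using assms(2) by auto
qed

text \<open>Only finitely many faces come within distance 1 of \<open>z\<close> without containing
  it; their union is closed and misses a ball around \<open>z\<close>.\<close>

lemma local_star:
  "\<exists>e>0. \<forall>z'. dist z z' < e \<longrightarrow> (\<exists>g\<in>faces. z \<in> convex hull (cvert ` g) \<and> z' \<in> convex hull (cvert ` g))"
proof -
  define G where "G = {g \<in> faces. (\<exists>y\<in>convex hull (cvert ` g). dist z y \<le> 1) \<and> z \<notin> convex hull (cvert ` g)}"
  have "G \<subseteq> Pow {v. dist (cvert v) z \<le> 2}"
  proof (intro subsetI PowI CollectI)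
    fix g v assume g: "g \<in> G" and v: "v \<in> g"
    obtain y where y: "g \<in> faces" "y \<in> convex hull (cvert ` g)" "dist z y \<le> 1" using g unfolding G_def by blast
    show "dist (cvert v) z \<le> 2"
      using face_diameter[OF y(1,2) v] y(3) dist_triangle[of "cvert v" z y] by (simp add: dist_commute)
  qed
  then have finG: "finite G" by (rule finite_subset) (simp add: finite_near_vertices)
  have "closed (\<Union>g\<in>G. convex hull (cvert ` g))"
  proof (rule closed_UN[OF finG], rule ballI)
    fix g assume "g \<in> G"
    then have "finite (cvert ` g)" unfolding G_def using finite_face by blast
    then show "closed (convex hull (cvert ` g))"
      by (rule compact_imp_closed[OF finite_imp_compact_convex_hull])
  qed
  moreover have "z \<notin> (\<Union>g\<in>G. convex hull (cvert ` g))" by (auto simp: G_def)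
  ultimately obtain e where "0 < e" "ball z e \<subseteq> - (\<Union>g\<in>G. convex hull (cvert ` g))"
    using open_contains_ball[of "- (\<Union>g\<in>G. convex hull (cvert ` g))"] open_Compl by blast
  then have e: "0 < e" "\<And>y. dist y z < e \<Longrightarrow> y \<notin> (\<Union>g\<in>G. convex hull (cvert ` g))"
    by (auto simp: subset_iff dist_commute)
  show ?thesis
  proof (intro exI[of _ "min e 1"] conjI allI impI)
    fix z' assume z': "dist z z' < min e 1"
    obtain g where g: "g \<in> faces" "z' \<in> convex hull (cvert ` g)" using faces_cover by blast
    have "z \<in> convex hull (cvert ` g)"
    proof (rule ccontr)
      assume "z \<notin> convex hull (cvert ` g)"
      then have "g \<in> G" unfolding G_def using g z' by (auto intro!: bexI[of _ z'])
      then show False using e(2)[of z'] z' g(2) by (auto simp: dist_commute)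
    qed
    then show "\<exists>g\<in>faces. z \<in> convex hull (cvert ` g) \<and> z' \<in> convex hull (cvert ` g)" using g by blast
  qed (use e in simp)
qed

text \<open>Bisection of the segment: near each of its points \<open>local_star\<close> gives one
  face on either side, both containing that point, and adjacent pieces concatenate.\<close>

lemma reach_straight: "reach x y (dist x y)"
proof -
  define \<gamma> where "\<gamma> t = x + t *\<^sub>R (y - x)" for t
  have d: "dist (\<gamma> s) (\<gamma> t) = \<bar>t - s\<bar> * dist x y" for s t
  proof -
    have "\<gamma> s - \<gamma> t = (s - t) *\<^sub>R (y - x)" by (simp add: \<gamma>_def algebra_simps)
    then show ?thesis by (simp add: dist_norm norm_minus_commute abs_minus_commute)
  qed
  have "reach (\<gamma> 0) (\<gamma> 1) ((1 - 0) * dist x y)"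
  proof (rule Bolzano[of 0 1 "\<lambda>s t. reach (\<gamma> s) (\<gamma> t) ((t - s) * dist x y)"])
    fix a b c assume "reach (\<gamma> a) (\<gamma> b) ((b - a) * dist x y)" "reach (\<gamma> b) (\<gamma> c) ((c - b) * dist x y)"
    from reach_trans[OF this(2,1)] show "reach (\<gamma> a) (\<gamma> c) ((c - a) * dist x y)"
      by (simp add: algebra_simps)
  next
    fix t :: real
    obtain e where e: "0 < e" "\<And>z'. dist (\<gamma> t) z' < e \<Longrightarrow>
        \<exists>g\<in>faces. \<gamma> t \<in> convex hull (cvert ` g) \<and> z' \<in> convex hull (cvert ` g)"
      using local_star by blast
    define \<delta> where "\<delta> = e / (dist x y + 1)"
    have \<delta>: "0 < \<delta>" using e by (simp add: \<delta>_def add_nonneg_pos)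
    have near: "dist (\<gamma> t) (\<gamma> s) < e" if "\<bar>s - t\<bar> < \<delta>" for s
    proof -
      have "\<bar>s - t\<bar> * dist x y \<le> \<bar>s - t\<bar> * (dist x y + 1)" by (intro mult_left_mono) auto
      also have "\<dots> < \<delta> * (dist x y + 1)" using that by (intro mult_strict_right_mono) (auto simp: add_nonneg_pos)
      also have "\<dots> = e" by (simp add: \<delta>_def add_nonneg_eq_0_iff)
      finally show ?thesis unfolding d .
    qed
    have "reach (\<gamma> a) (\<gamma> b) ((b - a) * dist x y)" if ab: "a \<le> t" "t \<le> b" "b - a < \<delta>" for a b
    proof -
      obtain g where g: "g \<in> faces" "\<gamma> t \<in> convex hull (cvert ` g)" "\<gamma> a \<in> convex hull (cvert ` g)"
        using e(2)[OF near[of a]] ab by auto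
      obtain h where h: "h \<in> faces" "\<gamma> t \<in> convex hull (cvert ` h)" "\<gamma> b \<in> convex hull (cvert ` h)"
        using e(2)[OF near[of b]] ab by auto
      have "reach (\<gamma> a) (\<gamma> b) (0 + dist (\<gamma> a) (\<gamma> t) + dist (\<gamma> t) (\<gamma> b))"
        by (rule reach.extend[OF reach.extend[OF reach.here g(1,3,2)] h])
      moreover have "0 + dist (\<gamma> a) (\<gamma> t) + dist (\<gamma> t) (\<gamma> b) = (b - a) * dist x y"
        unfolding d using ab by (simp add: algebra_simps)
      ultimately show ?thesis by simp
    qed
    then show "\<exists>\<delta>>0. \<forall>a b. a \<le> t \<and> t \<le> b \<and> b - a < \<delta> \<longrightarrow> reach (\<gamma> a) (\<gamma> b) ((b - a) * dist x y)"
      using \<delta> by blast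
  qed simp
  then show ?thesis by (simp add: \<gamma>_def)
qed

lemma face_path_exists: "\<exists>n p f. face_path x y n p f"
  using reach_path[OF reach_straight[of x y]] by blast

lemma intrinsic_dist_le:
  assumes "face_path x y n p f"
  shows "intrinsic_dist l x y \<le> (\<Sum>m<n. face_dist l (f m) (p m) (p (Suc m)))"
  unfolding intrinsic_dist_def
proof (rule cInf_lower)
  show "bdd_below {\<Sum>m<n. face_dist l (f m) (p m) (p (Suc m)) |n p f. face_path x y n p f}"
    by (intro bdd_belowI[of _ 0]) (auto intro!: sum_nonneg face_dist_nonneg)
qed (use assms in blast)

lemma intrinsic_dist_ge:
  assumes "\<And>n p f. face_path x y n p f \<Longrightarrow> r \<le> (\<Sum>m<n. face_dist l (f m) (p m) (p (Suc m)))"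
  shows "r \<le> intrinsic_dist l x y"
  unfolding intrinsic_dist_def
proof (rule cInf_greatest)
  show "{\<Sum>m<n. face_dist l (f m) (p m) (p (Suc m)) |n p f. face_path x y n p f} \<noteq> {}"
    using face_path_exists[of x y] by blast
qed (use assms in blast)

lemma intrinsic_dist_unit: "intrinsic_dist unit_metric x y = dist x y"
proof (rule antisym)
  show "intrinsic_dist unit_metric x y \<le> dist x y"
    using reach_path[OF reach_straight[of x y]] intrinsic_dist_le by metis
  show "dist x y \<le> intrinsic_dist unit_metric x y"
  proof (rule intrinsic_dist_ge)
    fix n p f assume p: "face_path x y n p f"
    have "dist (p 0) (p k) \<le> (\<Sum>m<k. face_dist unit_metric (f m) (p m) (p (Suc m)))" if "k \<le> n" for k
      using that
    proof (induction k)
      case (Suc k)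
      have "f k \<in> hex_F" "p k \<in> convex hull (f k)" "p (Suc k) \<in> convex hull (f k)"
        using p Suc.prems unfolding face_path_def by auto
      moreover from this(1) obtain g where "g \<in> faces" "f k = cvert ` g" unfolding hex_F_iff by blast
      ultimately have "face_dist unit_metric (f k) (p k) (p (Suc k)) = dist (p k) (p (Suc k))"
        using face_dist_unit by simp
      then show ?case using Suc dist_triangle[of "p 0" "p (Suc k)" "p k"] by simp
    qed simp
    from this[of n] show "dist x y \<le> (\<Sum>m<n. face_dist unit_metric (f m) (p m) (p (Suc m)))"
      using p by (simp add: face_path_def)
  qed
qed

section \<open>The main theorem\<close>

lemma heron_shift: "heron (a + e) (b + e) (c + e) = heron a b c + 2 * e * (a + b + c) + 3 * e\<^sup>2"
  by (simp add: heron_def power2_eq_square algebra_simps)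

text \<open>
  Adding a constant to \<open>X\<close> makes all triangles and the Delaunay condition strict, and destroys only the
  flatness, which the strip argument does not use; the bound then passes to the limit for each fixed path.
\<close>

lemma intrinsic_dist_vertices:
  assumes X: "hexflat X" and l: "edge_metric X l" and vw: "v \<noteq> w"
  shows "1 / (4 * X v) \<le> intrinsic_dist l (cvert v) (cvert w)"
proof (rule intrinsic_dist_ge)
  fix n p f assume p: "face_path (cvert v) (cvert w) n p f"
  note pos = hexflatD(1)[OF X]
  define g where "g m = cvert -` f m" for m
  have g: "g m \<in> faces" "f m = cvert ` g m" "p m \<in> convex hull (cvert ` g m)" "p (Suc m) \<in> convex hull (cvert ` g m)"
    if "m < n" for m
  proof -
    have h: "f m \<in> hex_F" "p m \<in> convex hull (f m)" "p (Suc m) \<in> convex hull (f m)"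
      using p that unfolding face_path_def by auto
    from h(1) obtain g' where "g' \<in> faces" "f m = cvert ` g'" unfolding hex_F_iff by blast
    moreover from this have "g m = g'" unfolding g_def by (simp add: inj_vimage_image_eq[OF inj_cvert])
    ultimately show "g m \<in> faces" "f m = cvert ` g m" "p m \<in> convex hull (cvert ` g m)"
      "p (Suc m) \<in> convex hull (cvert ` g m)" using h by simp_all
  qed
  have eq: "(\<Sum>m<n. face_dist l (f m) (p m) (p (Suc m))) = (\<Sum>m<n. face_len X (g m) (hat (p m)) (hat (p (Suc m))))"
  proof (rule sum.cong[OF refl])
    fix m assume "m \<in> {..<n}"
    then have m: "m < n" by simp
    show "face_dist l (f m) (p m) (p (Suc m)) = face_len X (g m) (hat (p m)) (hat (p (Suc m)))"
      unfolding g(2)[OF m] by (rule face_dist_eq[OF l g(1,3,4)[OF m]])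
  qed
  define e where "e k = inverse (real (Suc k))" for k
  have e: "0 < e k" for k by (simp add: e_def)
  have e0: "e \<longlonglongrightarrow> 0" unfolding e_def by (rule LIMSEQ_inverse_real_of_nat)
  \<comment> \<open>The shifted function need not be flat, so the bound on its neighbour values
    comes from \<open>X u \<le> 16 * X v\<close> before the shift.\<close>
  have main: "sqrt (1 / ((X v + e k) * (16 * X v + e k))) \<le>
      (\<Sum>m<n. face_len (\<lambda>u. X u + e k) (g m) (hat (p m)) (hat (p (Suc m))))" for k
  proof -
    interpret strict_delaunay "\<lambda>u. X u + e k" "sqrt (1 / ((X v + e k) * (16 * X v + e k)))" v
    proof
      show "0 < X u + e k" for u using pos[of u] e[of k] by simp
      show "0 < heron (X a + e k) (X b + e k) (X c + e k)" if "tri a b c" for a b c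
      proof -
        have "0 < 2 * e k * (X a + X b + X c)" using e[of k] pos[of a] pos[of b] pos[of c] by simp
        then show ?thesis unfolding heron_shift using hexflatD(2)[OF X that] e[of k] by (simp add: add_pos_nonneg add_nonneg_pos)
      qed
      show "X c + e k + (X c' + e k) \<le> 2 * (X a + e k + (X b + e k))" if "tri a b c" "tri a b c'" "c \<noteq> c'" for a b c c'
        using hexflatD(4)[OF X that] e[of k] by simp
      show "sqrt (1 / ((X v + e k) * (16 * X v + e k))) \<le> sqrt (sqlen (\<lambda>u. X u + e k) v u)" if "adj v u" for u
      proof -
        have "v \<noteq> u" using that by auto
        moreover have "(X v + e k) * (X u + e k) \<le> (X v + e k) * (16 * X v + e k)"
          using hexflat_ratio[OF X that] e[of k] pos[of v] by (intro mult_left_mono) auto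
        moreover have "0 < (X v + e k) * (X u + e k)" using e[of k] pos[of v] pos[of u] by simp
        ultimately show ?thesis by (simp add: sqlen_def frac_le)
      qed
    qed
    show ?thesis
    proof (rule vertex_path_length)
      show "g m \<in> faces \<and> bary_weights (hat (p m)) (g m) \<and> bary_weights (hat (p (Suc m))) (g m)" if "m < n" for m
        using g[OF that] hat_hull(1) by blast
      show "hat (p 0) = (\<lambda>u. if u = v then 1 else 0)" "hat (p n) = (\<lambda>u. if u = w then 1 else 0)"
        using p hat_vertex unfolding face_path_def by auto
    qed (rule vw)
  qed
  have "(\<lambda>k. sqrt (1 / ((X v + e k) * (16 * X v + e k)))) \<longlonglongrightarrow> sqrt (1 / ((X v + 0) * (16 * X v + 0)))"
    using pos[of v] by (intro tendsto_intros e0) auto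
  moreover have "(\<lambda>k. \<Sum>m<n. face_len (\<lambda>u. X u + e k) (g m) (hat (p m)) (hat (p (Suc m)))) \<longlonglongrightarrow>
      (\<Sum>m<n. face_len X (g m) (hat (p m)) (hat (p (Suc m))))"
  proof -
    have "(\<lambda>k. sqlen (\<lambda>u. X u + e k) a b) \<longlonglongrightarrow> sqlen X a b" for a b
    proof (cases "a = b")
      case False
      have "(\<lambda>k. 1 / ((X a + e k) * (X b + e k))) \<longlonglongrightarrow> 1 / ((X a + 0) * (X b + 0))"
        using pos[of a] pos[of b] by (intro tendsto_intros e0) auto
      then show ?thesis using False by (simp add: sqlen_def)
    qed (simp add: sqlen_def)
    then show ?thesis unfolding face_len_def quad_def by (intro tendsto_intros) simp_all
  qed
  ultimately have "sqrt (1 / ((X v + 0) * (16 * X v + 0))) \<le> (\<Sum>m<n. face_len X (g m) (hat (p m)) (hat (p (Suc m))))"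
    using main by (intro LIMSEQ_le) auto
  moreover have "sqrt (1 / ((X v + 0) * (16 * X v + 0))) = 1 / (4 * X v)"
  proof -
    have "1 / ((X v + 0) * (16 * X v + 0)) = (1 / (4 * X v))\<^sup>2" by (simp add: power2_eq_square)
    then show ?thesis using pos[of v] by simp
  qed
  ultimately show "1 / (4 * X v) \<le> (\<Sum>m<n. face_dist l (f m) (p m) (p (Suc m)))" unfolding eq by simp
qed

lemma intrinsic_dist_edge:
  assumes l: "edge_metric X l" and vw: "adj v w"
  shows "(intrinsic_dist l (cvert v) (cvert w))\<^sup>2 \<le> 1 / (X v * X w)"
proof -
  obtain k where k: "k < 6" "w = v + hex_dir k" using vw unfolding adj_def by blast
  have t: "tri v w (v + hex_dir (nxt k))" unfolding k(2) by (rule tri_star(1)[OF k(1)])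
  define g where "g = {v, w, v + hex_dir (nxt k)}"
  have g: "g \<in> faces" unfolding g_def by (rule tri_face[OF t])
  have h: "cvert v \<in> convex hull (cvert ` g)" "cvert w \<in> convex hull (cvert ` g)"
    by (auto intro!: hull_inc simp: g_def)
  have "face_path (cvert v) (cvert w) 1 (\<lambda>m. if m = 0 then cvert v else cvert w) (\<lambda>_. cvert ` g)"
    using g h unfolding face_path_def hex_F_iff by auto
  from intrinsic_dist_le[OF this, of l]
  have le: "intrinsic_dist l (cvert v) (cvert w) \<le> face_dist l (cvert ` g) (cvert v) (cvert w)" by simp
  have "quad X g (\<lambda>u. hat (cvert w) u - hat (cvert v) u) = sqlen X v w"
  proof -
    have "v \<noteq> w" using vw by auto
    then have "quad X g (\<lambda>u. hat (cvert w) u - hat (cvert v) u) = quad X {v, w} (\<lambda>u. hat (cvert w) u - hat (cvert v) u)"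
      by (intro quad_cong finite_face[OF g]) (auto simp: hat_vertex g_def)
    also have "\<dots> = sqlen X v w"
      using \<open>v \<noteq> w\<close> by (simp add: quad_def hat_vertex sqlen_sym[of X w v]) (simp add: sqlen_def)
    finally show ?thesis .
  qed
  then have "face_dist l (cvert ` g) (cvert v) (cvert w) = sqrt (sqlen X v w)"
    unfolding face_dist_eq[OF l g h] face_len_def by simp
  moreover have "0 \<le> intrinsic_dist l (cvert v) (cvert w)"
    by (rule intrinsic_dist_ge) (intro sum_nonneg face_dist_nonneg)
  ultimately have "(intrinsic_dist l (cvert v) (cvert w))\<^sup>2 \<le> (sqrt (sqlen X v w))\<^sup>2"
    using le by (intro power_mono) auto
  also have "\<dots> = 1 / (X v * X w)"
  proof -
    have "v \<noteq> w" using vw by auto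
    then show ?thesis using edge_metricD(1)[OF l, of v] edge_metricD(1)[OF l, of w] by (simp add: sqlen_def)
  qed
  finally show ?thesis .
qed

section \<open>The hypotheses expressed through \<open>X\<close>\<close>

lemma heron_of_sides:
  assumes "0 \<le> p" "0 \<le> q" "0 \<le> r" "p \<le> q + r" "q \<le> p + r" "r \<le> p + q"
  shows "0 \<le> heron (p\<^sup>2) (q\<^sup>2) (r\<^sup>2)"
proof -
  have "heron (p\<^sup>2) (q\<^sup>2) (r\<^sup>2) = ((p + q)\<^sup>2 - r\<^sup>2) * (r\<^sup>2 - (p - q)\<^sup>2)"
    by (simp add: heron_def power2_eq_square algebra_simps)
  moreover have "r\<^sup>2 \<le> (p + q)\<^sup>2" using assms by (intro power_mono) auto
  moreover have "\<bar>p - q\<bar>\<^sup>2 \<le> r\<^sup>2" using assms by (intro power_mono) auto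
  ultimately show ?thesis by simp
qed

text \<open>Reindexes the curvature sum over the faces at a vertex by the six directions.\<close>

lemma star_faces:
  "bij_betw (\<lambda>k. cvert ` {v, v + hex_dir k, v + hex_dir (nxt k)}) {..<6} {f \<in> hex_F. cvert v \<in> f}"
  unfolding bij_betw_def
proof (intro conjI inj_onI equalityI subsetI)
  fix j k :: nat assume jk: "j \<in> {..<6}" "k \<in> {..<6}"
    and eq: "cvert ` {v, v + hex_dir j, v + hex_dir (nxt j)} = cvert ` {v, v + hex_dir k, v + hex_dir (nxt k)}"
  have s: "{v, v + hex_dir j, v + hex_dir (nxt j)} = {v, v + hex_dir k, v + hex_dir (nxt k)}"
    using eq unfolding inj_image_eq_iff[OF inj_cvert] .
  have nz: "v + hex_dir i \<noteq> v" if "i < 6" for i using tri_distinct[OF tri_star(1)[OF that, of v]] by metis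
  have "v + hex_dir j \<in> {v, v + hex_dir k, v + hex_dir (nxt k)}" "v + hex_dir (nxt j) \<in> {v, v + hex_dir k, v + hex_dir (nxt k)}"
    unfolding s[symmetric] by simp_all
  then have "hex_dir j = hex_dir k \<or> hex_dir j = hex_dir (nxt k)" "hex_dir (nxt j) = hex_dir k \<or> hex_dir (nxt j) = hex_dir (nxt k)"
    using nz[of j] nz[of "nxt j"] jk unfolding insert_iff empty_iff add_left_cancel lessThan_iff by simp_all
  then have "(j = k \<or> j = nxt k) \<and> (nxt j = k \<or> nxt j = nxt k)"
    using hex_dir_inj jk nxt_less unfolding lessThan_iff by metis
  then show "j = k" using jk unfolding lessThan_iff less6 by (elim insertE emptyE) simp_all
next
  fix f assume "f \<in> (\<lambda>k. cvert ` {v, v + hex_dir k, v + hex_dir (nxt k)}) ` {..<6}"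
  then obtain k where k: "k < 6" "f = cvert ` {v, v + hex_dir k, v + hex_dir (nxt k)}" by auto
  have "f \<in> hex_F" unfolding hex_F_iff k(2) using tri_face[OF tri_star(1)[OF k(1), of v]] by (rule imageI)
  then show "f \<in> {f \<in> hex_F. cvert v \<in> f}" using k by simp
next
  fix f assume "f \<in> {f \<in> hex_F. cvert v \<in> f}"
  then obtain g where g: "g \<in> faces" "f = cvert ` g" "cvert v \<in> cvert ` g" unfolding hex_F_iff by blast
  then have "v \<in> g" using inj_cvert by (simp add: inj_image_mem_iff)
  then obtain b c where bc: "g = {v, b, c}" "tri v b c" using faces_elem[OF g(1)] by metis
  obtain k where k: "k < 6" "b = v + hex_dir k" using bc(2) unfolding tri_def adj_def by blast
  have "c = v + hex_dir (nxt k) \<or> c = v + hex_dir (prv k)" using bc(2) tri_dir[OF k(1)] k(2) by blast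
  then show "f \<in> (\<lambda>k. cvert ` {v, v + hex_dir k, v + hex_dir (nxt k)}) ` {..<6}"
  proof
    assume "c = v + hex_dir (nxt k)"
    then show ?thesis using g(2) bc(1) k by (intro image_eqI[of _ _ k]) simp_all
  next
    assume c: "c = v + hex_dir (prv k)"
    have "nxt (prv k) = k" using k(1) unfolding less6 by auto
    then have "f = cvert ` {v, v + hex_dir (prv k), v + hex_dir (nxt (prv k))}"
      unfolding g(2) bc(1) k(2) c by (simp add: insert_commute[of "cvert (v + hex_dir k)"])
    then show ?thesis by (rule image_eqI) simp
  qed
qed

theorem theorem1p4:
  fixes l :: "complex set \<Rightarrow> real"
  assumes "generalized_PL_metric l"
    and "PL_conformal unit_metric l"
    and "flat_metric l"
    and "complete_PL_metric l"
    and "Delaunay l"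
  shows "\<exists>C>0. \<forall>e\<in>hex_E. l e = C"
proof -
  obtain u where u: "\<And>i j. {i, j} \<in> hex_E \<Longrightarrow> l {i, j} = exp (u i + u j)"
    using assms(2) unfolding PL_conformal_def unit_metric_def by auto
  define x where "x v = exp (- u (cvert v))" for v
  define X where "X v = (x v)\<^sup>2" for v
  have x: "0 < x v" for v by (simp add: x_def)
  have X: "0 < X v" for v using x[of v] by (simp add: X_def)
  have len: "l {cvert v, cvert w} = 1 / (x v * x w)" if "adj v w" for v w
    using u[of "cvert v" "cvert w"] that unfolding hex_E_iff x_def by (simp add: exp_add exp_minus field_simps)
  have side: "x c \<le> x a + x b" if "tri a b c" for a b c
  proof -
    have adj: "adj a b" "adj b c" "adj c a" using that unfolding tri_def by auto
    have "l {cvert a, cvert b} \<le> l {cvert b, cvert c} + l {cvert c, cvert a}"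
      using assms(1) hex_F_triple[OF that] unfolding generalized_PL_metric_def by blast
    then have "1 / (x a * x b) \<le> 1 / (x b * x c) + 1 / (x c * x a)"
      unfolding adj[THEN len] .
    \<comment> \<open>Over the common denominator \<open>x a * x b * x c\<close> the face has sides
      \<open>x a\<close>, \<open>x b\<close>, \<open>x c\<close>, each opposite to its own
      vertex.\<close>
    moreover have "1 / (x a * x b) = x c / (x a * x b * x c)"
        "1 / (x b * x c) + 1 / (x c * x a) = (x a + x b) / (x a * x b * x c)"
      using x[of a] x[of b] x[of c] by (simp_all add: field_simps)
    ultimately have "x c / (x a * x b * x c) \<le> (x a + x b) / (x a * x b * x c)" by argo
    moreover have "0 < x a * x b * x c" using x by simp
    ultimately show ?thesis by (simp only: divide_le_cancel)
  qed
  have heron: "0 \<le> heron (X a) (X b) (X c)" if "tri a b c" for a b c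
  proof -
    have "tri b c a" "tri c a b" using that unfolding tri_def by auto
    then show ?thesis unfolding X_def
      using side[of b c a] side[of c a b] side[OF that] x by (intro heron_of_sides) (auto simp: less_imp_le)
  qed
  have angle: "face_angle l {cvert v, cvert a, cvert b} (cvert v) = angle_sq (X v) (X a) (X b)"
    if "tri v a b" for v a b
  proof -
    have d: "cvert v \<noteq> cvert a" "cvert a \<noteq> cvert b" "cvert b \<noteq> cvert v"
      using tri_distinct[OF that] inj_cvert by (auto simp: inj_eq)
    have adj: "adj v a" "adj v b" "adj a b" using that adj_sym[of b v] unfolding tri_def by auto
    have "sqrt (X a * X b) = x a * x b" unfolding X_def using x[of a] x[of b] by (simp add: real_sqrt_mult)
    then have "((1 / (x v * x a))\<^sup>2 + (1 / (x v * x b))\<^sup>2 - (1 / (x a * x b))\<^sup>2) / (2 * (1 / (x v * x a) * (1 / (x v * x b))))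
        = (X a + X b - X v) / (2 * sqrt (X a * X b))"
      using x[of v] x[of a] x[of b] by (simp add: X_def field_simps power2_eq_square)
    then show ?thesis
      unfolding face_angle_triple[OF d] adj[THEN len] angle_sq_def by (rule arg_cong)
  qed
  have sum: "(\<Sum>k<6. angle_sq (X v) (X (v + hex_dir k)) (X (v + hex_dir (nxt k)))) = 2 * pi" for v
  proof -
    have "(\<Sum>k<6. angle_sq (X v) (X (v + hex_dir k)) (X (v + hex_dir (nxt k)))) =
        (\<Sum>k<6. face_angle l (cvert ` {v, v + hex_dir k, v + hex_dir (nxt k)}) (cvert v))"
      using angle[OF tri_star(1)] by (intro sum.cong) auto
    also have "\<dots> = (\<Sum>f\<in>{f \<in> hex_F. cvert v \<in> f}. face_angle l f (cvert v))"
      by (rule sum.reindex_bij_betw[OF star_faces])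
    also have "\<dots> = 2 * pi"
      using assms(3) unfolding flat_metric_def curvature_def hex_V_iff by auto
    finally show ?thesis .
  qed
  have del: "X c + X c' \<le> 2 * (X a + X b)" if t: "tri a b c" "tri a b c'" "c \<noteq> c'" for a b c c'
  proof -
    have t': "tri c a b" "tri c' a b" using t unfolding tri_def by auto
    have "{cvert a, cvert b} \<in> hex_E" using t unfolding hex_E_iff tri_def by auto
    moreover have "cvert c \<noteq> cvert c'" using t(3) inj_cvert by (auto simp: inj_eq)
    ultimately have "face_angle l {cvert a, cvert b, cvert c} (cvert c) + face_angle l {cvert a, cvert b, cvert c'} (cvert c') \<le> pi"
      using assms(5) hex_F_triple[OF t(1)] hex_F_triple[OF t(2)] unfolding Delaunay_def by blast
    moreover have "{cvert a, cvert b, d} = {d, cvert a, cvert b}" for d by auto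
    ultimately have le: "angle_sq (X c) (X a) (X b) + angle_sq (X c') (X a) (X b) \<le> pi"
      using angle[OF t'(1)] angle[OF t'(2)] by simp
    let ?s = "2 * sqrt (X a * X b)"
    have r: "(X a + X b - X c) / ?s \<in> {-1..1}" "(X a + X b - X c') / ?s \<in> {-1..1}"
      by (intro angle_sq_arg X heron t')+
    \<comment> \<open>Opposite angles summing to at most \<open>pi\<close> means a nonnegative sum
      of cosines; both have the denominator \<open>?s\<close>, which leaves a linear
      inequality.\<close>
    have "arccos ((X a + X b - X c') / ?s) \<le> arccos (- ((X a + X b - X c) / ?s))"
      using le r(1) arccos_minus[of "(X a + X b - X c) / ?s"] unfolding angle_sq_def by simp
    then have "- ((X a + X b - X c) / ?s) \<le> (X a + X b - X c') / ?s"
      using r by (subst (asm) arccos_le_mono) auto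
    then have "0 \<le> ((X a + X b - X c) + (X a + X b - X c')) / ?s"
      unfolding add_divide_distrib[of "X a + X b - X c"] by linarith
    moreover have "0 < ?s" using X[of a] X[of b] by simp
    ultimately show ?thesis by (simp add: zero_le_divide_iff)
  qed
  have hex: "hexflat X" unfolding hexflat_def by (intro conjI allI impI X heron sum del)
  have em: "edge_metric X l" unfolding edge_metric_def
  proof (intro conjI allI impI X heron)
    fix v w assume a: "adj v w"
    then have "v \<noteq> w" by auto
    then show "0 \<le> l {cvert v, cvert w}" "(l {cvert v, cvert w})\<^sup>2 = sqlen X v w"
      using x[of v] x[of w] unfolding len[OF a] by (simp_all add: sqlen_def X_def power_divide power_mult_distrib)
  qed
  obtain F :: "complex \<Rightarrow> complex" where F: "\<And>y z. dist (F y) (F z) = intrinsic_dist l y z"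
    using assms(4) unfolding complete_PL_metric_def PL_isometric_def intrinsic_dist_unit by blast
  have "immersed X (\<lambda>v. F (cvert v))"
    unfolding immersed_def F
  proof (intro conjI allI impI hex intrinsic_dist_edge[OF em])
    fix v w :: "int \<times> int" assume "v \<noteq> w"
    from intrinsic_dist_vertices[OF hex em this]
    have "(1 / (4 * X v))\<^sup>2 \<le> (intrinsic_dist l (cvert v) (cvert w))\<^sup>2"
      using X[of v] by (intro power_mono) auto
    then show "1 / (16 * (X v)\<^sup>2) \<le> (intrinsic_dist l (cvert v) (cvert w))\<^sup>2"
      by (simp add: power_divide power_mult_distrib)
  qed
  from immersed_constant[OF this] have "X v = X w" for v w .
  then have const: "x v = x 0" for v
    unfolding X_def using x[of v] x[of 0] by (metis less_imp_le power2_eq_iff_nonneg)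
  have "l e = 1 / (x 0 * x 0)" if e: "e \<in> hex_E" for e
  proof -
    obtain i j where "e = {i, j}" using e unfolding hex_E_def by blast
    moreover from this e obtain v w where "i = cvert v" "j = cvert w" "adj v w" using hex_E_cases by metis
    ultimately show ?thesis using len[of v w] const[of v] const[of w] by simp
  qed
  moreover have "0 < 1 / (x 0 * x 0)" using x[of 0] by simp
  ultimately show ?thesis by blast
qed

end
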